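(* For every integer $n\ge 5$, $$|D_b(n)|=|D(n)|-|D_0(n-2)|-\sum_{N\in I''_e(n)}|P(N-2n+3,\,n-3,\,n-1,\,1)|-\sum_{i=4}^{n-1}\ \sum_{\substack{0\le j\le i-4\\ j\equiv i \ (\mathrm{mod}\ 2)}}|P(j)|,$$ where $I''_e(n)=\{N : 2n-3\le N\le n(n-2),\ N \text{ an even integer}\}$. Moreover, there is an algorithm which, given $n\ge 5$ and the values $|D(i)|$ for all $i\le n$, computes $|D_b(n)|$ in time $O(n^5)$ and space $O(n^5)$.
   Context: All graphs are finite, simple (no loops or multiple edges) and undirected. Degree sequences are unordered (i.e. regarded as multisets, written in non-increasing order). $D(n)$ is the set of zero-free degree sequences of length $n$: those sequences $d_1\ge d_2\ge\dots\ge d_n\ge 1$ of positive integers that are the vertex degrees of some graph on $n$ vertices. $D_0(n)$ is the set of degree sequences of length $n$ of graphs on $n$ vertices, where zero terms are allowed. $D_b(n)$ is the set of degree sequences of biconnected (i.e. $2$-connected: connected with no cut vertex) graphs on $n$ vertices. A partition of an integer $N\ge 0$ is a non-increasing sequence of positive integers (parts) with sum $N$ (the empty partition is the only partition of $0$). $P(j)$ is the set of all partitions of $j$ (so $|P(0)|=1$). For a partition $\pi$, $\pi_i$ and $\pi_i'$ denote the number of dots in the $i$-th row and the $i$-th column of its Ferrers diagram (so $\pi_i$ is the $i$-th part and $\pi'$ is the conjugate partition), $d(\pi)$ is the size (number of rows) of its Durfee square, i.e. of the largest upper-left square contained in its Ferrers diagram, and $r_i(\pi)=\pi_i'-\pi_i$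 for $1\le i\le d(\pi)$. $P(N,k,l)$ is the set of partitions of $N$ into at most $l$ parts with largest part at most $k$ (empty if $N<0$, $k<0$ or $l<0$). For an integer $s$, $P(N,k,l,s)=\emptyset$ if $s<0$, and if $s\ge 0$, $$P(N,k,l,s)=\Big\{\pi\in P(N,k,l) : s+\sum_{i=1}^{j}r_i(\pi)\ge j \text{ for all } 1\le j\le d(\pi)\Big\}.$$ Cost model: time is the number of elementary operations (arithmetic operations and comparisons of integers, array accesses), each of unit cost; space is the number of integers stored. *)

theory Defs
  imports Complex_Main "HOL-Library.Landau_Symbols"
begin

section \<open>Graphs and degree sequences\<close>

definition graph :: "'a set \<Rightarrow> 'a set set \<Rightarrow> bool" where
  "graph V E \<longleftrightarrow> finite V \<and> (\<forall>e\<in>E. e \<subseteq> V \<and> card e = 2)"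

definition degree :: "'a set set \<Rightarrow> 'a \<Rightarrow> nat" where
  "degree E v = card {e \<in> E. v \<in> e}"

definition connected_graph :: "'a set \<Rightarrow> 'a set set \<Rightarrow> bool" where
  "connected_graph V E \<longleftrightarrow>
     V \<noteq> {} \<and> (\<forall>u\<in>V. \<forall>v\<in>V. (u, v) \<in> {(x, y). {x, y} \<in> E}\<^sup>*)"

text \<open>Only applied to connected graphs, where a cut vertex is a vertex whose deletion
  disconnects the graph.\<close>

definition cut_vertex :: "'a set \<Rightarrow> 'a set set \<Rightarrow> 'a \<Rightarrow> bool" where
  "cut_vertex V E v \<longleftrightarrow> v \<in> V \<and> \<not> connected_graph (V - {v}) {e \<in> E. v \<notin> e}"

definition biconnected :: "'a set \<Rightarrow> 'a set set \<Rightarrow> bool" where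
  "biconnected V E \<longleftrightarrow> connected_graph V E \<and> (\<forall>v\<in>V. \<not> cut_vertex V E v)"

text \<open>Up to isomorphism a graph on \<open>n\<close> vertices has vertex set \<open>{..<n}\<close>; its degree sequence is
  the list of vertex degrees in non-increasing order.\<close>

definition degree_sequence :: "nat \<Rightarrow> nat set set \<Rightarrow> nat list" where
  "degree_sequence n E = rev (sort (map (degree E) [0..<n]))"

definition D0 :: "nat \<Rightarrow> nat list set" where
  "D0 n = {degree_sequence n E | E. graph {..<n} E}"

definition D :: "nat \<Rightarrow> nat list set" where
  "D n = {ds \<in> D0 n. \<forall>d\<in>set ds. 1 \<le> d}"

definition Db :: "nat \<Rightarrow> nat list set" where
  "Db n = {degree_sequence n E | E. graph {..<n} E \<and> biconnected {..<n} E}"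

section \<open>Partitions\<close>

definition is_partition :: "nat list \<Rightarrow> bool" where
  "is_partition p \<longleftrightarrow> sorted_wrt (\<ge>) p \<and> (\<forall>x\<in>set p. 1 \<le> x)"

definition P_all :: "nat \<Rightarrow> nat list set" where
  "P_all j = {p. is_partition p \<and> sum_list p = j}"

text \<open>Dots of the Ferrers diagram, as (row, column), both counted from 1.\<close>

definition ferrers :: "nat list \<Rightarrow> (nat \<times> nat) set" where
  "ferrers p = {(i, j). 1 \<le> i \<and> i \<le> length p \<and> 1 \<le> j \<and> j \<le> p ! (i - 1)}"

definition row :: "nat list \<Rightarrow> nat \<Rightarrow> nat" where
  "row p i = card {j. (i, j) \<in> ferrers p}"

definition col :: "nat list \<Rightarrow> nat \<Rightarrow> nat" where
  "col p j = card {i. (i, j) \<in> ferrers p}"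

definition durfee :: "nat list \<Rightarrow> nat" where
  "durfee p = (GREATEST d. {1..d} \<times> {1..d} \<subseteq> ferrers p)"

definition r_diff :: "nat list \<Rightarrow> nat \<Rightarrow> int" where
  "r_diff p i = int (col p i) - int (row p i)"

text \<open>The conjunct \<open>0 \<le> k\<close> excludes the empty partition when \<open>k < 0\<close>; for \<open>N < 0\<close> or \<open>l < 0\<close>
  the set is empty anyway.\<close>

definition P_box :: "int \<Rightarrow> int \<Rightarrow> int \<Rightarrow> nat list set" where
  "P_box N k l = {p. is_partition p \<and> int (sum_list p) = N \<and> int (length p) \<le> l \<and>
                     0 \<le> k \<and> (\<forall>x\<in>set p. int x \<le> k)}"

definition P_res :: "int \<Rightarrow> int \<Rightarrow> int \<Rightarrow> int \<Rightarrow> nat list set" where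
  "P_res N k l s = (if s < 0 then {} else
     {p \<in> P_box N k l. \<forall>j. 1 \<le> j \<and> j \<le> durfee p \<longrightarrow> s + (\<Sum>i=1..j. r_diff p i) \<ge> int j})"

definition I_even :: "nat \<Rightarrow> int set" where
  "I_even n = {N. 2 * int n - 3 \<le> N \<and> N \<le> int n * (int n - 2) \<and> even N}"

section \<open>Cost model\<close>

text \<open>Algorithms are programs of a small imperative language over unbounded integers, held in
  scalar variables and in integer-indexed arrays. Every arithmetic operation, comparison and array
  access costs one unit of time; in addition a unit is charged for each constant, variable access
  and assignment, which changes running times only by a constant factor.\<close>

datatype loc = Scalar string | Cell string int

type_synonym state = "loc \<Rightarrow> int"

datatype arith = Add | Sub | Mul | Div | Mod

datatype aexp = Const int | Var string | Arr string aexp | Op arith aexp aexp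

datatype cmp = Less | LessEq | Equal

datatype bexp = Cmp cmp aexp aexp

datatype com =
    Skip
  | Assign string aexp
  | Store string aexp aexp  \<comment> \<open>\<open>Store a i e\<close> is \<open>a[i] := e\<close>\<close>
  | Seq com com
  | Cond bexp com com
  | While bexp com

fun arith_val :: "arith \<Rightarrow> int \<Rightarrow> int \<Rightarrow> int" where
  "arith_val Add x y = x + y"
| "arith_val Sub x y = x - y"
| "arith_val Mul x y = x * y"
| "arith_val Div x y = x div y"
| "arith_val Mod x y = x mod y"

fun cmp_val :: "cmp \<Rightarrow> int \<Rightarrow> int \<Rightarrow> bool" where
  "cmp_val Less x y \<longleftrightarrow> x < y"
| "cmp_val LessEq x y \<longleftrightarrow> x \<le> y"
| "cmp_val Equal x y \<longleftrightarrow> x = y"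

fun aval :: "aexp \<Rightarrow> state \<Rightarrow> int" where
  "aval (Const k) s = k"
| "aval (Var x) s = s (Scalar x)"
| "aval (Arr a i) s = s (Cell a (aval i s))"
| "aval (Op f e1 e2) s = arith_val f (aval e1 s) (aval e2 s)"

fun acost :: "aexp \<Rightarrow> nat" where
  "acost (Const k) = 1"
| "acost (Var x) = 1"
| "acost (Arr a i) = acost i + 1"
| "acost (Op f e1 e2) = acost e1 + acost e2 + 1"

fun alocs :: "aexp \<Rightarrow> state \<Rightarrow> loc set" where
  "alocs (Const k) s = {}"
| "alocs (Var x) s = {Scalar x}"
| "alocs (Arr a i) s = insert (Cell a (aval i s)) (alocs i s)"
| "alocs (Op f e1 e2) s = alocs e1 s \<union> alocs e2 s"

fun bval :: "bexp \<Rightarrow> state \<Rightarrow> bool" where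
  "bval (Cmp f e1 e2) s = cmp_val f (aval e1 s) (aval e2 s)"

fun bcost :: "bexp \<Rightarrow> nat" where
  "bcost (Cmp f e1 e2) = acost e1 + acost e2 + 1"

fun blocs :: "bexp \<Rightarrow> state \<Rightarrow> loc set" where
  "blocs (Cmp f e1 e2) s = alocs e1 s \<union> alocs e2 s"

text \<open>\<open>exec c s t L s'\<close>: started in \<open>s\<close>, the program \<open>c\<close> terminates in \<open>s'\<close> after time \<open>t\<close>, and \<open>L\<close>
  is the set of all locations read or written on the way. The space used is the number of these
  locations (nothing is ever deallocated).\<close>

inductive exec :: "com \<Rightarrow> state \<Rightarrow> nat \<Rightarrow> loc set \<Rightarrow> state \<Rightarrow> bool" where
  Skip: "exec Skip s 1 {} s"
| Assign: "exec (Assign x e) s (acost e + 1) (insert (Scalar x) (alocs e s))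
             (s(Scalar x := aval e s))"
| Store: "exec (Store a i e) s (acost i + acost e + 1)
            (insert (Cell a (aval i s)) (alocs i s \<union> alocs e s))
            (s(Cell a (aval i s) := aval e s))"
| Seq: "exec c1 s t1 L1 s1 \<Longrightarrow> exec c2 s1 t2 L2 s2 \<Longrightarrow>
          exec (Seq c1 c2) s (t1 + t2) (L1 \<union> L2) s2"
| CondTrue: "bval b s \<Longrightarrow> exec c1 s t L s' \<Longrightarrow>
          exec (Cond b c1 c2) s (bcost b + t) (blocs b s \<union> L) s'"
| CondFalse: "\<not> bval b s \<Longrightarrow> exec c2 s t L s' \<Longrightarrow>
          exec (Cond b c1 c2) s (bcost b + t) (blocs b s \<union> L) s'"
| WhileFalse: "\<not> bval b s \<Longrightarrow> exec (While b c) s (bcost b) (blocs b s) s"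
| WhileTrue: "bval b s \<Longrightarrow> exec c s t1 L1 s1 \<Longrightarrow> exec (While b c) s1 t2 L2 s2 \<Longrightarrow>
          exec (While b c) s (bcost b + t1 + t2) (blocs b s \<union> L1 \<union> L2) s2"

lemma finite_alocs: "finite (alocs e s)"
  by (induction e) auto

lemma exec_finite: "exec c s t L s' \<Longrightarrow> finite L"
proof (induction rule: exec.induct)
  case (CondTrue b s c1 t L s' c2) then show ?case by (cases b) (auto simp: finite_alocs)
next
  case (CondFalse b s c2 t L s' c1) then show ?case by (cases b) (auto simp: finite_alocs)
next
  case (WhileFalse b s c) then show ?case by (cases b) (auto simp: finite_alocs)
next
  case (WhileTrue b s c t1 L1 s1 t2 L2 s2) then show ?case by (cases b) (auto simp: finite_alocs)
qed (auto simp: finite_alocs)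

inductive_cases SkipE: "exec Skip s t L s'"
inductive_cases AssignE: "exec (Assign x e) s t L s'"
inductive_cases StoreE: "exec (Store a i e) s t L s'"
inductive_cases SeqE: "exec (Seq c1 c2) s t L s'"
inductive_cases CondE: "exec (Cond b c1 c2) s t L s'"
inductive_cases WhileE: "exec (While b c) s t L s'"

lemma exec_deterministic:
  "exec c s t L s' \<Longrightarrow> exec c s u M s'' \<Longrightarrow> u = t \<and> M = L \<and> s'' = s'"
proof (induction arbitrary: u M s'' rule: exec.induct)
  case Skip then show ?case by (auto elim: SkipE)
next
  case Assign then show ?case by (auto elim: AssignE)
next
  case Store then show ?case by (auto elim: StoreE)
next
  case Seq from Seq.prems show ?case by (rule SeqE) (use Seq.IH in blast)
next
  case CondTrue from CondTrue.prems show ?case by (rule CondE) (use CondTrue in blast)+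
next
  case CondFalse from CondFalse.prems show ?case by (rule CondE) (use CondFalse in blast)+
next
  case WhileFalse from WhileFalse.prems show ?case by (rule WhileE) (use WhileFalse in auto)
next
  case WhileTrue from WhileTrue.prems show ?case by (rule WhileE) (use WhileTrue in blast)+
qed

text \<open>The input consists of \<open>n\<close> and of \<open>|D(i)|\<close> for \<open>1 \<le> i \<le> n\<close>; all other locations are 0.\<close>

definition input :: "nat \<Rightarrow> state" where
  "input n l = (case l of
       Scalar x \<Rightarrow> (if x = ''n'' then int n else 0)
     | Cell a i \<Rightarrow> (if a = ''D'' \<and> 1 \<le> i \<and> i \<le> int n then int (card (D (nat i))) else 0))"

text \<open>The result is read from the scalar variable \<open>result\<close>.\<close>

definition computes_Db :: "com \<Rightarrow> (nat \<Rightarrow> nat) \<Rightarrow> (nat \<Rightarrow> nat) \<Rightarrow> bool" where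
  "computes_Db c time space \<longleftrightarrow>
     (\<forall>n\<ge>5. \<exists>t L s. exec c (input n) t L s \<and> s (Scalar ''result'') = int (card (Db n)) \<and>
        t \<le> time n \<and> card L \<le> space n)"

end

(*
  A graphic sequence of length n >= 3 is realized by a biconnected graph iff its terms are at least 2
  and its sum is at least 2 (n - 2 + d_1).  Necessity counts the edges of the connected graph that is
  left after deleting a vertex.  For sufficiency, let deleting v disconnect a realization.  One
  component C1 then has an edge ab that lies on a cycle avoiding v, because too many edges remain for a
  forest; another component C2 has an edge xy on a cycle in C2 + v, because its vertices have degree at
  least 2.  Exchanging ab, xy for ax, by keeps connected whatever was connected before, for every
  deleted vertex, and joins a to x after deleting v.

  The sequences in D(n) that are not biconnected are of three kinds.  Those with terms n - 1 and 1 lose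
  a dominating and then an isolated vertex, which leaves D_0(n - 2).  Those with a term 1 but no term
  n - 1 are complementary to those with largest term n - 2 and smallest term at least 1.  Those with
  terms at least 2 and small sum are (i, 2 + q_1, 2 + q_2, ...) for a partition q of some j <= i - 4 of
  the parity of i, and all of these are graphic.

  The Erdos-Gallai inequalities for a partition with first row k and first column l and with slack s
  are those for the partition without its first row and column, with slack s + l - k - 1.  This yields
  the Durfee square criterion, the sets P(N,k,l,s), and the recurrence behind the algorithm; as N is
  summed over all even numbers, only its parity has to be tabulated.
*)
theory Submission
  imports Defs "HOL-Combinatorics.Permutations"
begin

section \<open>Degrees and edge exchanges\<close>

text \<open>An exchange that joins two components after deleting \<open>v\<close> could break
  connections after deleting some other vertex, so progress is measured by all triples of a deleted
  vertex and two vertices connected without it. This is why both traded edges must lie on cycles: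
  the cycles, one in C1 and one in C2 + v, are disjoint, so any deleted vertex spoils at most one of
  them, and the other one carries the detours. The lower bound on the number of edges depends on the
  degrees only, so it survives every exchange and the process ends in a biconnected graph.

  The table has n^2 box sizes, n^2 + 1 slacks and 2 parities, with constant work per entry, which
  stays below n^5; keeping N as a further index would cost another factor of order n^2. Space needs
  no separate count, because every location touched is paid for in time.\<close>

lemma graph_finite: "graph V E \<Longrightarrow> finite V" "graph V E \<Longrightarrow> finite E"
proof -
  assume g: "graph V E"
  then show "finite V" by (simp add: graph_def)
  moreover have "E \<subseteq> Pow V" using g by (auto simp: graph_def)
  ultimately show "finite E" by (meson finite_Pow_iff finite_subset)
qed

lemma graph_edge:
  assumes "graph V E" "{u, v} \<in> E"
  shows "u \<in> V" "v \<in> V" "u \<noteq> v"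
  using assms by (auto simp: graph_def card_insert_if split: if_splits)

lemma graph_edgeE:
  assumes "graph V E" "e \<in> E"
  obtains u v where "e = {u, v}" "u \<noteq> v" "u \<in> V" "v \<in> V"
proof -
  have "card e = 2" "e \<subseteq> V" using assms by (auto simp: graph_def)
  then show ?thesis using that by (auto simp: card_2_iff)
qed

lemma graph_subset: "graph V E \<Longrightarrow> F \<subseteq> E \<Longrightarrow> graph V F"
  by (auto simp: graph_def)

lemma graph_insert: "graph V E \<Longrightarrow> u \<in> V \<Longrightarrow> v \<in> V \<Longrightarrow> u \<noteq> v \<Longrightarrow> graph V (insert {u, v} E)"
  by (auto simp: graph_def)

definition nbrs :: "'a set set \<Rightarrow> 'a \<Rightarrow> 'a set" where
  "nbrs E v = {u. {v, u} \<in> E}"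

lemma nbrs_subset: "graph V E \<Longrightarrow> nbrs E v \<subseteq> V - {v}"
  using graph_edge[of V E v] by (auto simp: nbrs_def)

lemma finite_nbrs: "graph V E \<Longrightarrow> finite (nbrs E v)"
  using nbrs_subset graph_finite(1) by (metis finite_Diff finite_subset)

lemma degree_nbrs:
  assumes "graph V E"
  shows "degree E v = card (nbrs E v)"
proof -
  have "bij_betw (\<lambda>u. {v, u}) (nbrs E v) {e \<in> E. v \<in> e}"
  proof (rule bij_betwI')
    fix e assume e: "e \<in> {e \<in> E. v \<in> e}"
    then obtain x y where "e = {x, y}" using graph_edgeE[OF assms, of e] by blast
    then have "e = {v, x} \<or> e = {v, y}" using e by auto
    then show "\<exists>x\<in>nbrs E v. e = {v, x}" using e by (auto simp: nbrs_def)
  qed (auto simp: nbrs_def doubleton_eq_iff)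
  then show ?thesis by (simp add: degree_def bij_betw_same_card)
qed

lemma degree_insert:
  assumes "finite E" "e \<notin> E"
  shows "degree (insert e E) v = degree E v + of_bool (v \<in> e)"
proof (cases "v \<in> e")
  case True
  then have "{f \<in> insert e E. v \<in> f} = insert e {f \<in> E. v \<in> f}" by auto
  then show ?thesis using True assms by (simp add: degree_def)
next
  case False
  then have "{f \<in> insert e E. v \<in> f} = {f \<in> E. v \<in> f}" by auto
  then show ?thesis using False by (simp add: degree_def)
qed

text \<open>An additive equation instead of truncated subtraction, so that several removals and
  insertions combine by linear arithmetic.\<close>

lemma degree_remove:
  assumes "finite E" "e \<in> E"
  shows "degree (E - {e}) v + of_bool (v \<in> e) = degree E v"
  using degree_insert[of "E - {e}" e v] assms by (simp add: insert_absorb)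

lemma handshake:
  assumes "graph V E"
  shows "(\<Sum>v\<in>V. degree E v) = 2 * card E"
proof -
  have fin: "finite V" "finite E" using graph_finite assms by auto
  have "(\<Sum>v\<in>V. degree E v) = (\<Sum>v\<in>V. \<Sum>e\<in>E. of_bool (v \<in> e))"
    using fin by (simp add: degree_def Int_def)
  also have "\<dots> = (\<Sum>e\<in>E. \<Sum>v\<in>V. of_bool (v \<in> e))" by (rule sum.swap)
  also have "\<dots> = (\<Sum>e\<in>E. 2)"
  proof (rule sum.cong)
    fix e assume "e \<in> E"
    then have "card e = 2" "V \<inter> {v. v \<in> e} = e" using assms by (auto simp: graph_def)
    then show "(\<Sum>v\<in>V. of_bool (v \<in> e)) = (2::nat)" using fin by simp
  qed simp
  finally show ?thesis by simp
qed

text \<open>Otherwise the only neighbour of \<open>i\<close> that \<open>r\<close> lacks is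
  \<open>r\<close> itself, and an edge between them also gives \<open>r\<close> the neighbour
  \<open>i\<close>, which \<open>i\<close> lacks. So \<open>i\<close> would have no surplus.\<close>

lemma degree_private_neighbour:
  assumes g: "graph V E" and less: "degree E r < degree E i"
  obtains u where "u \<noteq> r" "{i, u} \<in> E" "{r, u} \<notin> E"
proof (rule ccontr)
  assume c: "\<not> thesis"
  then have sub: "nbrs E i \<subseteq> insert r (nbrs E r)" using that by (auto simp: nbrs_def)
  have fin: "finite (nbrs E r)" by (rule finite_nbrs[OF g])
  have "card (nbrs E i) \<le> card (nbrs E r)"
  proof (cases "r \<in> nbrs E i")
    case True
    then have i: "i \<in> nbrs E r" by (simp add: nbrs_def insert_commute)
    have "nbrs E i \<subseteq> insert r (nbrs E r) - {i}" using sub nbrs_subset[OF g, of i] by auto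
    then have "card (nbrs E i) \<le> card (insert r (nbrs E r) - {i})" using fin by (intro card_mono) auto
    also have "\<dots> = card (nbrs E r)"
      using i fin nbrs_subset[OF g, of r] by (subst card_Diff_singleton) (auto simp: card_insert_if)
    finally show ?thesis .
  next
    case False
    then have "nbrs E i \<subseteq> nbrs E r" using sub by auto
    then show ?thesis using fin card_mono by blast
  qed
  then show False using less by (simp add: degree_nbrs[OF g])
qed

section \<open>The Erdos--Gallai theorem\<close>

text \<open>The constructive argument of Tripathi, Venugopalan and West: vertices are saturated in order,
  \<open>r\<close> is the first one whose degree may be too small, and the vertices after \<open>r\<close> stay independent.
  If no exchange of edges raises the degree of \<open>r\<close>, then the vertices up to \<open>r\<close> form a clique, the
  later ones have degree \<open>min (d k) (Suc r)\<close>, and the inequality for \<open>Suc r\<close> saturates \<open>r\<close>.\<close>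

definition subrealization :: "nat \<Rightarrow> (nat \<Rightarrow> nat) \<Rightarrow> nat \<Rightarrow> nat set set \<Rightarrow> bool" where
  "subrealization n d r E \<longleftrightarrow> graph {..<n} E \<and> (\<forall>i<n. degree E i \<le> d i) \<and>
     (\<forall>i<r. degree E i = d i) \<and> (\<forall>u v. r < u \<longrightarrow> r < v \<longrightarrow> {u, v} \<notin> E)"

lemma erdos_gallai_step:
  fixes d :: "nat \<Rightarrow> nat"
  assumes sub: "subrealization n d r E" and r: "r < n" and less: "degree E r < d r"
    and mono: "\<And>i j. i \<le> j \<Longrightarrow> j < n \<Longrightarrow> d j \<le> d i"
    and even: "even (\<Sum>i<n. d i)"
    and eg: "(\<Sum>i\<le>r. d i) \<le> Suc r * r + (\<Sum>i\<in>{r<..<n}. min (d i) (Suc r))"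
  shows "\<exists>E'. subrealization n d r E' \<and> degree E r < degree E' r"
proof (rule ccontr)
  assume "\<not> ?thesis"
  then have stuck: "False" if "subrealization n d r E'" "degree E r < degree E' r" for E'
    using that by blast
  have g: "graph {..<n} E" and le: "\<And>i. i < n \<Longrightarrow> degree E i \<le> d i"
    and sat: "\<And>i. i < r \<Longrightarrow> degree E i = d i"
    and ind: "\<And>u v. r < u \<Longrightarrow> r < v \<Longrightarrow> {u, v} \<notin> E"
    using sub by (auto simp: subrealization_def)
  have fin: "finite E" using graph_finite g by blast
  have edge: "u < n" "v < n" "u \<noteq> v" if "{u, v} \<in> E" for u v
    using graph_edge[OF g that] by auto
  have sym: "{u, v} \<in> E \<longleftrightarrow> {v, u} \<in> E" for u v by (simp add: insert_commute)
  \<comment> \<open>Otherwise the edge could simply be added; it ends in \<open>r\<close>, so the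
    vertices after \<open>r\<close> stay independent.\<close>
  have c0: "{r, k} \<in> E" if k: "r < k" "k < n" "degree E k < d k" for k
  proof (rule ccontr)
    assume n: "{r, k} \<notin> E"
    let ?E = "insert {r, k} E"
    have deg: "degree ?E x = degree E x + of_bool (x \<in> {r, k})" for x
      using degree_insert[OF fin n] .
    show False
    proof (rule stuck)
      have "graph {..<n} ?E" using graph_insert[OF g] r k by simp
      moreover have "\<forall>u v. r < u \<longrightarrow> r < v \<longrightarrow> {u, v} \<notin> ?E"
        using ind by (auto simp: doubleton_eq_iff)
      ultimately show "subrealization n d r ?E"
        unfolding subrealization_def deg using le sat k r less by auto
    qed (simp add: deg)
  qed
  \<comment> \<open>A saturated \<open>i\<close> has degree at least \<open>d r\<close>, more than
    \<open>r\<close> has now. The edge from \<open>i\<close> to \<open>u\<close> is what the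
    exchanges below trade in.\<close>
  have priv: "\<exists>u. u \<noteq> r \<and> {i, u} \<in> E \<and> {r, u} \<notin> E" if i: "i < r" for i
  proof -
    have "degree E r < degree E i" using sat[OF i] less mono[of i r] i r by auto
    then show ?thesis using degree_private_neighbour[OF g] by metis
  qed
  have c1: "{r, i} \<in> E" if i: "i < r" for i
  proof (rule ccontr)
    assume n: "{r, i} \<notin> E"
    obtain u where u: "u \<noteq> r" "{i, u} \<in> E" "{r, u} \<notin> E" using priv[OF i] by blast
    have ui: "u \<noteq> i" "u < n" using edge[OF u(2)] by auto
    show False
    \<comment> \<open>Replacing \<open>{i, u}\<close> by \<open>{r, i}\<close> and
      \<open>{r, u}\<close> keeps the degrees of \<open>i\<close> and \<open>u\<close> but raises
      that of \<open>r\<close> by two, which is admissible only if at least two are missing.\<close>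
    proof (cases "degree E r + 1 < d r")
      case True
      let ?F = "E - {{i, u}}"
      let ?E = "insert {r, u} (insert {r, i} ?F)"
      have deg: "degree ?E x + of_bool (x \<in> {i, u}) = degree E x + of_bool (x \<in> {r, u}) + of_bool (x \<in> {r, i})" for x
        using degree_remove[OF fin u(2), of x] degree_insert[of ?F "{r, i}" x]
          degree_insert[of "insert {r, i} ?F" "{r, u}" x] n u ui fin i
        by (auto simp: doubleton_eq_iff)
      have degr: "degree ?E r = degree E r + 2" using deg[of r] u i by auto
      have dego: "degree ?E x = degree E x" if "x \<noteq> r" for x using deg[of x] that ui unfolding of_bool_def by (auto split: if_splits)
      show False
      proof (rule stuck)
        have "graph {..<n} ?E" by (intro graph_insert graph_subset[OF g]) (use r u ui i in auto)
        moreover have "\<forall>u v. r < u \<longrightarrow> r < v \<longrightarrow> {u, v} \<notin> ?E"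
          using ind by (auto simp: doubleton_eq_iff)
        moreover have "degree ?E x \<le> d x" if "x < n" for x
          using le[OF that] dego degr True by (cases "x = r") auto
        ultimately show "subrealization n d r ?E"
          unfolding subrealization_def using sat dego by auto
      qed (simp add: degr)
    next
      case False
      have ev: "even (\<Sum>i<n. degree E i)" using handshake[OF g] by simp
      \<comment> \<open>With exactly one missing at \<open>r\<close>, parity forces a second
        deficient vertex, since both the sum of \<open>d\<close> and the sum of the degrees are
        even.\<close>
      have "\<exists>k<n. k \<noteq> r \<and> degree E k < d k"
      proof (rule ccontr)
        assume "\<not> ?thesis"
        then have "degree E k = d k" if "k \<in> {..<n} - {r}" for k using le[of k] that by force
        then have "(\<Sum>i\<in>{..<n} - {r}. degree E i) = (\<Sum>i\<in>{..<n} - {r}. d i)" by (intro sum.cong) auto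
        moreover have "d r = degree E r + 1" using False less by simp
        ultimately have "(\<Sum>i<n. d i) = (\<Sum>i<n. degree E i) + 1"
          using r by (simp add: sum.remove[of "{..<n}" r])
        then show False using even ev by simp
      qed
      then obtain k where k: "k < n" "k \<noteq> r" "degree E k < d k" by blast
      then have rk: "r < k" using sat[of k] by (metis less_irrefl linorder_neqE_nat)
      have erk: "{r, k} \<in> E" using c0 k rk by blast
      have uk: "u \<noteq> k" using erk u by auto
      \<comment> \<open>Giving up \<open>{r, k}\<close> as well cuts the gain of \<open>r\<close> to
        one. The loss at \<open>k\<close> is harmless, as vertices after \<open>r\<close> need only
        respect the upper bound.\<close>
      let ?F = "E - {{i, u}} - {{r, k}}"
      let ?E = "insert {r, u} (insert {r, i} ?F)"
      have deg: "degree ?E x + of_bool (x \<in> {i, u}) + of_bool (x \<in> {r, k}) = degree E x + of_bool (x \<in> {r, u}) + of_bool (x \<in> {r, i})" for x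
        using degree_remove[OF fin u(2), of x] degree_remove[of "E - {{i, u}}" "{r, k}" x]
          degree_insert[of ?F "{r, i}" x] erk
          degree_insert[of "insert {r, i} ?F" "{r, u}" x] n u ui fin i
        by (auto simp: doubleton_eq_iff)
      have degr: "degree ?E r = degree E r + 1" using deg[of r] u i by auto
      have dego: "degree ?E x + of_bool (x = k) = degree E x" if "x \<noteq> r" for x
        using deg[of x] that ui uk i rk unfolding of_bool_def by (auto split: if_splits)
      have dego': "degree ?E x = degree E x" if "x \<noteq> r" "x \<noteq> k" for x
        using dego[of x] that by auto
      have dego'': "degree ?E x \<le> degree E x" if "x \<noteq> r" for x
        using dego[of x] that by auto
      show False
      proof (rule stuck)
        have "graph {..<n} ?E" by (intro graph_insert graph_subset[OF g]) (use r u ui i in auto)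
        moreover have "\<forall>u v. r < u \<longrightarrow> r < v \<longrightarrow> {u, v} \<notin> ?E"
          using ind by (auto simp: doubleton_eq_iff)
        moreover have "degree ?E x \<le> d x" if "x < n" for x
          using le[OF that] dego''[of x] degr less by (cases "x = r") auto
        ultimately show "subrealization n d r ?E"
          unfolding subrealization_def using sat dego' rk by auto
      qed (simp add: degr)
    qed
  qed
  have nb_sub: "nbrs E k \<subseteq> {..r}" if "r < k" for k
    using ind[OF that] by (auto simp: nbrs_def not_le[symmetric])
  \<comment> \<open>A deficient \<open>k\<close> of degree below \<open>Suc r\<close> is adjacent to
    \<open>r\<close> by \<open>c0\<close>, so it misses some \<open>i\<close> before
    \<open>r\<close>. Trading \<open>{i, u}\<close> for \<open>{r, u}\<close> and
    \<open>{i, k}\<close> raises \<open>r\<close> and \<open>k\<close> by one each and changes no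
    other degree.\<close>
  have c2: "degree E k = min (d k) (Suc r)" if k: "r < k" "k < n" for k
  proof (rule ccontr)
    have "degree E k \<le> Suc r" using card_mono[OF _ nb_sub[OF k(1)]] degree_nbrs[OF g] by simp
    moreover assume "degree E k \<noteq> min (d k) (Suc r)"
    ultimately have lt: "degree E k < d k" "degree E k < Suc r" using le[OF k(2)] by auto
    then have erk: "{r, k} \<in> E" using c0 k by blast
    have "nbrs E k \<noteq> {..r}" using lt degree_nbrs[OF g, of k] by auto
    then obtain i where i: "i \<le> r" "{k, i} \<notin> E" using nb_sub[OF k(1)] by (auto simp: nbrs_def)
    with erk have ir: "i < r" by (metis insert_commute nat_less_le)
    obtain u where u: "u \<noteq> r" "{i, u} \<in> E" "{r, u} \<notin> E" using priv[OF ir] by blast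
    have ui: "u \<noteq> i" "u < n" "u \<noteq> k" using edge[OF u(2)] u erk by auto
    have ik: "{i, k} \<notin> E" using i sym by blast
    let ?F = "E - {{i, u}}"
    let ?E = "insert {r, u} (insert {i, k} ?F)"
    have deg: "degree ?E x + of_bool (x \<in> {i, u}) = degree E x + of_bool (x \<in> {r, u}) + of_bool (x \<in> {i, k})" for x
      using degree_remove[OF fin u(2), of x] degree_insert[of ?F "{i, k}" x]
        degree_insert[of "insert {i, k} ?F" "{r, u}" x] u ui fin ir ik
      by (auto simp: doubleton_eq_iff)
    have degr: "degree ?E x = degree E x + of_bool (x = r) + of_bool (x = k)" for x
      using deg[of x] u ir k ui unfolding of_bool_def by (auto split: if_splits)
    show False
    proof (rule stuck)
      have "graph {..<n} ?E" by (intro graph_insert graph_subset[OF g]) (use r u ui ir k in auto)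
      moreover have "\<forall>u v. r < u \<longrightarrow> r < v \<longrightarrow> {u, v} \<notin> ?E"
        using ind ir by (auto simp: doubleton_eq_iff)
      ultimately show "subrealization n d r ?E"
        unfolding subrealization_def degr using le sat k lt less by auto
    qed (simp add: degr)
  qed
  \<comment> \<open>By \<open>c1\<close> the vertices \<open>u\<close> and \<open>w\<close> lie
    after \<open>r\<close>. Trading \<open>{i, u}\<close> and \<open>{j, w}\<close> for
    \<open>{i, j}\<close> and \<open>{r, u}\<close> raises \<open>r\<close> by one at the expense of
    \<open>w\<close> alone.\<close>
  have c3: "{i, j} \<in> E" if ij: "i < r" "j < r" "i \<noteq> j" for i j
  proof (rule ccontr)
    assume n: "{i, j} \<notin> E"
    obtain u where u: "u \<noteq> r" "{i, u} \<in> E" "{r, u} \<notin> E" using priv ij by blast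
    obtain w where w: "w \<noteq> r" "{j, w} \<in> E" "{r, w} \<notin> E" using priv ij by blast
    have ur: "r < u" "r < w" using c1 u w by (metis linorder_neqE_nat)+
    have un: "u < n" "w < n" using edge[OF u(2)] edge[OF w(2)] by auto
    let ?F = "E - {{i, u}} - {{j, w}}"
    let ?E = "insert {r, u} (insert {i, j} ?F)"
    have deg: "degree ?E x + of_bool (x \<in> {i, u}) + of_bool (x \<in> {j, w}) = degree E x + of_bool (x \<in> {r, u}) + of_bool (x \<in> {i, j})" for x
      using degree_remove[OF fin u(2), of x] degree_remove[of "E - {{i, u}}" "{j, w}" x]
        degree_insert[of ?F "{i, j}" x]
        degree_insert[of "insert {i, j} ?F" "{r, u}" x] n u w un ur fin ij
      by (auto simp: doubleton_eq_iff)
    have degr: "degree ?E x + of_bool (x = w) = degree E x + of_bool (x = r)" for x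
      using deg[of x] ij ur unfolding of_bool_def by (auto split: if_splits)
    have degx: "degree ?E x = degree E x" if "x < r" for x using degr[of x] that ur by auto
    have degy: "degree ?E x \<le> degree E x + of_bool (x = r)" for x using degr[of x] by simp
    have degrr: "degree ?E r = degree E r + 1" using degr[of r] ur by simp
    show False
    proof (rule stuck)
      have "graph {..<n} ?E" by (intro graph_insert graph_subset[OF g]) (use r u un ij in auto)
      moreover have "\<forall>u v. r < u \<longrightarrow> r < v \<longrightarrow> {u, v} \<notin> ?E"
        using ind ij by (auto simp: doubleton_eq_iff)
      moreover have "degree ?E x \<le> d x" if "x < n" for x
        using le[OF that] degy[of x] less by (cases "x = r") auto
      ultimately show "subrealization n d r ?E"
        unfolding subrealization_def using sat degx by auto
    qed (simp add: degrr)
  qed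
  have clique: "nbrs E i \<inter> {..r} = {..r} - {i}" if "i \<le> r" for i
  proof -
    have "{i, j} \<in> E" if "j \<le> r" "j \<noteq> i" for j
      using c1[of i] c1[of j] c3[of i j] sym that \<open>i \<le> r\<close> by (cases "i = r"; cases "j = r") auto
    then show ?thesis using nbrs_subset[OF g, of i] by (auto simp: nbrs_def)
  qed
  have split: "degree E i = r + (\<Sum>k\<in>{r<..<n}. of_bool ({i, k} \<in> E))" if "i \<le> r" for i
  proof -
    have "nbrs E i = (nbrs E i \<inter> {..r}) \<union> {k \<in> {r<..<n}. {i, k} \<in> E}"
      using nbrs_subset[OF g, of i] by (auto simp: nbrs_def)
    moreover have "card ((nbrs E i \<inter> {..r}) \<union> {k \<in> {r<..<n}. {i, k} \<in> E})
        = card (nbrs E i \<inter> {..r}) + card {k \<in> {r<..<n}. {i, k} \<in> E}"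
      by (rule card_Un_disjoint) auto
    moreover have "card (nbrs E i \<inter> {..r}) = r" using clique[OF that] that by simp
    ultimately show ?thesis by (simp add: degree_nbrs[OF g] Int_def)
  qed
  \<comment> \<open>Double counting of the edges between the clique and the independent set. By
    \<open>c2\<close> the degrees up to \<open>r\<close> attain the right-hand side of the
    inequality, so they leave no deficiency at \<open>r\<close>.\<close>
  have "(\<Sum>i\<le>r. degree E i) = Suc r * r + (\<Sum>i\<le>r. \<Sum>k\<in>{r<..<n}. of_bool ({i, k} \<in> E))"
    using split by (simp add: sum.distrib)
  also have "(\<Sum>i\<le>r. \<Sum>k\<in>{r<..<n}. of_bool ({i, k} \<in> E)) = (\<Sum>k\<in>{r<..<n}. \<Sum>i\<le>r. of_bool ({i, k} \<in> E))"
    by (rule sum.swap)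
  also have "\<dots> = (\<Sum>k\<in>{r<..<n}. min (d k) (Suc r))"
  proof (rule sum.cong)
    fix k assume k: "k \<in> {r<..<n}"
    then have "nbrs E k = {i \<in> {..r}. {i, k} \<in> E}" using nb_sub[of k] sym by (auto simp: nbrs_def)
    then have "(\<Sum>i\<le>r. of_bool ({i, k} \<in> E)) = degree E k" by (simp add: degree_nbrs[OF g] Int_def)
    then show "(\<Sum>i\<le>r. of_bool ({i, k} \<in> E)) = min (d k) (Suc r)" using c2 k by simp
  qed simp
  finally have "(\<Sum>i\<le>r. d i) \<le> (\<Sum>i\<le>r. degree E i)" using eg by simp
  moreover have "(\<Sum>i\<le>r. degree E i) < (\<Sum>i\<le>r. d i)"
    using le r less by (intro sum_strict_mono_ex1) auto
  ultimately show False by simp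
qed

theorem erdos_gallai_sufficient:
  fixes d :: "nat \<Rightarrow> nat"
  assumes mono: "\<And>i j. i \<le> j \<Longrightarrow> j < n \<Longrightarrow> d j \<le> d i"
    and even: "even (\<Sum>i<n. d i)"
    and eg: "\<And>k. k \<le> n \<Longrightarrow> (\<Sum>i<k. d i) \<le> k * (k - 1) + (\<Sum>i\<in>{k..<n}. min (d i) k)"
  shows "\<exists>E. graph {..<n} E \<and> (\<forall>i<n. degree E i = d i)"
proof -
  have step: "\<exists>E'. subrealization n d r E' \<and> degree E' r = d r"
    if sub: "subrealization n d r E" and rn: "r < n" for r E
    using sub
  proof (induction "d r - degree E r" arbitrary: E rule: less_induct)
    case less
    show ?case
    proof (cases "degree E r = d r")
      case False
      then have lt: "degree E r < d r" using less.prems rn by (force simp: subrealization_def)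
      have "{Suc r..<n} = {r<..<n}" by auto
      then have "(\<Sum>i\<le>r. d i) \<le> Suc r * r + (\<Sum>i\<in>{r<..<n}. min (d i) (Suc r))"
        using eg[of "Suc r"] rn by (simp add: lessThan_Suc_atMost)
      then obtain E' where E': "subrealization n d r E'" "degree E r < degree E' r"
        using erdos_gallai_step[OF less.prems rn lt mono even] by blast
      show ?thesis by (rule less.hyps[OF _ E'(1)]) (use E' lt in simp)
    qed (use less in blast)
  qed
  have "\<exists>E. subrealization n d r E" if "r \<le> n" for r
    using that
  proof (induction r)
    case 0
    have "subrealization n d 0 {}" by (simp add: subrealization_def graph_def degree_def)
    then show ?case by blast
  next
    case (Suc r)
    then obtain E where "subrealization n d r E" by auto
    then obtain E' where E': "subrealization n d r E'" "degree E' r = d r" using step Suc.prems by (meson Suc_le_lessD)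
    have "subrealization n d (Suc r) E'"
      unfolding subrealization_def
    proof (intro conjI)
      show "\<forall>i<Suc r. degree E' i = d i" using E' by (auto simp: subrealization_def less_Suc_eq)
    qed (use E' in \<open>auto simp: subrealization_def\<close>)
    then show ?case by blast
  qed
  then obtain E where "subrealization n d n E" by blast
  then show ?thesis by (auto simp: subrealization_def)
qed

theorem erdos_gallai_necessary:
  assumes g: "graph {..<n} E" and k: "k \<le> n"
  shows "(\<Sum>i<k. degree E i) \<le> k * (k - 1) + (\<Sum>i\<in>{k..<n}. min (degree E i) k)"
proof -
  have le: "degree E i \<le> (k - 1) + (\<Sum>j\<in>{k..<n}. of_bool ({i, j} \<in> E))" if "i < k" for i
  proof -
    have "nbrs E i \<subseteq> ({..<k} - {i}) \<union> {j \<in> {k..<n}. {i, j} \<in> E}"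
      using nbrs_subset[OF g, of i] by (auto simp: nbrs_def)
    then have "card (nbrs E i) \<le> card (({..<k} - {i}) \<union> {j \<in> {k..<n}. {i, j} \<in> E})"
      by (rule card_mono[rotated]) auto
    also have "\<dots> \<le> card ({..<k} - {i}) + card {j \<in> {k..<n}. {i, j} \<in> E}" by (rule card_Un_le)
    finally show ?thesis using that by (simp add: degree_nbrs[OF g] Int_def)
  qed
  have "(\<Sum>i<k. degree E i) \<le> (\<Sum>i<k. (k - 1) + (\<Sum>j\<in>{k..<n}. of_bool ({i, j} \<in> E)))"
    using le by (intro sum_mono) auto
  also have "\<dots> = k * (k - 1) + (\<Sum>i<k. \<Sum>j\<in>{k..<n}. of_bool ({i, j} \<in> E))"
    unfolding sum.distrib by simp
  also have "(\<Sum>i<k. \<Sum>j\<in>{k..<n}. of_bool ({i, j} \<in> E)) = (\<Sum>j\<in>{k..<n}. \<Sum>i<k. of_bool ({i, j} \<in> E))"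
    by (rule sum.swap)
  also have "\<dots> \<le> (\<Sum>j\<in>{k..<n}. min (degree E j) k)"
  proof (rule sum_mono)
    fix j
    have "{i \<in> {..<k}. {i, j} \<in> E} \<subseteq> nbrs E j" by (auto simp: nbrs_def insert_commute)
    then have "card {i \<in> {..<k}. {i, j} \<in> E} \<le> degree E j"
      using degree_nbrs[OF g] finite_nbrs[OF g] by (simp add: card_mono)
    moreover have "card {i \<in> {..<k}. {i, j} \<in> E} \<le> card {..<k}" by (rule card_mono) auto
    ultimately show "(\<Sum>i<k. of_bool ({i, j} \<in> E)) \<le> min (degree E j) k" by (simp add: Int_def)
  qed
  finally show ?thesis by simp
qed

section \<open>Degree sequences\<close>

lemma rev_sort_eq:
  assumes "sorted_wrt (\<ge>) (xs :: 'a::linorder list)" "mset xs = mset ys"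
  shows "rev (sort ys) = xs"
proof -
  have "sorted (rev xs)" using assms by (simp add: sorted_wrt_rev)
  then have "sort ys = rev xs" using assms by (intro properties_for_sort) auto
  then show ?thesis by simp
qed

lemma relabel_graph:
  fixes n :: nat
  assumes g: "graph {..<n} E" and p: "p permutes {..<n}"
  obtains E' where "graph {..<n} E'" "\<And>i. degree E' i = degree E (p i)"
proof
  define q where "q = inv p"
  have q: "q permutes {..<n}" using p permutes_inv q_def by blast
  have inj: "inj q" using q permutes_inj by blast
  have qp: "q (p i) = i" "p (q i) = i" for i using p q_def by (auto simp: permutes_inverses)
  have memq: "q i < n \<longleftrightarrow> i < n" for i using permutes_in_image[OF q] by simp
  let ?E = "(`) q ` E"
  show "graph {..<n} ?E"
    unfolding graph_def
  proof (intro conjI ballI)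
    fix e assume "e \<in> ?E"
    then obtain f where f: "f \<in> E" "e = q ` f" by auto
    then have "f \<subseteq> {..<n}" "card f = 2" using g by (auto simp: graph_def)
    moreover have "card e = card f"
      unfolding f(2) by (rule card_image[OF inj_on_subset[OF inj subset_UNIV]])
    ultimately show "e \<subseteq> {..<n}" "card e = 2" unfolding f(2) using memq by auto
  qed simp
  fix i
  have "{e \<in> ?E. i \<in> e} = (`) q ` {e \<in> E. p i \<in> e}"
  proof -
    have "i \<in> q ` e \<longleftrightarrow> p i \<in> e" for e using qp by (metis image_iff)
    then show ?thesis by auto
  qed
  moreover have "inj_on ((`) q) A" for A using inj by (auto simp: inj_on_def inj_image_eq_iff)
  ultimately show "degree ?E i = degree E (p i)" by (simp add: degree_def card_image)
qed

text \<open>Sorting the degrees permutes the vertices. Relabelling by that permutation gives a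
  realization in which vertex \<open>i\<close> carries the \<open>i\<close>-th term, the form in
  which the Erdos-Gallai theorem is stated.\<close>

lemma D0_iff:
  "ds \<in> D0 n \<longleftrightarrow> length ds = n \<and> sorted_wrt (\<ge>) ds \<and>
     (\<exists>E. graph {..<n} E \<and> (\<forall>i<n. degree E i = ds ! i))" (is "_ \<longleftrightarrow> ?R")
proof
  assume "ds \<in> D0 n"
  then obtain E where E: "graph {..<n} E" "ds = degree_sequence n E" by (auto simp: D0_def)
  have len: "length ds = n" by (simp add: E degree_sequence_def)
  have srt: "sorted_wrt (\<ge>) ds" by (simp add: E degree_sequence_def sorted_wrt_rev)
  have "mset ds = mset (map (degree E) [0..<n])" by (simp add: E degree_sequence_def)
  then obtain p where p: "p permutes {..<n}" "permute_list p (map (degree E) [0..<n]) = ds"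
    using mset_eq_permutation[of ds "map (degree E) [0..<n]"] by auto
  obtain E' where E': "graph {..<n} E'" "\<And>i. degree E' i = degree E (p i)"
    using relabel_graph[OF E(1) p(1)] by blast
  have "degree E' i = ds ! i" if "i < n" for i
  proof -
    have "p i < n" using permutes_in_image[OF p(1)] that by simp
    then show ?thesis using that E'(2) p by (auto simp: permute_list_nth)
  qed
  then show ?R using len srt E' by blast
next
  assume ?R
  then obtain E where E: "graph {..<n} E" "\<forall>i<n. degree E i = ds ! i" by blast
  have "map (degree E) [0..<n] = ds" using \<open>?R\<close> E by (intro nth_equalityI) auto
  then have "ds = degree_sequence n E"
    using \<open>?R\<close> rev_sort_eq[of ds ds] by (simp add: degree_sequence_def)
  then show "ds \<in> D0 n" using E by (auto simp: D0_def)
qed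

section \<open>Forests and components\<close>

definition adj :: "'a set set \<Rightarrow> ('a \<times> 'a) set" where
  "adj E = {(x, y). {x, y} \<in> E}"

text \<open>Every edge is a bridge. Failure of this directly supplies an edge together with a detour
  around it, which is how cycles enter the exchange argument.\<close>

definition forest :: "'a set set \<Rightarrow> bool" where
  "forest E \<longleftrightarrow> (\<forall>a b. {a, b} \<in> E \<longrightarrow> (a, b) \<notin> (adj (E - {{a, b}}))\<^sup>*)"

definition component :: "'a set set \<Rightarrow> 'a \<Rightarrow> 'a set" where
  "component E x = {y. (x, y) \<in> (adj E)\<^sup>*}"

lemma adj_mono: "E \<subseteq> F \<Longrightarrow> adj E \<subseteq> adj F"
  by (auto simp: adj_def)

lemma adj_rtrancl_mono: "E \<subseteq> F \<Longrightarrow> p \<in> (adj E)\<^sup>* \<Longrightarrow> p \<in> (adj F)\<^sup>*"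
  using rtrancl_mono[OF adj_mono] by blast

lemma sym_adj: "sym ((adj E)\<^sup>*)"
  by (rule sym_rtrancl) (auto simp: adj_def sym_def insert_commute)

lemma adj_symD: "(x, y) \<in> (adj E)\<^sup>* \<Longrightarrow> (y, x) \<in> (adj E)\<^sup>*"
  using sym_adj by (rule symD)

lemma adj_edge: "{x, y} \<in> E \<Longrightarrow> (x, y) \<in> (adj E)\<^sup>*"
  by (auto simp: adj_def)

lemma component_eq_iff: "component E x = component E y \<longleftrightarrow> (x, y) \<in> (adj E)\<^sup>*"
  unfolding component_def by (auto dest: adj_symD intro: rtrancl_trans)

lemma component_subset:
  assumes "graph V E" "x \<in> V"
  shows "component E x \<subseteq> V"
proof
  fix y assume "y \<in> component E x"
  then have "(x, y) \<in> (adj E)\<^sup>*" by (simp add: component_def)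
  then show "y \<in> V"
    by (induction rule: rtrancl_induct) (use assms graph_edge in \<open>auto simp: adj_def\<close>)
qed

text \<open>A path never has to traverse the new edge more than once; the two directions of
  traversal give the last two cases.\<close>

lemma adj_insert_rtrancl:
  "(x, y) \<in> (adj (insert {a, b} E))\<^sup>* \<longleftrightarrow>
     (x, y) \<in> (adj E)\<^sup>* \<or> (x, a) \<in> (adj E)\<^sup>* \<and> (b, y) \<in> (adj E)\<^sup>*
     \<or> (x, b) \<in> (adj E)\<^sup>* \<and> (a, y) \<in> (adj E)\<^sup>*" (is "?L \<longleftrightarrow> ?R")
proof
  assume ?L
  then show ?R
  proof (induction rule: rtrancl_induct)
    case (step y z)
    from step.hyps(2) consider "{y, z} \<in> E" | "y = a" "z = b" | "y = b" "z = a"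
      by (auto simp: adj_def doubleton_eq_iff)
    then show ?case
    proof cases
      case 1
      then have "(y, z) \<in> (adj E)\<^sup>*" by (rule adj_edge)
      with step.IH show ?thesis by (meson rtrancl_trans)
    next
      case 2
      with step.IH show ?thesis by (meson adj_symD rtrancl_trans rtrancl.rtrancl_refl)
    next
      case 3
      with step.IH show ?thesis by (meson adj_symD rtrancl_trans rtrancl.rtrancl_refl)
    qed
  qed simp
next
  let ?A = "(adj (insert {a, b} E))\<^sup>*"
  have ab: "(a, b) \<in> ?A" "(b, a) \<in> ?A" by (auto simp: adj_def)
  have sub: "p \<in> ?A" if "p \<in> (adj E)\<^sup>*" for p using adj_rtrancl_mono[OF _ that] by blast
  assume ?R
  then show ?L using ab sub by (meson rtrancl_trans)
qed

text \<open>Inserting an edge merges two components or leaves the components alone. In a forest the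
  second never happens, since the edge would have a detour, and hence equality holds.\<close>

lemma card_components:
  assumes "graph V E"
  shows "card V \<le> card E + card (component E ` V) \<and>
    (forest E \<longrightarrow> card V = card E + card (component E ` V))"
  using graph_finite(2)[OF assms] assms
proof (induction E rule: finite_induct)
  case empty
  have "component {} x = {x}" for x :: 'a by (simp add: component_def adj_def)
  then have "component {} ` V = (\<lambda>x. {x}) ` V" by auto
  then have "card (component {} ` V) = card V" by (simp add: card_image inj_on_def)
  then show ?case by simp
next
  case (insert e E)
  have g: "graph V E" using insert.prems by (rule graph_subset) auto
  have fin: "finite V" using g graph_finite by blast
  obtain a b where e: "e = {a, b}" "a \<noteq> b" "a \<in> V" "b \<in> V"
    using graph_edgeE[OF insert.prems, of e] by blast
  note IH = insert.IH[OF g]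
  have forest: "forest E \<and> (a, b) \<notin> (adj E)\<^sup>*" if f: "forest (insert e E)"
  proof
    show "forest E"
      unfolding forest_def
    proof (intro allI impI notI)
      fix c d assume cd: "{c, d} \<in> E" "(c, d) \<in> (adj (E - {{c, d}}))\<^sup>*"
      then have "(c, d) \<in> (adj (insert e E - {{c, d}}))\<^sup>*" by (auto elim!: adj_rtrancl_mono[rotated])
      then show False using f cd by (auto simp: forest_def)
    qed
    have "insert e E - {e} = E" using insert.hyps by auto
    then show "(a, b) \<notin> (adj E)\<^sup>*" using f e by (auto simp: forest_def)
  qed
  show ?case
  proof (cases "(a, b) \<in> (adj E)\<^sup>*")
    case True
    then have "(b, a) \<in> (adj E)\<^sup>*" by (rule adj_symD)
    with True have "(x, y) \<in> (adj (insert e E))\<^sup>* \<longleftrightarrow> (x, y) \<in> (adj E)\<^sup>*" for x y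
      unfolding e adj_insert_rtrancl by (meson rtrancl_trans)
    then have "component (insert e E) x = component E x" for x by (simp add: component_def)
    then show ?thesis using True IH forest insert.hyps by auto
  next
    case False
    let ?A = "component E a" and ?B = "component E b"
    let ?K = "component E ` V"
    have ne: "?A \<noteq> ?B" using False component_eq_iff by metis
    have *: "component (insert e E) x = (if component E x \<in> {?A, ?B} then ?A \<union> ?B else component E x)" for x
    proof -
      have xa: "(x, a) \<in> (adj E)\<^sup>* \<longleftrightarrow> component E x = ?A"
        by (rule component_eq_iff[symmetric])
      have xb: "(x, b) \<in> (adj E)\<^sup>* \<longleftrightarrow> component E x = ?B"
        by (rule component_eq_iff[symmetric])
      have mem: "y \<in> component F z \<longleftrightarrow> (z, y) \<in> (adj F)\<^sup>*" for F and y z :: 'a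
        by (simp add: component_def)
      have "y \<in> component (insert e E) x \<longleftrightarrow>
          y \<in> component E x \<or> component E x = ?A \<and> y \<in> ?B \<or> component E x = ?B \<and> y \<in> ?A" for y
        unfolding mem e(1) adj_insert_rtrancl xa xb ..
      then show ?thesis by (cases "component E x = ?A"; cases "component E x = ?B") auto
    qed
    have sub: "?K - {?A, ?B} \<subseteq> component (insert e E) ` V"
    proof
      fix C assume "C \<in> ?K - {?A, ?B}"
      then obtain x where x: "x \<in> V" "C = component E x" "component E x \<noteq> ?A" "component E x \<noteq> ?B" by blast
      then have "component (insert e E) x = C" unfolding *[of x] by simp
      then show "C \<in> component (insert e E) ` V" using x(1) by blast
    qed
    moreover have "?A \<union> ?B = component (insert e E) a" unfolding *[of a] by simp
    then have "?A \<union> ?B \<in> component (insert e E) ` V" using e(3) by (rule image_eqI)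
    moreover have "component (insert e E) x \<in> insert (?A \<union> ?B) (?K - {?A, ?B})" if "x \<in> V" for x
      unfolding *[of x] using that by auto
    ultimately have eq: "component (insert e E) ` V = insert (?A \<union> ?B) (?K - {?A, ?B})"
      by (intro subset_antisym image_subsetI insert_subsetI)
    have notin: "?A \<union> ?B \<notin> ?K - {?A, ?B}"
    proof
      assume "?A \<union> ?B \<in> ?K - {?A, ?B}"
      then obtain x where x: "?A \<union> ?B = component E x" by blast
      have "a \<in> ?A" "b \<in> ?B" by (auto simp: component_def)
      then have "a \<in> component E x" "b \<in> component E x" unfolding x[symmetric] by blast+
      then have "(x, a) \<in> (adj E)\<^sup>*" "(x, b) \<in> (adj E)\<^sup>*" by (simp_all add: component_def)
      then show False using False by (meson adj_symD rtrancl_trans)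
    qed
    have "card {?A, ?B} \<le> card ?K" using fin e by (intro card_mono) auto
    then have "card (component (insert e E) ` V) + 1 = card ?K"
    proof -
      have "{?A, ?B} \<subseteq> ?K" using e by blast
      then have "card (?K - {?A, ?B}) = card ?K - 2" using ne by (simp add: card_Diff_subset)
      moreover have "finite (?K - {?A, ?B})" using fin by blast
      ultimately show ?thesis
        unfolding eq card_insert_disjoint[OF \<open>finite (?K - {?A, ?B})\<close> notin]
        using \<open>card {?A, ?B} \<le> card ?K\<close> ne by simp
    qed
    then show ?thesis using IH forest insert.hyps by auto
  qed
qed

lemma connected_card_edges:
  assumes "graph V E" "connected_graph V E"
  shows "card V \<le> card E + 1"
proof -
  obtain x where x: "x \<in> V" using assms by (auto simp: connected_graph_def)
  have "component E y = component E x" if "y \<in> V" for y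
    unfolding component_eq_iff using assms that x by (auto simp: connected_graph_def adj_def)
  then have "component E ` V \<subseteq> {component E x}" by blast
  then have "card (component E ` V) \<le> card {component E x}" by (rule card_mono[rotated]) simp
  then show ?thesis using card_components[OF assms(1)] by simp
qed

text \<open>Meant contrapositively: a disconnected graph with at least \<open>card V - 1\<close>
  edges contains a cycle.\<close>

lemma disconnected_forest_card_edges:
  assumes g: "graph V E" and pq: "p \<in> V" "q \<in> V" "(p, q) \<notin> (adj E)\<^sup>*" and f: "forest E"
  shows "card E + 2 \<le> card V"
proof -
  have "component E p \<noteq> component E q" using pq component_eq_iff by metis
  then have "card {component E p, component E q} = 2" by simp
  moreover have "card {component E p, component E q} \<le> card (component E ` V)"
    using pq graph_finite[OF g] by (intro card_mono) auto
  ultimately show ?thesis using card_components[OF g] f by simp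
qed

text \<open>A nonempty forest on its non-isolated vertices has degree sum at most 2 |U| - 2, while
  one exceptional vertex of degree 1 still leaves at least 2 |U| - 1. The exception \<open>v\<close>
  will be the deleted vertex, which may have a single edge into the component.\<close>

lemma not_forest_if_degrees:
  assumes g: "graph V E" and ne: "E \<noteq> {}"
    and deg: "\<And>u. u \<in> \<Union>E \<Longrightarrow> u \<noteq> v \<Longrightarrow> 2 \<le> degree E u"
  shows "\<not> forest E"
proof
  assume f: "forest E"
  let ?U = "\<Union>E"
  have gU: "graph ?U E" using g finite_subset[of ?U V] by (auto simp: graph_def)
  have finU: "finite ?U" using gU by (simp add: graph_def)
  obtain e where "e \<in> E" using ne by blast
  moreover from this have "e \<noteq> {}" using g by (auto simp: graph_def)
  ultimately obtain x where "x \<in> ?U" by blast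
  then have "card (component E ` ?U) \<noteq> 0" using finU by auto
  then have lt: "card E + 1 \<le> card ?U" using card_components[OF gU] f by simp
  have "2 * card ?U \<le> (\<Sum>u\<in>?U. degree E u + of_bool (u = v))"
  proof -
    have "(\<Sum>u\<in>?U. 2) \<le> (\<Sum>u\<in>?U. degree E u + of_bool (u = v))"
    proof (rule sum_mono)
      fix u assume u: "u \<in> ?U"
      then have "{e \<in> E. u \<in> e} \<noteq> {}" by auto
      then have "degree E u \<noteq> 0" using graph_finite(2)[OF g] by (simp add: degree_def)
      then show "2 \<le> degree E u + of_bool (u = v)" using deg[OF u] by (cases "u = v") auto
    qed
    then show ?thesis by simp
  qed
  also have "\<dots> = 2 * card E + (\<Sum>u\<in>?U. of_bool (u = v))"
    by (simp add: sum.distrib handshake[OF gU])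
  also have "(\<Sum>u\<in>?U. of_bool (u = v)) \<le> (1::nat)"
    using finU by (simp add: Int_def card_le_Suc0_iff_eq)
  finally show False using lt by simp
qed

text \<open>Cut the path at its last visit to \<open>p\<close>. On a cycle this yields the second
  edge at a given vertex.\<close>

lemma rtrancl_first_step_avoiding:
  assumes "(p, q) \<in> R\<^sup>*" "p \<noteq> q"
  shows "\<exists>y. (p, y) \<in> R \<and> (y, q) \<in> {(u, w) \<in> R. u \<noteq> p \<and> w \<noteq> p}\<^sup>*"
proof -
  let ?A = "{(u, w) \<in> R. u \<noteq> p \<and> w \<noteq> p}"
  have "z \<noteq> p \<and> (z, q) \<in> ?A\<^sup>* \<or> (\<exists>y. (p, y) \<in> R \<and> (y, q) \<in> ?A\<^sup>*)" if "(z, q) \<in> R\<^sup>*" for z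
    using that
  proof (induction rule: converse_rtrancl_induct)
    case (step y z)
    show ?case
    proof (cases "z \<noteq> p \<and> (z, q) \<in> ?A\<^sup>*")
      case True
      show ?thesis
      proof (cases "y = p")
        case False
        then have "(y, z) \<in> ?A" using step True by auto
        then have "(y, q) \<in> ?A\<^sup>*" using True by (meson converse_rtrancl_into_rtrancl)
        then show ?thesis using False by blast
      qed (use True step in auto)
    qed (use step in auto)
  qed (use assms in auto)
  then show ?thesis using assms by blast
qed

section \<open>Biconnected realizations\<close>

text \<open>Deleting a vertex outside the graph deletes nothing, so that connectedness of the whole
  graph and of its vertex-deleted subgraphs are treated alike.\<close>

abbreviation del :: "'a set set \<Rightarrow> 'a \<Rightarrow> 'a set set" where
  "del E v \<equiv> {e \<in> E. v \<notin> e}"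

lemma card_del:
  assumes "graph V E"
  shows "card (del E v) + degree E v = card E"
proof -
  have "finite E" using graph_finite assms by blast
  moreover have "E = del E v \<union> {e \<in> E. v \<in> e}" by auto
  ultimately show ?thesis unfolding degree_def
    by (metis (no_types, lifting) card_Un_disjoint disjoint_iff finite_Un mem_Collect_eq)
qed

text \<open>The range of \<open>v\<close> includes \<open>n\<close>, which is not a vertex: that
  instance says that the graph itself is connected.\<close>

lemma biconnectedI:
  fixes n :: nat
  assumes g: "graph {..<n} E" and n: "n \<ge> 2"
    and con: "\<And>v p q. v \<le> n \<Longrightarrow> p \<in> {..<n} - {v} \<Longrightarrow> q \<in> {..<n} - {v} \<Longrightarrow> (p, q) \<in> (adj (del E v))\<^sup>*"
  shows "biconnected {..<n} E"
proof -
  have "n \<notin> e" if "e \<in> E" for e using g that by (auto simp: graph_def)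
  then have "del E n = E" by auto
  then have "connected_graph {..<n} E" using con[of n] n by (auto simp: connected_graph_def adj_def lessThan_empty_iff)
  moreover have "\<not> cut_vertex {..<n} E v" for v
  proof -
    have "{..<n} - {v} \<noteq> {}"
    proof
      assume "{..<n} - {v} = {}"
      then have "{..<n} \<subseteq> {v}" by auto
      then have "card {..<n} \<le> card {v}" by (rule card_mono[rotated]) auto
      then show False using n by simp
    qed
    then show ?thesis using con[of v] by (auto simp: cut_vertex_def connected_graph_def adj_def)
  qed
  ultimately show ?thesis by (simp add: biconnected_def)
qed

text \<open>The potential of the exchange argument: it must strictly grow and is bounded by the
  finite set of all triples.\<close>

definition reachable_triples :: "nat \<Rightarrow> nat set set \<Rightarrow> (nat \<times> nat \<times> nat) set" where
  "reachable_triples n E = {(v, p, q). v \<le> n \<and> p < n \<and> q < n \<and> (p, q) \<in> (adj (del E v))\<^sup>*}"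

lemma biconnect_step:
  fixes n :: nat
  assumes g: "graph {..<n} E" and deg2: "\<And>v. v < n \<Longrightarrow> 2 \<le> degree E v"
    and edges: "\<And>v. v < n \<Longrightarrow> n + degree E v \<le> card E + 2"
    and v: "v \<le> n" and pq: "p \<in> {..<n} - {v}" "q \<in> {..<n} - {v}" "(p, q) \<notin> (adj (del E v))\<^sup>*"
  shows "\<exists>E'. graph {..<n} E' \<and> (\<forall>i. degree E' i = degree E i) \<and>
    reachable_triples n E \<subset> reachable_triples n E'"
proof -
  have fin: "finite E" using graph_finite g by blast
  have gv: "graph ({..<n} - {v}) (del E v)" using g by (auto simp: graph_def)
  have "n \<le> card E"
  proof -
    have "(\<Sum>i<n. 2) \<le> (\<Sum>i<n. degree E i)" using deg2 by (intro sum_mono) auto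
    then show ?thesis using handshake[OF g] by simp
  qed
  have "card ({..<n} - {v}) < card (del E v) + 2"
  proof (cases "v = n")
    case True
    then have "{e \<in> E. v \<in> e} = {}" using g by (auto simp: graph_def)
    then have "degree E v = 0" unfolding degree_def by (simp only: card.empty)
    then show ?thesis using card_del[OF g, of v] \<open>n \<le> card E\<close> True by simp
  next
    case False
    then show ?thesis using card_del[OF g, of v] edges[of v] v by simp
  qed
  then have "\<not> forest (del E v)" using disconnected_forest_card_edges[OF gv pq] by auto
  then obtain a b where ab: "{a, b} \<in> del E v" and abR: "(a, b) \<in> (adj (del E v - {{a, b}}))\<^sup>*"
    by (auto simp: forest_def)
  let ?R = "(adj (del E v))\<^sup>*"
  have abV: "a < n" "b < n" "a \<noteq> b" "a \<noteq> v" "b \<noteq> v"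
    using graph_edge[OF gv ab] by auto
  \<comment> \<open>As \<open>p\<close> and \<open>q\<close> are separated, at least one of them
    lies outside the component of \<open>a\<close>.\<close>
  define z where "z = (if (a, p) \<in> ?R then q else p)"
  have z: "(a, z) \<notin> ?R" "z \<in> {..<n} - {v}"
    using pq by (auto simp: z_def dest: adj_symD rtrancl_trans)
  define C1 where "C1 = component (del E v) a"
  define C2 where "C2 = component (del E v) z"
  have C1V: "C1 \<subseteq> {..<n} - {v}" and C2V: "C2 \<subseteq> {..<n} - {v}"
    using component_subset[OF gv] abV z by (auto simp: C1_def C2_def)
  have disj: "C1 \<inter> C2 = {}"
    using z by (auto simp: C1_def C2_def component_def dest: adj_symD rtrancl_trans)
  have abC: "a \<in> C1" "b \<in> C1" using adj_edge[OF ab] by (auto simp: C1_def component_def)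
  have closed2: "w \<in> insert v C2" if "u \<in> C2" "{u, w} \<in> E" for u w
  proof (cases "w = v")
    case False
    then have "{u, w} \<in> del E v" using that C2V by auto
    then have "(u, w) \<in> ?R" by (rule adj_edge)
    then show ?thesis using that by (auto simp: C2_def component_def intro: rtrancl_trans)
  qed simp
  \<comment> \<open>The part of the graph on C2 and \<open>v\<close>. Vertices of \<open>C2\<close>
    keep all their edges here, so \<open>v\<close> is the only one whose degree may fall below
    2.\<close>
  define F where "F = {e \<in> E. e \<inter> C2 \<noteq> {}}"
  have FE: "F \<subseteq> E" by (auto simp: F_def)
  have gF: "graph {..<n} F" using g FE graph_subset by blast
  have Fsub: "e \<subseteq> insert v C2" if e: "e \<in> F" for e
  proof -
    obtain s t where "e = {s, t}" using graph_edgeE[OF gF e] by blast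
    then show ?thesis using e closed2[of s t] closed2[of t s] by (auto simp: F_def insert_commute)
  qed
  have degF: "degree F u = degree E u" if "u \<in> C2" for u
  proof -
    have "{e \<in> F. u \<in> e} = {e \<in> E. u \<in> e}" using that by (auto simp: F_def)
    then show ?thesis by (simp add: degree_def)
  qed
  have "\<not> forest F"
  proof (rule not_forest_if_degrees[OF gF])
    have zC: "z \<in> C2" by (simp add: C2_def component_def)
    then have "degree F z \<noteq> 0" using degF deg2[of z] z by auto
    then have "{e \<in> F. z \<in> e} \<noteq> {}" unfolding degree_def by (metis card.empty)
    then show "F \<noteq> {}" by blast
    show "2 \<le> degree F u" if "u \<in> \<Union>F" "u \<noteq> v" for u
    proof -
      have "u \<in> C2" using that Fsub by blast
      then show ?thesis using degF deg2[of u] C2V by auto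
    qed
  qed
  then obtain x0 y0 where xy0: "{x0, y0} \<in> F" and xyR0: "(x0, y0) \<in> (adj (F - {{x0, y0}}))\<^sup>*"
    by (auto simp: forest_def)
  \<comment> \<open>If the edge found on a cycle ends in \<open>v\<close>, the other edge at
    \<open>x\<close> on the same cycle is taken instead. Its far end is not \<open>v\<close>, hence
    lies in \<open>C2\<close>.\<close>
  have *: "\<exists>y. y \<in> C2 \<and> {x, y} \<in> F \<and> (x, y) \<in> (adj (F - {{x, y}}))\<^sup>*"
    if xv: "{x, v} \<in> F" "(x, v) \<in> (adj (F - {{x, v}}))\<^sup>*" for x
  proof -
    have "x \<noteq> v" using graph_edge[OF gF xv(1)] by simp
    then obtain y where y: "(x, y) \<in> adj (F - {{x, v}})"
      "(y, v) \<in> {(u, w) \<in> adj (F - {{x, v}}). u \<noteq> x \<and> w \<noteq> x}\<^sup>*"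
      using rtrancl_first_step_avoiding[OF xv(2)] by blast
    have xy: "{x, y} \<in> F" "y \<noteq> v" using y by (auto simp: adj_def)
    then have yC: "y \<in> C2" using Fsub by blast
    have "{(u, w) \<in> adj (F - {{x, v}}). u \<noteq> x \<and> w \<noteq> x} \<subseteq> adj (F - {{x, y}})"
      by (auto simp: adj_def doubleton_eq_iff)
    then have "(y, v) \<in> (adj (F - {{x, y}}))\<^sup>*" using y(2) rtrancl_mono by blast
    moreover have "(x, v) \<in> (adj (F - {{x, y}}))\<^sup>*"
      using xv(1) xy by (intro adj_edge) (auto simp: doubleton_eq_iff)
    ultimately have "(x, y) \<in> (adj (F - {{x, y}}))\<^sup>*" by (meson adj_symD rtrancl_trans)
    then show ?thesis using yC xy by blast
  qed
  have "\<exists>x y. x \<in> C2 \<and> y \<in> C2 \<and> {x, y} \<in> F \<and> (x, y) \<in> (adj (F - {{x, y}}))\<^sup>*"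
  proof -
    have ne: "x0 \<noteq> y0" using graph_edge[OF gF xy0] by simp
    have mem: "x0 \<in> insert v C2" "y0 \<in> insert v C2" using Fsub[OF xy0] by auto
    consider "x0 \<in> C2" "y0 \<in> C2" | "y0 = v" "x0 \<in> C2" | "x0 = v" "y0 \<in> C2" using ne mem by auto
    then show ?thesis
    proof cases
      case 1
      then show ?thesis using xy0 xyR0 by blast
    next
      case 2
      then show ?thesis using *[of x0] xy0 xyR0 by blast
    next
      case 3
      have "{y0, v} = {x0, y0}" using 3 by auto
      then show ?thesis using *[of y0] xy0 adj_symD[OF xyR0] 3 by auto
    qed
  qed
  then obtain x y where xyC: "x \<in> C2" "y \<in> C2" and xyF: "{x, y} \<in> F"
    and xyR: "(x, y) \<in> (adj (F - {{x, y}}))\<^sup>*" by blast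
  have xyE: "{x, y} \<in> E" and abE: "{a, b} \<in> E" using xyF FE ab by auto
  have ne: "x \<noteq> y" "a \<noteq> x" "a \<noteq> y" "b \<noteq> x" "b \<noteq> y"
    using graph_edge[OF g xyE] xyC abC disj by auto
  have cross: "{s, t} \<notin> E" if "s \<in> C1" "t \<in> C2" for s t
    using closed2[of t s] that disj C1V by (auto simp: insert_commute)
  let ?F = "E - {{a, b}} - {{x, y}}"
  define E' where "E' = insert {a, x} (insert {b, y} ?F)"
  have g': "graph {..<n} E'"
    unfolding E'_def by (intro graph_insert graph_subset[OF g]) (use ne abV xyC C2V in auto)
  have deg': "degree E' i = degree E i" for i
  proof -
    have xy': "{x, y} \<in> E - {{a, b}}" using xyE ne by (auto simp: doubleton_eq_iff)
    have by': "{b, y} \<notin> ?F" using cross[of b y] abC xyC by blast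
    have ax': "{a, x} \<notin> insert {b, y} ?F"
      using cross[of a x] abC xyC abV ne by (auto simp: doubleton_eq_iff)
    have "degree E' i + of_bool (i \<in> {a, b}) + of_bool (i \<in> {x, y})
        = degree E i + of_bool (i \<in> {a, x}) + of_bool (i \<in> {b, y})"
      unfolding E'_def
      using degree_remove[OF fin abE, of i] degree_remove[OF _ xy', of i]
        degree_insert[OF _ by', of i] degree_insert[OF _ ax', of i] fin
      by simp
    then show ?thesis using ne abV unfolding of_bool_def by (auto split: if_splits)
  qed
  \<comment> \<open>The detour around \<open>{a, b}\<close> stays inside \<open>C1\<close>, so
    deleting a vertex outside \<open>C1\<close> cannot break it.\<close>
  define E1 where "E1 = {e \<in> del E v - {{a, b}}. e \<subseteq> C1}"
  have ab1: "(a, b) \<in> (adj E1)\<^sup>*"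
  proof -
    have "(a, c) \<in> (adj E1)\<^sup>* \<and> c \<in> C1" if "(a, c) \<in> (adj (del E v - {{a, b}}))\<^sup>*" for c
      using that
    proof (induction rule: rtrancl_induct)
      case (step c d)
      have e: "{c, d} \<in> del E v - {{a, b}}" using step.hyps(2) by (simp add: adj_def)
      then have "(c, d) \<in> ?R" by (intro adj_edge) auto
      then have d: "d \<in> C1" using step.IH by (auto simp: C1_def component_def intro: rtrancl_trans)
      then have "{c, d} \<in> E1" using e step.IH by (simp add: E1_def)
      then show ?case using step.IH d by (meson adj_edge rtrancl_trans)
    qed (simp add: abC)
    then show ?thesis using abR by blast
  qed
  have path1: "(a, b) \<in> (adj (del E' w))\<^sup>*" if "w \<notin> C1" for w
  proof (rule adj_rtrancl_mono[OF _ ab1])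
    show "E1 \<subseteq> del E' w" using that xyC disj by (auto simp: E1_def E'_def)
  qed
  have path2: "(x, y) \<in> (adj (del E' w))\<^sup>*" if "w \<in> C1" for w
  proof (rule adj_rtrancl_mono[OF _ xyR])
    show "F - {{x, y}} \<subseteq> del E' w"
    proof
      fix e assume e: "e \<in> F - {{x, y}}"
      then have "e \<subseteq> insert v C2" "e \<inter> C2 \<noteq> {}" "e \<in> E" using Fsub by (auto simp: F_def)
      moreover have "w \<notin> insert v C2" using that disj C1V by auto
      moreover have "e \<noteq> {a, b}" using \<open>e \<inter> C2 \<noteq> {}\<close> abC disj by auto
      ultimately show "e \<in> del E' w" using e by (auto simp: E'_def)
    qed
  qed
  \<comment> \<open>Only \<open>{a, b}\<close> and \<open>{x, y}\<close> disappear. If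
    \<open>w\<close> is outside \<open>C1\<close>, the first has its own detour and the second is
    replaced by x, a, detour to b, y; if \<open>w\<close> is in \<open>C1\<close>, the roles are
    exchanged.\<close>
  have edge': "(s, t) \<in> (adj (del E' w))\<^sup>*" if st: "{s, t} \<in> del E w" for s t w
  proof -
    let ?R' = "(adj (del E' w))\<^sup>*"
    have ax: "(a, x) \<in> ?R'" if "w \<noteq> a" "w \<noteq> x" using that by (intro adj_edge) (auto simp: E'_def)
    have by2: "(b, y) \<in> ?R'" if "w \<noteq> b" "w \<noteq> y" using that by (intro adj_edge) (auto simp: E'_def)
    have nxy: "w \<noteq> x" "w \<noteq> y" if "w \<in> C1" using that xyC disj by auto
    have nab: "w \<noteq> a" "w \<noteq> b" if "w \<notin> C1" using that abC by auto
    have ab': "(a, b) \<in> ?R'" if "w \<noteq> a" "w \<noteq> b"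
    proof (cases "w \<in> C1")
      case True
      show ?thesis
        using rtrancl_trans[OF rtrancl_trans[OF ax path2] adj_symD[OF by2]] True that nxy by blast
    qed (rule path1)
    have xy': "(x, y) \<in> ?R'" if "w \<noteq> x" "w \<noteq> y"
    proof (cases "w \<in> C1")
      case False
      show ?thesis
        using rtrancl_trans[OF rtrancl_trans[OF adj_symD[OF ax] path1] by2] False that nab by blast
    qed (rule path2)
    consider "{s, t} = {a, b}" | "{s, t} = {x, y}" | "{s, t} \<in> del E' w"
      using st by (auto simp: E'_def)
    then show ?thesis
    proof cases
      case 1
      then have "(a, b) \<in> ?R'" using ab' st by auto
      then show ?thesis using 1 adj_symD by (fastforce simp: doubleton_eq_iff)
    next
      case 2
      then have "(x, y) \<in> ?R'" using xy' st by auto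
      then show ?thesis using 2 adj_symD by (fastforce simp: doubleton_eq_iff)
    qed (rule adj_edge)
  qed
  have "(adj (del E w))\<^sup>* \<subseteq> (adj (del E' w))\<^sup>*" for w
  proof (rule rtrancl_subset_rtrancl)
    show "adj (del E w) \<subseteq> (adj (del E' w))\<^sup>*" using edge' by (auto simp: adj_def)
  qed
  then have sub: "reachable_triples n E \<subseteq> reachable_triples n E'"
    by (auto simp: reachable_triples_def)
  have xV: "x < n" "x \<noteq> v" using xyC C2V by auto
  have "(a, x) \<in> (adj (del E' v))\<^sup>*" using abV xV by (intro adj_edge) (auto simp: E'_def)
  moreover have "(a, x) \<notin> ?R" using xyC disj by (auto simp: C1_def component_def)
  ultimately have "(v, a, x) \<in> reachable_triples n E' - reachable_triples n E"
    using v abV xV by (auto simp: reachable_triples_def)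
  then show ?thesis using g' deg' sub by blast
qed

text \<open>Induction on the number of missing triples. The number of edges is half the degree sum,
  so the assumptions carry over to each exchanged graph.\<close>

theorem biconnected_realization:
  fixes n :: nat
  assumes g: "graph {..<n} E" and n: "n \<ge> 2" and deg2: "\<And>v. v < n \<Longrightarrow> 2 \<le> degree E v"
    and edges: "\<And>v. v < n \<Longrightarrow> n + degree E v \<le> card E + 2"
  shows "\<exists>E'. graph {..<n} E' \<and> (\<forall>i. degree E' i = degree E i) \<and> biconnected {..<n} E'"
proof -
  let ?U = "{..n} \<times> {..<n} \<times> {..<n}"
  have sub: "reachable_triples n F \<subseteq> ?U" for F by (auto simp: reachable_triples_def)
  show ?thesis
    using g deg2 edges
  proof (induction "card ?U - card (reachable_triples n E)" arbitrary: E rule: less_induct)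
    case less
    show ?case
    proof (cases "biconnected {..<n} E")
      case False
      then obtain v p q where "v \<le> n" "p \<in> {..<n} - {v}" "q \<in> {..<n} - {v}" "(p, q) \<notin> (adj (del E v))\<^sup>*"
        using biconnectedI[OF less.prems(1) n] by blast
      from biconnect_step[OF less.prems this] obtain E' where
        E': "graph {..<n} E'" "\<And>i. degree E' i = degree E i" "reachable_triples n E \<subset> reachable_triples n E'"
        by blast
      have "card (reachable_triples n E) < card (reachable_triples n E')"
        using E'(3) sub by (meson finite_SigmaI finite_atMost finite_lessThan psubset_card_mono rev_finite_subset)
      moreover have "card (reachable_triples n E') \<le> card ?U" using sub by (intro card_mono) auto
      ultimately have "card ?U - card (reachable_triples n E') < card ?U - card (reachable_triples n E)"
        by linarith
      moreover have "card E' = card E" using handshake[OF E'(1)] handshake[OF less.prems(1)] E'(2) by simp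
      ultimately have "\<exists>E''. graph {..<n} E'' \<and> (\<forall>i. degree E'' i = degree E' i) \<and> biconnected {..<n} E''"
        using less.hyps[of E'] E' less.prems by simp
      then show ?thesis using E'(2) by simp
    qed (use less.prems in blast)
  qed
qed

text \<open>Deleting \<open>v\<close> leaves a connected graph on n - 1 vertices, which has at least
  n - 2 edges. If \<open>v\<close> had a single neighbour, deleting that neighbour would cut
  \<open>v\<close> off from a third vertex.\<close>

lemma biconnected_degree:
  fixes n :: nat
  assumes g: "graph {..<n} E" and bic: "biconnected {..<n} E" and n: "n \<ge> 3" and v: "v < n"
  shows "2 \<le> degree E v" "n + degree E v \<le> card E + 2"
proof -
  have con: "connected_graph ({..<n} - {w}) (del E w)" if "w < n" for w
    using bic that by (auto simp: biconnected_def cut_vertex_def)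
  have gd: "graph ({..<n} - {w}) (del E w)" for w using g by (auto simp: graph_def)
  show "n + degree E v \<le> card E + 2"
    using connected_card_edges[OF gd con[OF v]] card_del[OF g, of v] v by simp
  have nbr: "\<exists>u. u \<noteq> w \<and> {v, u} \<in> E" if w: "w < n" "w \<noteq> v" for w
  proof -
    obtain z where z: "z < n" "z \<noteq> w" "z \<noteq> v"
    proof -
      have "card ({..<n} - {v, w}) \<noteq> 0" using n v w by (simp add: card_Diff_subset)
      then have "{..<n} - {v, w} \<noteq> {}" by (metis card.empty)
      then show ?thesis using that by auto
    qed
    then have "(v, z) \<in> (adj (del E w))\<^sup>*"
      using con[OF w(1)] v w by (auto simp: connected_graph_def adj_def)
    then obtain u where "(v, u) \<in> adj (del E w)" using z by (metis converse_rtranclE)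
    then show ?thesis by (auto simp: adj_def)
  qed
  obtain w where w: "w < n" "w \<noteq> v" using n that[of 0] that[of 1] by (cases "v = 0") auto
  obtain u where u: "{v, u} \<in> E" using nbr[OF w] by blast
  then have "u < n" "u \<noteq> v" using graph_edge[OF g u] by auto
  then obtain u' where u': "u' \<noteq> u" "{v, u'} \<in> E" using nbr[of u] by blast
  have "{u, u'} \<subseteq> nbrs E v" using u u' by (auto simp: nbrs_def)
  then have "card {u, u'} \<le> card (nbrs E v)" using finite_nbrs[OF g] by (rule card_mono[rotated])
  then show "2 \<le> degree E v" using u' by (simp add: degree_nbrs[OF g])
qed

theorem Db_iff:
  assumes n: "n \<ge> 3"
  shows "ds \<in> Db n \<longleftrightarrow> ds \<in> D0 n \<and> (\<forall>x\<in>set ds. 2 \<le> x) \<and> 2 * (n - 2 + hd ds) \<le> sum_list ds"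
proof
  assume "ds \<in> Db n"
  then obtain E where E: "graph {..<n} E" "biconnected {..<n} E" "ds = degree_sequence n E"
    by (auto simp: Db_def)
  have set: "set ds = degree E ` {..<n}" by (simp add: E degree_sequence_def atLeast_upt lessThan_atLeast0)
  have "sum_list ds = (\<Sum>i<n. degree E i)"
    unfolding E(3) degree_sequence_def
    by (metis mset_rev mset_sort sum_mset_sum_list interv_sum_list_conv_sum_set_nat atLeast_upt set_upt lessThan_atLeast0)
  then have sum: "sum_list ds = 2 * card E" using handshake[OF E(1)] by simp
  have "length ds = n" by (simp add: E degree_sequence_def)
  then have "ds \<noteq> []" using n by auto
  then have "hd ds \<in> set ds" by simp
  then obtain v where v: "v < n" "hd ds = degree E v" using set by auto
  have "2 * (n - 2 + hd ds) \<le> sum_list ds"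
    using biconnected_degree(2)[OF E(1,2) n v(1)] v(2) sum n by simp
  moreover have "\<forall>x\<in>set ds. 2 \<le> x" using biconnected_degree(1)[OF E(1,2) n] set by auto
  ultimately show "ds \<in> D0 n \<and> (\<forall>x\<in>set ds. 2 \<le> x) \<and> 2 * (n - 2 + hd ds) \<le> sum_list ds"
    using E by (auto simp: D0_def)
next
  assume R: "ds \<in> D0 n \<and> (\<forall>x\<in>set ds. 2 \<le> x) \<and> 2 * (n - 2 + hd ds) \<le> sum_list ds"
  then obtain E where E: "graph {..<n} E" "\<And>i. i < n \<Longrightarrow> degree E i = ds ! i"
    and len: "length ds = n" and srt: "sorted_wrt (\<ge>) ds"
    by (auto simp: D0_iff)
  have "sum_list ds = (\<Sum>i<n. degree E i)" using E len by (simp add: sum_list_sum_nth lessThan_atLeast0)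
  then have sum: "sum_list ds = 2 * card E" using handshake[OF E(1)] by simp
  have hd: "ds ! i \<le> hd ds" if "i < n" for i
  proof -
    have "hd ds = ds ! 0" using len n by (intro hd_conv_nth) auto
    then show ?thesis using srt that len by (cases "i = 0") (auto simp: sorted_wrt_iff_nth_less)
  qed
  have "\<exists>E'. graph {..<n} E' \<and> (\<forall>i. degree E' i = degree E i) \<and> biconnected {..<n} E'"
  proof (rule biconnected_realization[OF E(1)])
    show "n + degree E v \<le> card E + 2" if "v < n" for v
      using hd[OF that] E(2)[OF that] sum R n by auto
    show "2 \<le> degree E v" if "v < n" for v using R E(2)[OF that] len that by simp
  qed (use n in simp)
  then obtain E' where E': "graph {..<n} E'" "\<And>i. degree E' i = degree E i" "biconnected {..<n} E'"
    by blast
  have "map (degree E') [0..<n] = ds" using E E' len by (intro nth_equalityI) auto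
  then have "degree_sequence n E' = ds" using rev_sort_eq[of ds ds] srt by (simp add: degree_sequence_def)
  then show "ds \<in> Db n" using E' by (auto simp: Db_def)
qed

section \<open>Peeling the first row and column\<close>

text \<open>Deletion of the first column of the Ferrers diagram; filtering first keeps the result
  free of zero parts.\<close>

definition peel :: "nat list \<Rightarrow> nat list" where
  "peel p = map (\<lambda>x. x - 1) (filter (\<lambda>x. 2 \<le> x) p)"

text \<open>The inverse of \<open>peel\<close> once the height \<open>l\<close> of the deleted
  column is given: \<open>l\<close> records how many parts equal to 1 were lost.\<close>

definition unpeel :: "nat \<Rightarrow> nat list \<Rightarrow> nat list" where
  "unpeel l q = map Suc q @ replicate (l - length q) 1"

lemma length_peel_le: "length (peel p) \<le> length p"
  by (simp add: peel_def)

text \<open>The condition that defines \<open>P(N,k,l,s)\<close>, unrolled by removing the first row and column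
  repeatedly.\<close>

function slack :: "int \<Rightarrow> nat list \<Rightarrow> bool" where
  "slack s [] \<longleftrightarrow> True"
| "slack s (a # p) \<longleftrightarrow> 0 \<le> s + int (length p) - int a \<and> slack (s + int (length p) - int a) (peel p)"
  by pat_completeness auto
termination
  by (relation "measure (length \<circ> snd)") (auto simp: less_Suc_eq_le length_peel_le)

lemma is_partition_Cons:
  "is_partition (a # p) \<longleftrightarrow> 1 \<le> a \<and> (\<forall>x\<in>set p. x \<le> a) \<and> is_partition p"
  by (auto simp: is_partition_def)

lemma is_partition_peel: "is_partition p \<Longrightarrow> is_partition (peel p)"
  by (induction p) (fastforce simp: is_partition_def peel_def)+

lemma is_partition_unpeel:
  assumes "is_partition q"
  shows "is_partition (unpeel l q)"
proof -
  have "sorted_wrt (\<ge>) (replicate m (1::nat))" for m by (induction m) auto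
  then show ?thesis
    using assms by (auto simp: is_partition_def unpeel_def sorted_wrt_append sorted_wrt_map)
qed

lemma length_unpeel: "length q \<le> l \<Longrightarrow> length (unpeel l q) = l"
  by (simp add: unpeel_def)

lemma sum_unpeel:
  assumes "length q \<le> l"
  shows "sum_list (unpeel l q) = sum_list q + l"
proof -
  have "sum_list (map Suc q) = sum_list q + length q" by (induction q) auto
  then show ?thesis using assms by (simp add: unpeel_def sum_list_replicate)
qed

lemma peel_unpeel: "is_partition q \<Longrightarrow> peel (unpeel l q) = q"
  by (induction q) (auto simp: is_partition_def peel_def unpeel_def)

lemma unpeel_peel:
  assumes "is_partition p"
  shows "unpeel (length p) (peel p) = p"
  using assms
proof (induction p)
  case (Cons a p)
  note part = Cons.prems[unfolded is_partition_Cons]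
  show ?case
  proof (cases "2 \<le> a")
    case True
    then show ?thesis using Cons.IH part by (simp add: peel_def unpeel_def)
  next
    case False
    then have "\<forall>x\<in>set p. x = 1" using part by (fastforce simp: is_partition_def)
    then have "p = replicate (length p) 1" by (simp add: replicate_length_same)
    then have "filter (\<lambda>x. 2 \<le> x) p = []" 
      using \<open>\<forall>x\<in>set p. x = 1\<close> by (auto simp: filter_empty_conv)
    then show ?thesis using False part \<open>p = _\<close> by (simp add: peel_def unpeel_def)
  qed
qed (simp add: peel_def unpeel_def)

lemma sum_peel_le: "sum_list (peel p) \<le> sum_list p"
  by (induction p) (auto simp: peel_def)

lemma peel_le: "x \<in> set (peel p) \<Longrightarrow> \<forall>y\<in>set p. y \<le> k \<Longrightarrow> x \<le> k - 1"
  by (auto simp: peel_def)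

text \<open>A step lowers the slack by at most the row it removes, so the slack continues to
  dominate the sum of what is left.\<close>

lemma slack_large: "int (sum_list p) \<le> s \<Longrightarrow> slack s p"
proof (induction s p rule: slack.induct)
  case (2 s a p)
  then show ?case using sum_peel_le[of p] by simp
qed simp

subsection \<open>The Durfee square condition\<close>

lemma ferrers_Suc:
  assumes "is_partition (a # p)" "1 \<le> i" "1 \<le> j"
  shows "(Suc i, Suc j) \<in> ferrers (a # p) \<longleftrightarrow> (i, j) \<in> ferrers (peel p)"
proof -
  \<comment> \<open>The parts below 2 form a final segment of a partition, so filtering them out
    shifts no index.\<close>
  have "is_partition p \<Longrightarrow> 1 \<le> j \<Longrightarrow>
      k < length (filter (\<lambda>x. 2 \<le> x) p) \<and> j \<le> filter (\<lambda>x. 2 \<le> x) p ! k - 1 \<longleftrightarrow>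
      k < length p \<and> Suc j \<le> p ! k" for k
  proof (induction p arbitrary: k)
    case (Cons x p)
    show ?case
    proof (cases "2 \<le> x")
      case True
      then show ?thesis using Cons by (cases k) (auto simp: is_partition_Cons)
    next
      case False
      then have le: "y \<le> 1" if "y \<in> set (x # p)" for y
        using that Cons.prems by (force simp: is_partition_Cons)
      then have "filter (\<lambda>x. 2 \<le> x) (x # p) = []" by (intro filter_False ballI) (use le in fastforce)
      moreover have "\<not> Suc j \<le> (x # p) ! k" if "k < length (x # p)"
        using le[OF nth_mem[OF that]] Cons.prems(2) by linarith
      ultimately show ?thesis by auto
    qed
  qed simp
  from this[of "i - 1"] show ?thesis
    using assms by (cases i) (auto simp: is_partition_Cons ferrers_def peel_def)
qed

lemma ferrers_bound: "(i, j) \<in> ferrers p \<Longrightarrow> 1 \<le> i \<and> i \<le> length p \<and> 1 \<le> j \<and> j \<le> sum_list p"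
  using member_le_sum_list[of "p ! (i - 1)" p] by (auto simp: ferrers_def)

lemma finite_ferrers: "finite {i. (i, j) \<in> ferrers p}" "finite {j. (i, j) \<in> ferrers p}"
  using ferrers_bound by (fastforce intro: finite_subset[of _ "{..length p}"] finite_subset[of _ "{..sum_list p}"])+

lemma le_durfee_iff: "d \<le> durfee p \<longleftrightarrow> {1..d} \<times> {1..d} \<subseteq> ferrers p"
proof -
  have bound: "d \<le> length p" if "{1..d} \<times> {1..d} \<subseteq> ferrers p" for d
    using subsetD[OF that, of "(d, 1)"] ferrers_bound[of d 1 p] by (cases "d = 0") auto
  have "{1..durfee p} \<times> {1..durfee p} \<subseteq> ferrers p"
    unfolding durfee_def by (rule GreatestI_nat[of _ 0]) (use bound in auto)
  moreover have "d \<le> durfee p" if "{1..d} \<times> {1..d} \<subseteq> ferrers p"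
    unfolding durfee_def by (rule Greatest_le_nat) (use bound that in auto)
  ultimately show ?thesis by fastforce
qed

text \<open>A square in the corner loses its first row and column. Conversely these are filled in
  because the diagram contains every dot above or to the left of one of its dots.\<close>

lemma durfee_Cons:
  assumes p: "is_partition (a # p)"
  shows "durfee (a # p) = Suc (durfee (peel p))"
proof -
  have "Suc d \<le> durfee (a # p) \<longleftrightarrow> d \<le> durfee (peel p)" for d
  proof -
    have "{1..Suc d} \<times> {1..Suc d} \<subseteq> ferrers (a # p) \<longleftrightarrow> {1..d} \<times> {1..d} \<subseteq> ferrers (peel p)"
    proof
      assume l: "{1..Suc d} \<times> {1..Suc d} \<subseteq> ferrers (a # p)"
      show "{1..d} \<times> {1..d} \<subseteq> ferrers (peel p)"
      proof
        fix ij assume "ij \<in> {1..d} \<times> {1..d}"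
        then obtain i j where "ij = (i, j)" "i \<in> {1..d}" "j \<in> {1..d}" by blast
        moreover from this have "(Suc i, Suc j) \<in> ferrers (a # p)" using l by auto
        ultimately show "ij \<in> ferrers (peel p)" using ferrers_Suc[OF p, of i j] by auto
      qed
    next
      assume r: "{1..d} \<times> {1..d} \<subseteq> ferrers (peel p)"
      show "{1..Suc d} \<times> {1..Suc d} \<subseteq> ferrers (a # p)"
      proof
        fix ij assume "ij \<in> {1..Suc d} \<times> {1..Suc d}"
        then obtain i j where ij: "ij = (i, j)" "1 \<le> i" "i \<le> Suc d" "1 \<le> j" "j \<le> Suc d" by auto
        have one: "(1, 1) \<in> ferrers (a # p)" using p by (auto simp: ferrers_def is_partition_Cons)
        have inner: "(Suc i', Suc j') \<in> ferrers (a # p)" if "1 \<le> i'" "i' \<le> d" "1 \<le> j'" "j' \<le> d" for i' j'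
          using that r ferrers_Suc[OF p, of i' j'] by auto
        consider "i = 1" "j = 1" | "i = 1" "j \<noteq> 1" | "i \<noteq> 1" "j = 1" | "i \<noteq> 1" "j \<noteq> 1" by blast
        then have "(i, j) \<in> ferrers (a # p)"
        proof cases
          case 2
          then have "(2, j) \<in> ferrers (a # p)" using inner[of 1 "j - 1"] ij by (simp add: numeral_2_eq_2)
          then have "p \<noteq> []" "j \<le> p ! 0" by (auto simp: ferrers_def)
          moreover from this have "p ! 0 \<le> a" using p by (auto simp: is_partition_Cons)
          ultimately show ?thesis using 2 ij by (auto simp: ferrers_def)
        next
          case 3
          then have "(i, 2) \<in> ferrers (a # p)" using inner[of "i - 1" 1] ij by (simp add: numeral_2_eq_2)
          then show ?thesis using 3 by (auto simp: ferrers_def)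
        qed (use one inner[of "i - 1" "j - 1"] ij in auto)
        then show "ij \<in> ferrers (a # p)" using ij by simp
      qed
    qed
    then show ?thesis by (simp add: le_durfee_iff)
  qed
  from this[of "durfee (peel p)"] this[of "durfee (a # p) - 1"] show ?thesis by auto
qed

lemma r_diff_Cons_1:
  assumes p: "is_partition (a # p)"
  shows "r_diff (a # p) 1 = int (length p) + 1 - int a"
proof -
  have "(a # p) ! i \<ge> 1" if "i < length (a # p)" for i
    using nth_mem[OF that] p by (auto simp: is_partition_def)
  then have "{i. (i, 1) \<in> ferrers (a # p)} = {1..Suc (length p)}"
    by (auto simp: ferrers_def simp del: nth_Cons_pos)
  moreover have "{j. (1, j) \<in> ferrers (a # p)} = {1..a}" by (auto simp: ferrers_def)
  ultimately show ?thesis by (simp add: r_diff_def col_def row_def)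
qed

text \<open>Within the Durfee square, row and column \<open>Suc i\<close> both reach the removed
  column and row, so each loses exactly one dot and their difference is unchanged.\<close>

lemma r_diff_Cons_Suc:
  assumes p: "is_partition (a # p)" and i: "1 \<le> i" "i \<le> durfee (peel p)"
  shows "r_diff (a # p) (Suc i) = r_diff (peel p) i"
proof -
  have ii: "Suc i \<le> durfee (a # p)" using durfee_Cons[OF p] i by simp
  then have mem: "(1, Suc i) \<in> ferrers (a # p)" "(Suc i, 1) \<in> ferrers (a # p)"
    unfolding le_durfee_iff by auto
  have "{k. (k, Suc i) \<in> ferrers (a # p)} = insert 1 (Suc ` {k. (k, i) \<in> ferrers (peel p)})" (is "?L = ?R")
  proof
    show "?L \<subseteq> ?R"
    proof
      fix k assume k: "k \<in> ?L"
      then obtain k' where k': "k = Suc k'" using ferrers_bound by (cases k) force+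
      then show "k \<in> ?R" using k ferrers_Suc[OF p, of k' i] i by (cases "k' = 0") auto
    qed
    show "?R \<subseteq> ?L" using mem ferrers_Suc[OF p _ i(1)] ferrers_bound by blast
  qed
  moreover have "1 \<notin> Suc ` {k. (k, i) \<in> ferrers (peel p)}" using ferrers_bound by fastforce
  ultimately have c: "col (a # p) (Suc i) = Suc (col (peel p) i)"
    using finite_ferrers by (simp add: col_def card_image)
  have "{k. (Suc i, k) \<in> ferrers (a # p)} = insert 1 (Suc ` {k. (i, k) \<in> ferrers (peel p)})" (is "?L = ?R")
  proof
    show "?L \<subseteq> ?R"
    proof
      fix k assume k: "k \<in> ?L"
      then obtain k' where k': "k = Suc k'" using ferrers_bound by (cases k) force+
      then show "k \<in> ?R" using k ferrers_Suc[OF p i(1), of k'] by (cases "k' = 0") auto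
    qed
    show "?R \<subseteq> ?L" using mem ferrers_Suc[OF p i(1)] ferrers_bound by blast
  qed
  moreover have "1 \<notin> Suc ` {k. (i, k) \<in> ferrers (peel p)}" using ferrers_bound by fastforce
  ultimately have r: "row (a # p) (Suc i) = Suc (row (peel p) i)"
    using finite_ferrers by (simp add: row_def card_image)
  show ?thesis using c r by (simp add: r_diff_def)
qed

text \<open>A step of \<open>slack\<close> adds the current row-column difference minus 1. After j
  steps the running slack is s plus the first j differences minus j, so its nonnegativity is the
  j-th condition, and the number of steps is the Durfee size.\<close>

lemma slack_iff_durfee:
  assumes "is_partition p" "0 \<le> s"
  shows "slack s p \<longleftrightarrow> (\<forall>j. 1 \<le> j \<and> j \<le> durfee p \<longrightarrow> int j \<le> s + (\<Sum>i=1..j. r_diff p i))"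
  using assms
proof (induction s p rule: slack.induct)
  case (1 s)
  have "durfee [] = 0" using le_durfee_iff[of 1 "[]"] by (auto simp: ferrers_def)
  then show ?case by simp
next
  case (2 s a p)
  let ?t = "s + int (length p) - int a" and ?p = "a # p"
  have part: "is_partition (peel p)" using 2(2) is_partition_Cons is_partition_peel by blast
  have sum: "s + (\<Sum>i=1..Suc j. r_diff ?p i) = ?t + 1 + (\<Sum>i=1..j. r_diff (peel p) i)"
    if "j \<le> durfee (peel p)" for j
  proof -
    have "(\<Sum>i=1..Suc j. r_diff ?p i) = r_diff ?p 1 + (\<Sum>i=Suc 1..Suc j. r_diff ?p i)"
      by (rule sum.atLeast_Suc_atMost) simp
    also have "(\<Sum>i=Suc 1..Suc j. r_diff ?p i) = (\<Sum>i=1..j. r_diff ?p (Suc i))"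
      by (rule sum.shift_bounds_cl_Suc_ivl)
    also have "\<dots> = (\<Sum>i=1..j. r_diff (peel p) i)"
      using r_diff_Cons_Suc[OF 2(2)] that by (intro sum.cong) auto
    finally show ?thesis using r_diff_Cons_1[OF 2(2)] by simp
  qed
  have all: "(\<forall>j. 1 \<le> j \<and> j \<le> durfee ?p \<longrightarrow> P j) \<longleftrightarrow> (\<forall>j\<le>durfee (peel p). P (Suc j))" for P
    unfolding durfee_Cons[OF 2(2)] by (metis One_nat_def Suc_le_mono le_Suc_ex plus_1_eq_Suc le_add1)
  have "(\<forall>j. 1 \<le> j \<and> j \<le> durfee ?p \<longrightarrow> int j \<le> s + (\<Sum>i=1..j. r_diff ?p i))
      \<longleftrightarrow> (\<forall>j\<le>durfee (peel p). int j \<le> ?t + (\<Sum>i=1..j. r_diff (peel p) i))"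
    unfolding all using sum by (auto simp del: sum.cl_ivl_Suc)
  \<comment> \<open>The instance \<open>j = 0\<close> is the sign condition on the new slack; the
    others form the condition for \<open>peel p\<close>.\<close>
  also have "\<dots> \<longleftrightarrow> 0 \<le> ?t \<and> (\<forall>j. 1 \<le> j \<and> j \<le> durfee (peel p) \<longrightarrow> int j \<le> ?t + (\<Sum>i=1..j. r_diff (peel p) i))"
  proof -
    have "(\<forall>j\<le>durfee (peel p). Q j) \<longleftrightarrow> Q 0 \<and> (\<forall>j. 1 \<le> j \<and> j \<le> durfee (peel p) \<longrightarrow> Q j)" for Q
      by (metis One_nat_def Suc_leI bot_nat_0.not_eq_extremum le0)
    from this[of "\<lambda>j. int j \<le> ?t + (\<Sum>i=1..j. r_diff (peel p) i)"] show ?thesis by simp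
  qed
  also have "\<dots> \<longleftrightarrow> slack s ?p" using 2(1)[OF part] by auto
  finally show ?case by simp
qed

subsection \<open>The Erdos--Gallai inequalities\<close>

text \<open>The k-th Erdos-Gallai inequality relaxed by \<open>s\<close>. It is stated over the
  integers because peeling can make the slack negative.\<close>

definition eg_at :: "int \<Rightarrow> nat list \<Rightarrow> nat \<Rightarrow> bool" where
  "eg_at s p k \<longleftrightarrow> int (sum_list (take k p)) \<le>
     int (k * (k - 1)) + int (sum_list (map (\<lambda>x. min x k) (drop k p))) + s"

lemma eg_at_beyond:
  assumes "eg_at s p (length p)" "length p \<le> k"
  shows "eg_at s p k"
proof -
  have "length p * (length p - 1) \<le> k * (k - 1)" using assms(2) by (intro mult_le_mono) auto
  then have "int (length p * (length p - 1)) \<le> int (k * (k - 1))" by (rule zle_int[THEN iffD2])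
  then show ?thesis using assms unfolding eg_at_def by simp
qed

lemma eg_at_append_zeros: "eg_at s (p @ replicate m 0) k \<longleftrightarrow> eg_at s p k"
proof -
  have "sum_list (take k (replicate m 0)) = (0::nat)" for k
    by (simp add: take_replicate sum_list_replicate)
  moreover have "sum_list (map (\<lambda>x. min x k) (drop j (replicate m 0))) = (0::nat)" for j
    by (simp add: drop_replicate sum_list_replicate)
  ultimately show ?thesis
    unfolding eg_at_def take_append drop_append map_append sum_list_append by (simp add: sum_list_replicate)
qed

text \<open>Zero terms alter neither side, and beyond the length of \<open>p\<close> only the term
  \<open>k * (k - 1)\<close> grows. This reconciles sequences of fixed length with
  partitions.\<close>

lemma eg_append_zeros:
  "(\<forall>k\<le>length p + m. eg_at s (p @ replicate m 0) k) \<longleftrightarrow> (\<forall>k\<le>length p. eg_at s p k)"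
  unfolding eg_at_append_zeros by (meson eg_at_beyond le_add1 le_trans linorder_linear order_refl)

text \<open>Passing to the peeled list, the left side drops by a + k. On the right, k (k - 1)
  replaces (k + 1) k, a loss of 2 k, and the minima lose one per remaining term, |q| - k in all. The
  balance |q| - a is absorbed by the slack.\<close>

lemma eg_at_Cons:
  assumes "\<forall>x\<in>set q. 1 \<le> x" "k \<le> length q"
  shows "eg_at s (a # q) (Suc k) \<longleftrightarrow> eg_at (s + int (length q) - int a) (map (\<lambda>x. x - 1) q) k"
proof -
  have t: "int (sum_list (map (\<lambda>x. x - 1) (take k q))) + int k = int (sum_list (take k q))"
  proof -
    have "\<forall>x\<in>set q. 1 \<le> x \<Longrightarrow> int (sum_list (map (\<lambda>x. x - 1) q)) + int (length q) = int (sum_list q)" for q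
      by (induction q) auto
    from this[of "take k q"] show ?thesis using assms by (auto dest: in_set_takeD)
  qed
  have d: "int (sum_list (map (\<lambda>x. min (x - 1) k) (drop k q))) + (int (length q) - int k)
      = int (sum_list (map (\<lambda>x. min x (Suc k)) (drop k q)))"
  proof -
    have "\<forall>x\<in>set q. 1 \<le> x \<Longrightarrow> int (sum_list (map (\<lambda>x. min (x - 1) k) q)) + int (length q)
        = int (sum_list (map (\<lambda>x. min x (Suc k)) q))" for q
      by (induction q) auto
    from this[of "drop k q"] show ?thesis using assms by (auto dest: in_set_dropD simp: of_nat_diff)
  qed
  have kk: "int (Suc k * k) = int (k * (k - 1)) + 2 * int k"
    by (cases k) (auto simp: algebra_simps)
  show ?thesis
    unfolding eg_at_def take_Suc_Cons drop_Suc_Cons sum_list.Cons take_map drop_map map_map comp_def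
      diff_Suc_1 of_nat_add kk
    using t d by (intro iffI; linarith)
qed

lemma map_pred_eq_peel:
  assumes "is_partition p"
  shows "map (\<lambda>x. x - 1) p = peel p @ replicate (length p - length (peel p)) 0"
proof -
  have "map (\<lambda>x. x - 1) (unpeel (length p) (peel p)) = peel p @ replicate (length p - length (peel p)) 0"
    by (simp add: unpeel_def comp_def)
  then show ?thesis using unpeel_peel[OF assms] by simp
qed

lemma slack_iff_eg:
  assumes "is_partition p" "0 \<le> s"
  shows "slack s p \<longleftrightarrow> (\<forall>k\<le>length p. eg_at s p k)"
  using assms
proof (induction s p rule: slack.induct)
  case (1 s)
  then show ?case by (simp add: eg_at_def)
next
  case (2 s a p)
  let ?t = "s + int (length p) - int a"
  have part: "is_partition p" "\<forall>x\<in>set p. 1 \<le> x" using 2(2) by (auto simp: is_partition_def)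
  have len: "length p = length (peel p) + (length p - length (peel p))" using length_peel_le by simp
  have all: "(\<forall>k\<le>Suc m. P k) \<longleftrightarrow> P 0 \<and> (\<forall>k\<le>m. P (Suc k))" for m and P :: "nat \<Rightarrow> bool"
    by (metis Suc_le_mono le0 not0_implies_Suc)
  have "(\<forall>k\<le>length (a # p). eg_at s (a # p) k) \<longleftrightarrow> (\<forall>k\<le>length p. eg_at s (a # p) (Suc k))"
    using 2(3) unfolding list.size(4) add_Suc_right add_0_right all by (simp add: eg_at_def)
  also have "\<dots> \<longleftrightarrow> (\<forall>k\<le>length p. eg_at ?t (map (\<lambda>x. x - 1) p) k)"
    using eg_at_Cons[OF part(2)] by blast
  also have "\<dots> \<longleftrightarrow> (\<forall>k\<le>length (peel p). eg_at ?t (peel p) k)"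
    unfolding map_pred_eq_peel[OF part(1)] using eg_append_zeros[of "peel p" "length p - length (peel p)" ?t] len by simp
  also have "\<dots> \<longleftrightarrow> slack s (a # p)"
  proof (cases "0 \<le> ?t")
    case True
    then show ?thesis using 2(1) is_partition_peel[OF part(1)] by simp
  next
    case False
    \<comment> \<open>A negative slack already violates the inequality for k = 0, whose remaining
      terms vanish.\<close>
    then have "\<not> eg_at ?t (peel p) 0" by (simp add: eg_at_def)
    then show ?thesis using False by auto
  qed
  finally show ?case by simp
qed

section \<open>From degree sequences with zeros to partitions\<close>

lemma sorted_filter_pos:
  fixes ds :: "nat list"
  assumes "sorted_wrt (\<ge>) ds"
  shows "ds = filter ((<) 0) ds @ replicate (length ds - length (filter ((<) 0) ds)) 0"
  using assms
proof (induction ds)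
  case (Cons d ds)
  show ?case
  proof (cases "d = 0")
    case True
    then have z: "\<forall>x\<in>set (d # ds). x = 0" using Cons.prems by simp
    then have "filter ((<) 0) (d # ds) = []" by (auto simp: filter_empty_conv)
    moreover have "d # ds = replicate (length (d # ds)) 0" using z by (metis replicate_length_same)
    ultimately show ?thesis by (metis append_Nil diff_zero list.size(3))
  qed (use Cons in simp)
qed simp

lemma is_partition_filter_pos: "sorted_wrt (\<ge>) (ds :: nat list) \<Longrightarrow> is_partition (filter ((<) 0) ds)"
  by (auto simp: is_partition_def sorted_wrt_filter)

text \<open>The bridge from graphs to partitions: the counting arguments below use this criterion in
  place of graphs, except where complements are taken and terms are bounded by n - 1.\<close>

theorem D0_iff_slack:
  "ds \<in> D0 n \<longleftrightarrow> length ds = n \<and> sorted_wrt (\<ge>) ds \<and> even (sum_list ds) \<and> slack 0 (filter ((<) 0) ds)"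
proof (cases "length ds = n \<and> sorted_wrt (\<ge>) ds")
  case True
  then have len: "length ds = n" and srt: "sorted_wrt (\<ge>) ds" by auto
  have mono: "ds ! j \<le> ds ! i" if "i \<le> j" "j < n" for i j
    using srt that len by (cases "i = j") (auto simp: sorted_wrt_iff_nth_less)
  have sum: "sum_list ds = (\<Sum>i<n. ds ! i)" using len by (simp add: sum_list_sum_nth lessThan_atLeast0)
  have eg: "eg_at 0 ds k \<longleftrightarrow> (\<Sum>i<k. ds ! i) \<le> k * (k - 1) + (\<Sum>i\<in>{k..<n}. min (ds ! i) k)"
    if "k \<le> n" for k
  proof -
    have "sum_list (take k ds) = (\<Sum>i<k. ds ! i)"
      using that len by (simp add: sum_list_sum_nth lessThan_atLeast0 min_absorb2)
    moreover have "sum_list (map (\<lambda>x. min x k) (drop k ds)) = (\<Sum>i\<in>{k..<n}. min (ds ! i) k)"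
    proof -
      have "sum_list (map (\<lambda>x. min x k) (drop k ds)) = (\<Sum>i\<in>{0..<n - k}. min (ds ! (k + i)) k)"
        using that len by (simp add: sum_list_sum_nth)
      also have "\<dots> = (\<Sum>i\<in>{k..<n}. min (ds ! i) k)"
        using sum.shift_bounds_nat_ivl[of "\<lambda>i. min (ds ! i) k" 0 k "n - k"] that by (simp add: add.commute)
      finally show ?thesis .
    qed
    ultimately show ?thesis unfolding eg_at_def
      by (simp only: of_nat_add[symmetric] add_0_right of_nat_le_iff)
  qed
  let ?p = "filter ((<) 0) ds"
  have "slack 0 ?p \<longleftrightarrow> (\<forall>k\<le>length ?p. eg_at 0 ?p k)"
    using is_partition_filter_pos[OF srt] by (simp add: slack_iff_eg)
  also have "\<dots> \<longleftrightarrow> (\<forall>k\<le>n. eg_at 0 ds k)"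
    using eg_append_zeros[of ?p "length ds - length ?p" 0] sorted_filter_pos[OF srt] len length_filter_le[of "(<) 0" ds]
    by simp
  finally have sl: "slack 0 ?p \<longleftrightarrow>
      (\<forall>k\<le>n. (\<Sum>i<k. ds ! i) \<le> k * (k - 1) + (\<Sum>i\<in>{k..<n}. min (ds ! i) k))"
    using eg by simp
  have "(\<exists>E. graph {..<n} E \<and> (\<forall>i<n. degree E i = ds ! i)) \<longleftrightarrow> even (sum_list ds) \<and> slack 0 ?p"
  proof
    assume "\<exists>E. graph {..<n} E \<and> (\<forall>i<n. degree E i = ds ! i)"
    then obtain E where E: "graph {..<n} E" "\<And>i. i < n \<Longrightarrow> degree E i = ds ! i" by blast
    have "sum_list ds = 2 * card E" using handshake[OF E(1)] E(2) sum by simp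
    moreover have "(\<Sum>i<k. ds ! i) \<le> k * (k - 1) + (\<Sum>i\<in>{k..<n}. min (ds ! i) k)" if "k \<le> n" for k
      using erdos_gallai_necessary[OF E(1) that] E(2) that by simp
    ultimately show "even (sum_list ds) \<and> slack 0 ?p" using sl by simp
  next
    assume "even (sum_list ds) \<and> slack 0 ?p"
    then show "\<exists>E. graph {..<n} E \<and> (\<forall>i<n. degree E i = ds ! i)"
      using erdos_gallai_sufficient[of n "\<lambda>i. ds ! i"] mono sum sl by simp
  qed
  then show ?thesis using True D0_iff by blast
next
  case False
  then show ?thesis using D0_iff by blast
qed

section \<open>Counting\<close>

definition hooked :: "nat \<Rightarrow> nat \<Rightarrow> nat list set" where
  "hooked k m = {p. is_partition p \<and> length p = Suc m \<and> hd p = k}"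

definition box :: "nat \<Rightarrow> nat \<Rightarrow> nat list set" where
  "box k l = {p. is_partition p \<and> length p \<le> l \<and> (\<forall>x\<in>set p. x \<le> k)}"

text \<open>The sets P(N,k,l,s) united over all N of parity \<open>b\<close>, for nonnegative
  \<open>s\<close>.\<close>

definition slack_box :: "nat \<Rightarrow> nat \<Rightarrow> int \<Rightarrow> nat \<Rightarrow> nat list set" where
  "slack_box k l s b = {p \<in> box k l. sum_list p mod 2 = b \<and> slack s p}"

lemma finite_box: "finite (box k l)"
  by (rule finite_subset[OF _ finite_lists_length_le[of "{..k}" l]]) (auto simp: box_def)

lemma finite_slack_box: "finite (slack_box k l s b)"
  using finite_box by (simp add: slack_box_def)

text \<open>Fixing the first row and the first column leaves an arbitrary partition in the box that
  remains inside the hook.\<close>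

lemma bij_betw_hooked:
  assumes "1 \<le> k"
  shows "bij_betw (\<lambda>q. k # unpeel m q) (box (k - 1) m) (hooked k m)"
proof (rule bij_betw_byWitness[where f' = "\<lambda>p. peel (tl p)"])
  show "\<forall>q\<in>box (k - 1) m. peel (tl (k # unpeel m q)) = q"
    by (simp add: box_def peel_unpeel)
  show "\<forall>p\<in>hooked k m. k # unpeel m (peel (tl p)) = p"
  proof
    fix p assume "p \<in> hooked k m"
    then have "p = k # tl p" "is_partition p" "length (tl p) = m"
      by (cases p; simp add: hooked_def)+
    then show "k # unpeel m (peel (tl p)) = p"
      using unpeel_peel[of "tl p"] by (metis is_partition_Cons)
  qed
  show "(\<lambda>q. k # unpeel m q) ` box (k - 1) m \<subseteq> hooked k m"
    using assms by (auto simp: box_def hooked_def is_partition_Cons is_partition_unpeel length_unpeel)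
      (auto simp: unpeel_def)
  show "(\<lambda>p. peel (tl p)) ` hooked k m \<subseteq> box (k - 1) m"
  proof
    fix q assume "q \<in> (\<lambda>p. peel (tl p)) ` hooked k m"
    then obtain p where p: "p \<in> hooked k m" "q = peel (tl p)" by blast
    then have "p = k # tl p" "is_partition p" "length (tl p) = m"
      by (cases p; simp add: hooked_def)+
    then have "is_partition (tl p)" "\<forall>x\<in>set (tl p). x \<le> k" by (metis is_partition_Cons)+
    then show "q \<in> box (k - 1) m"
      using p is_partition_peel peel_le length_peel_le[of "tl p"] \<open>length (tl p) = m\<close> by (auto simp: box_def)
  qed
qed

text \<open>The removed hook has k + m dots, which shifts the parity. The test \<open>b < 2\<close>
  is kept because for larger \<open>b\<close> the left side is empty, which the residue on the right
  does not show.\<close>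

lemma card_hooked:
  assumes "1 \<le> k"
  shows "card {p \<in> hooked k m. sum_list p mod 2 = b \<and> slack s p} =
    (if 0 \<le> s + int m - int k \<and> b < 2 then card (slack_box (k - 1) m (s + int m - int k) ((b + k + m) mod 2)) else 0)"
proof -
  have "bij_betw (\<lambda>q. k # unpeel m q)
      {q \<in> box (k - 1) m. 0 \<le> s + int m - int k \<and> b < 2 \<and> sum_list q mod 2 = (b + k + m) mod 2 \<and> slack (s + int m - int k) q}
      {p \<in> hooked k m. sum_list p mod 2 = b \<and> slack s p}"
  proof (rule bij_betw_Collect[OF bij_betw_hooked[OF assms]])
    fix q assume "q \<in> box (k - 1) m"
    then have q: "is_partition q" "length q \<le> m" by (auto simp: box_def)
    have "(k + (x + m)) mod 2 = b \<longleftrightarrow> b < 2 \<and> x mod 2 = (b + k + m) mod 2" for x by presburger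
    then show "sum_list (k # unpeel m q) mod 2 = b \<and> slack s (k # unpeel m q) \<longleftrightarrow>
        0 \<le> s + int m - int k \<and> b < 2 \<and> sum_list q mod 2 = (b + k + m) mod 2 \<and> slack (s + int m - int k) q"
      using q by (auto simp: peel_unpeel sum_unpeel length_unpeel)
  qed
  then have "card {p \<in> hooked k m. sum_list p mod 2 = b \<and> slack s p} =
    card {q \<in> box (k - 1) m. 0 \<le> s + int m - int k \<and> b < 2 \<and> sum_list q mod 2 = (b + k + m) mod 2 \<and> slack (s + int m - int k) q}"
    by (rule bij_betw_same_card[THEN sym])
  then show ?thesis by (auto simp: slack_box_def)
qed

lemma sum_list_le_length_mult:
  "\<forall>x\<in>set p. x \<le> k \<Longrightarrow> sum_list p \<le> length p * (k::nat)"
  by (induction p) (auto intro: add_mono)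

lemma length_le_sum_list: "is_partition p \<Longrightarrow> length p \<le> sum_list p"
  by (induction p) (auto simp: is_partition_Cons)

text \<open>N is the sum of a sequence of length n with largest term n - 2, whose corner hook has 2
  n - 3 dots; an even N thus means an odd rest. The range of N covers every possible rest, as n (n -
  2) - (2 n - 3) = (n - 1) (n - 3) is the area of the box.\<close>

lemma sum_card_P_res:
  assumes n: "n \<ge> 5"
  shows "(\<Sum>N\<in>I_even n. card (P_res (N - 2 * int n + 3) (int n - 3) (int n - 1) 1))
    = card (slack_box (n - 3) (n - 1) 1 1)"
proof -
  let ?P = "\<lambda>N. P_res (N - 2 * int n + 3) (int n - 3) (int n - 1) 1"
  have P: "p \<in> ?P N \<longleftrightarrow> is_partition p \<and> int (sum_list p) = N - 2 * int n + 3 \<and>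
      length p \<le> n - 1 \<and> (\<forall>x\<in>set p. x \<le> n - 3) \<and> slack 1 p" for p N
  proof -
    have "int (length p) \<le> int n - 1 \<longleftrightarrow> length p \<le> n - 1" "int x \<le> int n - 3 \<longleftrightarrow> x \<le> n - 3" for x
      using n by auto
    then show ?thesis using n slack_iff_durfee[of p 1] by (auto simp: P_res_def P_box_def)
  qed
  have fin: "finite (I_even n)"
    by (rule finite_subset[of _ "{2 * int n - 3..int n * (int n - 2)}"]) (auto simp: I_even_def)
  have "slack_box (n - 3) (n - 1) 1 1 = (\<Union>N\<in>I_even n. ?P N)"
  proof (intro equalityI subsetI)
    fix p assume p: "p \<in> slack_box (n - 3) (n - 1) 1 1"
    let ?N = "int (sum_list p) + 2 * int n - 3"
    have "sum_list p \<le> length p * (n - 3)"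
      using p by (intro sum_list_le_length_mult) (auto simp: slack_box_def box_def)
    also have "\<dots> \<le> (n - 1) * (n - 3)" using p by (intro mult_le_mono) (auto simp: slack_box_def box_def)
    finally have "int (sum_list p) \<le> int (n - 1) * int (n - 3)" by (metis of_nat_le_iff of_nat_mult)
    then have "?N \<le> int n * (int n - 2)" using n by (simp add: of_nat_diff algebra_simps)
    moreover have "odd (sum_list p)" using p by (simp add: slack_box_def odd_iff_mod_2_eq_one)
    then have "even ?N" by simp
    ultimately have "?N \<in> I_even n" by (simp add: I_even_def)
    moreover have "p \<in> ?P ?N" unfolding P using p by (simp add: slack_box_def box_def)
    ultimately show "p \<in> (\<Union>N\<in>I_even n. ?P N)" by blast
  next
    fix p assume "p \<in> (\<Union>N\<in>I_even n. ?P N)"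
    then obtain N where N: "N \<in> I_even n" "p \<in> ?P N" by blast
    then have "int (sum_list p) = N - 2 * int n + 3" "even N" unfolding P by (auto simp: I_even_def)
    then have "odd (int (sum_list p))" by presburger
    then have "sum_list p mod 2 = 1" by (simp add: odd_iff_mod_2_eq_one)
    then show "p \<in> slack_box (n - 3) (n - 1) 1 1" using N(2) unfolding P by (simp add: slack_box_def box_def)
  qed
  moreover have "card (\<Union>N\<in>I_even n. ?P N) = (\<Sum>N\<in>I_even n. card (?P N))"
  proof (rule card_UN_disjoint[OF fin])
    show "\<forall>N\<in>I_even n. finite (?P N)"
    proof
      fix N assume "N \<in> I_even n"
      have "?P N \<subseteq> box (n - 3) (n - 1)" unfolding P subset_iff by (simp add: box_def)
      then show "finite (?P N)" using finite_box finite_subset by blast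
    qed
    show "\<forall>N\<in>I_even n. \<forall>M\<in>I_even n. N \<noteq> M \<longrightarrow> ?P N \<inter> ?P M = {}"
      unfolding disjoint_iff P by auto
  qed
  ultimately show ?thesis by simp
qed

section \<open>The three kinds of sequences that are not biconnected\<close>

lemma D0_le:
  assumes "ds \<in> D0 n" "x \<in> set ds"
  shows "x \<le> n - 1"
proof -
  obtain E where E: "graph {..<n} E" "\<forall>i<n. degree E i = ds ! i" and len: "length ds = n"
    using assms(1) by (auto simp: D0_iff)
  obtain i where i: "i < n" "x = ds ! i" using assms(2) len by (auto simp: in_set_conv_nth)
  have "card (nbrs E i) \<le> card ({..<n} - {i})" using nbrs_subset[OF E(1)] by (intro card_mono) auto
  then show ?thesis using E i by (simp add: degree_nbrs)
qed

lemma finite_D0: "finite (D0 n)"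
proof (rule finite_subset)
  show "D0 n \<subseteq> {ds. set ds \<subseteq> {..n} \<and> length ds = n}"
    using D0_le by (fastforce simp: D0_iff)
qed (simp add: finite_lists_length_eq)

lemma finite_D: "finite (D n)"
  using finite_D0 by (simp add: D_def)

lemma D0_partition_iff:
  assumes "\<forall>x\<in>set ds. 1 \<le> x"
  shows "ds \<in> D0 n \<longleftrightarrow> length ds = n \<and> is_partition ds \<and> even (sum_list ds) \<and> slack 0 ds"
proof -
  have "filter ((<) 0) ds = ds" using assms by (intro filter_True) auto
  then show ?thesis using assms by (auto simp: D0_iff_slack is_partition_def)
qed

lemma D_iff: "ds \<in> D n \<longleftrightarrow> length ds = n \<and> is_partition ds \<and> even (sum_list ds) \<and> slack 0 ds"
  using D0_partition_iff[of ds n] by (auto simp: D_def is_partition_def)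

lemma sorted_last_le:
  assumes "sorted_wrt (\<ge>) (xs @ [y])" "x \<in> set (xs @ [y])"
  shows "(y::nat) \<le> x"
  using assms by (auto simp: sorted_wrt_append)

lemma card_dominating_pendant:
  assumes n: "n \<ge> 5"
  shows "card {ds \<in> D n. 1 \<in> set ds \<and> n - 1 \<in> set ds} = card (D0 (n - 2))"
proof -
  let ?f = "\<lambda>e. (n - 1) # map Suc e @ [1]"
  have len: "length (?f e) = n \<longleftrightarrow> length e = n - 2" for e using n by auto
  have "sum_list (map Suc e) = sum_list e + length e" for e by (induction e) auto
  then have even: "even (sum_list (?f e)) \<longleftrightarrow> even (sum_list e)" if "length e = n - 2" for e
    using that n by auto
  have "peel (map Suc e @ [1]) = filter ((<) 0) e" for e by (induction e) (auto simp: peel_def)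
  \<comment> \<open>The first part n - 1 and the n - 1 parts after it cancel, so the slack is 0
    again after one step.\<close>
  then have slack: "slack 0 (?f e) \<longleftrightarrow> slack 0 (filter ((<) 0) e)" if "length e = n - 2" for e
    using that n by (simp add: of_nat_diff)
  have "bij_betw ?f (D0 (n - 2)) {ds \<in> D n. 1 \<in> set ds \<and> n - 1 \<in> set ds}"
    unfolding bij_betw_def
  proof
    show "inj_on ?f (D0 (n - 2))" by (auto intro!: inj_onI simp: map_injective)
    show "?f ` D0 (n - 2) = {ds \<in> D n. 1 \<in> set ds \<and> n - 1 \<in> set ds}"
    proof (intro equalityI subsetI)
      fix ds assume "ds \<in> ?f ` D0 (n - 2)"
      then obtain e where e: "e \<in> D0 (n - 2)" "ds = ?f e" by blast
      have "Suc x \<le> n - 1" if "x \<in> set e" for x using D0_le[OF e(1) that] n by simp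
      then have "is_partition ds"
        using e n by (auto simp: D0_iff is_partition_def sorted_wrt_append sorted_wrt_map)
      then have "ds \<in> D n"
        using e(1) len[of e] even[of e] slack[of e] unfolding D_iff e(2) D0_iff_slack by blast
      then show "ds \<in> {ds \<in> D n. 1 \<in> set ds \<and> n - 1 \<in> set ds}" using e by simp
    next
      fix ds assume ds: "ds \<in> {ds \<in> D n. 1 \<in> set ds \<and> n - 1 \<in> set ds}"
      then have d0: "ds \<in> D0 n" by (simp add: D_def)
      have part: "is_partition ds" and ln: "length ds = n" using ds by (auto simp: D_iff)
      then obtain a r where ar: "ds = a # r" using n by (cases ds) auto
      have "a \<le> n - 1" using D0_le[OF d0, of a] ar by simp
      moreover have "n - 1 \<le> a" using ds part ar by (auto simp: is_partition_Cons)
      ultimately have a: "a = n - 1" by simp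
      have "r \<noteq> []" using ln ar n by auto
      then obtain r' y where ry: "r = r' @ [y]" by (metis rev_exhaust)
      have "1 \<in> set r" using ds ar a n by auto
      then have "y \<le> 1" using sorted_last_le[of r' y 1] part ar ry by (auto simp: is_partition_def)
      moreover have "1 \<le> y" using part ar ry by (auto simp: is_partition_def)
      ultimately have y: "y = 1" by simp
      define e where "e = map (\<lambda>x. x - 1) r'"
      have "map Suc e = r'" unfolding e_def using part ar ry by (auto simp: is_partition_def intro!: map_idI)
      then have f: "ds = ?f e" using ar ry a y by simp
      then have le: "length e = n - 2" using ln len by blast
      have "sorted_wrt (\<ge>) e" using part f by (auto simp: is_partition_def sorted_wrt_append sorted_wrt_map)
      then have "e \<in> D0 (n - 2)"
        using ds le even[OF le] slack[OF le] unfolding D0_iff_slack mem_Collect_eq D_iff f by blast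
      then show "ds \<in> ?f ` D0 (n - 2)" using f by blast
    qed
  qed
  then show ?thesis by (rule bij_betw_same_card[THEN sym])
qed

lemma D0_complement:
  assumes "ds \<in> D0 n"
  shows "rev (map (\<lambda>x. n - 1 - x) ds) \<in> D0 n"
proof -
  obtain E where E: "graph {..<n} E" "\<forall>i<n. degree E i = ds ! i"
    and len: "length ds = n" and srt: "sorted_wrt (\<ge>) ds"
    using assms by (auto simp: D0_iff)
  define E' where "E' = {e. e \<subseteq> {..<n} \<and> card e = 2} - E"
  have g: "graph {..<n} E'" by (auto simp: graph_def E'_def)
  have "degree E' i = n - 1 - ds ! i" if "i < n" for i
  proof -
    have "nbrs E' i = ({..<n} - {i}) - nbrs E i"
      using that by (auto simp: nbrs_def E'_def card_insert_if split: if_splits)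
    then have "degree E' i = card (({..<n} - {i}) - nbrs E i)" by (simp add: degree_nbrs[OF g])
    also have "\<dots> = card ({..<n} - {i}) - card (nbrs E i)"
      using nbrs_subset[OF E(1), of i] finite_nbrs[OF E(1)] by (intro card_Diff_subset) auto
    finally show ?thesis using that E(2) by (simp add: degree_nbrs[OF E(1)])
  qed
  then have "map (degree E') [0..<n] = map (\<lambda>x. n - 1 - x) ds" using len by (intro nth_equalityI) auto
  moreover have "sorted_wrt (\<ge>) (rev (map (\<lambda>x. n - 1 - x) ds))"
    unfolding sorted_wrt_rev sorted_wrt_map
    by (rule sorted_wrt_mono_rel[OF _ srt]) auto
  ultimately have "degree_sequence n E' = rev (map (\<lambda>x. n - 1 - x) ds)"
    unfolding degree_sequence_def by (intro rev_sort_eq) auto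
  moreover have "degree_sequence n E' \<in> D0 n" using g by (auto simp: D0_def)
  ultimately show ?thesis by (simp only:)
qed

lemma card_pendant_nondominating:
  assumes n: "n \<ge> 5"
  shows "card {ds \<in> D n. 1 \<in> set ds \<and> n - 1 \<notin> set ds} = card (slack_box (n - 3) (n - 1) 1 1)"
proof -
  let ?c = "\<lambda>ds. rev (map (\<lambda>x. n - 1 - x) ds)"
  let ?S = "{ds \<in> D n. 1 \<in> set ds \<and> n - 1 \<notin> set ds}"
  let ?T = "{ds \<in> D n. n - 2 \<in> set ds \<and> n - 1 \<notin> set ds}"
  have inv: "?c (?c ds) = ds" if "ds \<in> D n" for ds
  proof -
    have "n - 1 - (n - 1 - x) = x" if "x \<in> set ds" for x
      using D0_le[of ds n x] that \<open>ds \<in> D n\<close> by (simp add: D_def)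
    then show ?thesis by (auto simp: rev_map intro!: map_idI)
  qed
  have range: "1 \<le> x \<and> x \<le> n - 2" if "ds \<in> D n" "n - 1 \<notin> set ds" "x \<in> set ds" for ds x
  proof -
    have "x \<le> n - 1" "1 \<le> x" "x \<noteq> n - 1" using that D0_le[of ds n x] by (auto simp: D_def)
    then show ?thesis by auto
  qed
  have cD: "?c ds \<in> D n" "n - 1 \<notin> set (?c ds)" if dsD: "ds \<in> D n" "n - 1 \<notin> set ds" for ds
  proof -
    have pos: "1 \<le> y \<and> y \<noteq> n - 1" if y: "y \<in> set (?c ds)" for y
    proof -
      obtain x where "x \<in> set ds" "y = n - 1 - x" using y by auto
      then show ?thesis using range[OF dsD, of x] n by auto
    qed
    have "?c ds \<in> D0 n" using D0_complement dsD(1) unfolding D_def by blast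
    then show "?c ds \<in> D n" unfolding D_def mem_Collect_eq using pos by blast
    show "n - 1 \<notin> set (?c ds)" using pos by blast
  qed
  have "bij_betw ?c ?S ?T"
  proof (rule bij_betw_byWitness[where f' = ?c])
    have "n - 2 \<in> set (?c ds)" if "1 \<in> set ds" for ds using that n by force
    then show "?c ` ?S \<subseteq> ?T" using cD by blast
    have "1 \<in> set (?c ds)" if "n - 2 \<in> set ds" for ds using that n by force
    then show "?c ` ?T \<subseteq> ?S" using cD by blast
  qed (use inv in auto)
  then have "card ?S = card ?T" by (rule bij_betw_same_card)
  also have "?T = {p \<in> hooked (n - 2) (n - 1). sum_list p mod 2 = 0 \<and> slack 0 p}"
  proof (intro equalityI subsetI)
    fix ds assume ds: "ds \<in> ?T"
    then have part: "is_partition ds" and len: "length ds = n" by (auto simp: D_iff)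
    then obtain a r where ar: "ds = a # r" using n by (cases ds) auto
    have "a \<le> n - 2" using range[of ds a] ds ar by simp
    moreover have "n - 2 \<le> a" using ds part ar by (auto simp: is_partition_Cons)
    ultimately have "hd ds = n - 2" using ar by simp
    then show "ds \<in> {p \<in> hooked (n - 2) (n - 1). sum_list p mod 2 = 0 \<and> slack 0 p}"
      using ds n by (auto simp: hooked_def D_iff even_iff_mod_2_eq_zero)
  next
    fix ds assume ds: "ds \<in> {p \<in> hooked (n - 2) (n - 1). sum_list p mod 2 = 0 \<and> slack 0 p}"
    then obtain r where r: "ds = (n - 2) # r" by (cases ds) (auto simp: hooked_def)
    have "ds \<in> D n" using ds n by (auto simp: hooked_def D_iff even_iff_mod_2_eq_zero)
    moreover have "n - 1 \<notin> set ds" using ds r n by (auto simp: hooked_def is_partition_Cons)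
    ultimately show "ds \<in> ?T" using r by simp
  qed
  also have "card \<dots> = card (slack_box (n - 3) (n - 1) 1 1)"
  proof -
    \<comment> \<open>Removing the hook raises the slack from 0 to (n - 1) - (n - 2) = 1 and, having
      2 n - 3 dots, flips the parity from even to odd.\<close>
    have "n - 2 - 1 = n - 3" "(0 + (n - 2) + (n - 1)) mod 2 = 1" "0 + int (n - 1) - int (n - 2) = 1"
      using n by (auto simp: of_nat_diff) presburger
    then show ?thesis using card_hooked[of "n - 2" "n - 1" 0 0] n by simp
  qed
  finally show ?thesis .
qed

lemma card_few_edges:
  assumes n: "n \<ge> 5"
  shows "card {ds \<in> D n. 1 \<notin> set ds \<and> sum_list ds < 2 * (n - 2 + hd ds)}
    = (\<Sum>i=4..n - 1. \<Sum>j | j \<le> i - 4 \<and> j mod 2 = i mod 2. card (P_all j))"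
proof -
  let ?J = "\<lambda>i. {j. j \<le> i - 4 \<and> j mod 2 = i mod 2}"
  let ?A = "SIGMA i:{4..n - 1}. \<Union>j\<in>?J i. P_all j"
  let ?S = "{ds \<in> D n. 1 \<notin> set ds \<and> sum_list ds < 2 * (n - 2 + hd ds)}"
  let ?u = "unpeel (n - 1)"
  have finP: "finite (P_all j)" for j
  proof (rule finite_subset)
    show "P_all j \<subseteq> box j j"
    proof
      fix p assume p: "p \<in> P_all j"
      then have "x \<le> j" if "x \<in> set p" for x
        using member_le_sum_list[OF that] by (simp add: P_all_def)
      then show "p \<in> box j j" using p length_le_sum_list[of p] by (auto simp: P_all_def box_def)
    qed
  qed (rule finite_box)
  have finJ: "finite (?J i)" for i :: nat by (rule finite_subset[of _ "{..i}"]) auto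
  have A: "(i, q) \<in> ?A \<longleftrightarrow> i \<in> {4..n - 1} \<and> is_partition q \<and> sum_list q \<le> i - 4 \<and> sum_list q mod 2 = i mod 2" for i q
    by (auto simp: P_all_def)
  have "bij_betw (\<lambda>(i, q). i # ?u (?u q)) ?A ?S"
  proof (rule bij_betw_byWitness[where f' = "\<lambda>ds. (hd ds, peel (peel (tl ds)))"])
    show "\<forall>a\<in>?A. (\<lambda>ds. (hd ds, peel (peel (tl ds)))) (case a of (i, q) \<Rightarrow> i # ?u (?u q)) = a"
      by (auto simp: P_all_def peel_unpeel is_partition_unpeel)
    have S: "ds = hd ds # tl ds \<and> is_partition (tl ds) \<and> length (tl ds) = n - 1 \<and>
        is_partition (peel (tl ds)) \<and> length (peel (tl ds)) = n - 1" if ds: "ds \<in> ?S" for ds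
    proof -
      have part: "is_partition ds" and len: "length ds = n" using ds by (auto simp: D_iff)
      then obtain a r where ar: "ds = a # r" using n by (cases ds) auto
      have "2 \<le> x" if "x \<in> set r" for x
      proof -
        have "x \<noteq> 1" "1 \<le> x" using that ds ar part by (auto simp: is_partition_def)
        then show ?thesis by simp
      qed
      then have "length (peel r) = length r" by (simp add: peel_def)
      moreover have "is_partition r" using part ar is_partition_Cons by blast
      ultimately show ?thesis using len ar is_partition_peel by simp
    qed
    show "\<forall>ds\<in>?S. (case (hd ds, peel (peel (tl ds))) of (i, q) \<Rightarrow> i # ?u (?u q)) = ds"
    proof
      fix ds assume "ds \<in> ?S"
      from S[OF this] show "(case (hd ds, peel (peel (tl ds))) of (i, q) \<Rightarrow> i # ?u (?u q)) = ds"
        using unpeel_peel[of "tl ds"] unpeel_peel[of "peel (tl ds)"] by simp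
    qed
    show "(\<lambda>(i, q). i # ?u (?u q)) ` ?A \<subseteq> ?S"
    proof (rule image_subsetI)
      fix a assume "a \<in> ?A"
      moreover obtain i q where a: "a = (i, q)" by (cases a)
      ultimately have "(i, q) \<in> ?A" by simp
      then have i: "4 \<le> i" "i \<le> n - 1" and q: "is_partition q" "sum_list q \<le> i - 4"
        and par: "sum_list q mod 2 = i mod 2" unfolding A by auto
      have lq: "length q \<le> n - 1" using length_le_sum_list[OF q(1)] q(2) i by simp
      let ?q = "?u (?u q)"
      have lu: "length (?u q) = n - 1" using lq by (rule length_unpeel)
      have sum: "sum_list ?q = sum_list q + 2 * (n - 1)" using lq lu by (simp add: sum_unpeel)
      have u: "?q = map Suc (?u q)" using lu by (simp add: unpeel_def)
      have sq: "Suc (Suc x) \<le> i" if "x \<in> set q" for x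
        using member_le_sum_list[OF that] q(2) i by simp
      have "\<forall>x\<in>set ?q. x \<le> i" using i sq by (auto simp: unpeel_def)
      then have part: "is_partition (i # ?q)"
        unfolding is_partition_Cons using is_partition_unpeel[OF is_partition_unpeel[OF q(1)]] i by simp
      have "slack (int (n - 1) - int i) (?u q)"
      proof (cases q)
        case Nil
        obtain m where m: "n - 1 = Suc m" using n by (cases "n - 1") auto
        have "?u q = 1 # replicate m 1" unfolding unpeel_def Nil m by simp
        moreover have "peel (replicate m 1) = []" by (simp add: peel_def)
        ultimately show ?thesis using i m by simp
      next
        case (Cons a q')
        obtain m where m: "n - 1 = Suc m" using n by (cases "n - 1") auto
        have uq: "?u q = Suc a # unpeel m q'" unfolding unpeel_def Cons m by simp
        have "length q' \<le> m" "is_partition q'" using lq m Cons q(1) by (auto simp: is_partition_Cons)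
        \<comment> \<open>Two rows are gone and the slack is 2 n - 4 - i - a. The remaining sum is
          at most i - 4 - a, which is no larger because i < n; hence \<open>slack_large\<close>
          applies.\<close>
        moreover have "int (sum_list q') \<le> int (n - 1) - int i + int m - int (Suc a)"
          using q(2) i m Cons by simp
        ultimately show ?thesis
          unfolding uq using slack_large by (simp add: length_unpeel peel_unpeel)
      qed
      then have "slack 0 (i # ?q)"
        using i(2) lu is_partition_unpeel[OF q(1)] by (simp add: length_unpeel peel_unpeel)
      moreover have "even (sum_list (i # ?q))" using sum par by simp presburger
      moreover have "length (i # ?q) = n" using lu n by (simp add: length_unpeel)
      ultimately have "i # ?q \<in> D n" unfolding D_iff using part by blast
      moreover have "1 \<notin> set (i # ?q)" using i unfolding u by (auto simp: unpeel_def)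
      moreover have "sum_list (i # ?q) < 2 * (n - 2 + hd (i # ?q))" using sum q(2) i by simp
      ultimately have "i # ?q \<in> ?S" by blast
      then show "(case a of (i, q) \<Rightarrow> i # ?u (?u q)) \<in> ?S" by (simp add: a)
    qed
    show "(\<lambda>ds. (hd ds, peel (peel (tl ds)))) ` ?S \<subseteq> ?A"
    proof (rule image_subsetI)
      fix ds assume "ds \<in> ?S"
      then have ds: "ds \<in> D n" "1 \<notin> set ds" "sum_list ds < 2 * (n - 2 + hd ds)" by auto
      let ?q = "peel (peel (tl ds))" and ?i = "hd ds"
      have s: "ds = hd ds # tl ds" "is_partition (tl ds)" "length (tl ds) = n - 1"
        "is_partition (peel (tl ds))" "length (peel (tl ds)) = n - 1" using S ds by blast+
      have q: "is_partition ?q" "length ?q \<le> n - 1"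
        using is_partition_peel[OF s(4)] length_peel_le[of "peel (tl ds)"] s by auto
      have "ds = ?i # ?u (?u ?q)" using s unpeel_peel[of "tl ds"] unpeel_peel[of "peel (tl ds)"] by simp
      then have "sum_list ds = ?i + sum_list (?u (?u ?q))" by (metis sum_list.Cons)
      then have sum: "sum_list ds = ?i + sum_list ?q + 2 * (n - 1)"
        using q by (simp add: sum_unpeel length_unpeel)
      have even: "even (sum_list ds)" using ds by (simp add: D_iff)
      have par: "sum_list ?q mod 2 = ?i mod 2" using sum even by presburger
      \<comment> \<open>The bound on the sum gives only i - 3; equal parity of \<open>?i\<close> and
        the sum of \<open>?q\<close> improves it to i - 4, the bound in the formula.\<close>
      moreover have "sum_list ?q + 3 \<le> ?i" using sum ds(3) n by simp
      ultimately have le: "sum_list ?q + 4 \<le> ?i" by presburger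
      have "?i \<in> set ds" using s(1) by (metis list.set_intros(1))
      then have "?i \<le> n - 1" using D0_le[of ds n] ds(1) by (simp add: D_def)
      then show "(?i, ?q) \<in> ?A" unfolding A using q par le by auto
    qed
  qed
  then have "card ?S = card ?A" by (rule bij_betw_same_card[THEN sym])
  also have "\<dots> = (\<Sum>i=4..n - 1. card (\<Union>j\<in>?J i. P_all j))"
    using finP finJ by (intro card_SigmaI) auto
  also have "\<dots> = (\<Sum>i=4..n - 1. \<Sum>j\<in>?J i. card (P_all j))"
    using finP finJ by (intro sum.cong card_UN_disjoint) (auto simp: P_all_def)
  finally show ?thesis .
qed

theorem card_Db:
  assumes n: "n \<ge> 5"
  shows "card (D n) = card (Db n) + card (D0 (n - 2)) + card (slack_box (n - 3) (n - 1) 1 1)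
    + (\<Sum>i=4..n - 1. \<Sum>j | j \<le> i - 4 \<and> j mod 2 = i mod 2. card (P_all j))"
proof -
  let ?S1 = "{ds \<in> D n. 1 \<in> set ds \<and> n - 1 \<in> set ds}"
  let ?S2 = "{ds \<in> D n. 1 \<in> set ds \<and> n - 1 \<notin> set ds}"
  let ?S3 = "{ds \<in> D n. 1 \<notin> set ds \<and> sum_list ds < 2 * (n - 2 + hd ds)}"
  have "Db n = {ds \<in> D n. 1 \<notin> set ds \<and> \<not> sum_list ds < 2 * (n - 2 + hd ds)}"
  proof -
    have "(\<forall>x\<in>set ds. 2 \<le> x) \<longleftrightarrow> (\<forall>x\<in>set ds. 1 \<le> x) \<and> 1 \<notin> set ds" for ds :: "nat list"
    proof -
      have "2 \<le> x \<longleftrightarrow> 1 \<le> x \<and> x \<noteq> 1" for x :: nat by linarith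
      then show ?thesis by blast
    qed
    then show ?thesis using n Db_iff[of n] by (auto simp: D_def not_less)
  qed
  then have D: "D n = Db n \<union> (?S1 \<union> (?S2 \<union> ?S3))" and disj: "Db n \<inter> (?S1 \<union> (?S2 \<union> ?S3)) = {}"
    by auto
  have fin: "finite (Db n)" "finite ?S1" "finite ?S2" "finite ?S3"
    using finite_D[of n] finite_subset[of "Db n" "D n"] D by auto
  have "card (D n) = card (Db n \<union> (?S1 \<union> (?S2 \<union> ?S3)))" using D by (rule arg_cong)
  also have "\<dots> = card (Db n) + card (?S1 \<union> (?S2 \<union> ?S3))"
    using fin disj by (intro card_Un_disjoint) auto
  also have "card (?S1 \<union> (?S2 \<union> ?S3)) = card ?S1 + card (?S2 \<union> ?S3)"
    using fin by (intro card_Un_disjoint) auto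
  also have "card (?S2 \<union> ?S3) = card ?S2 + card ?S3"
    using fin by (intro card_Un_disjoint) auto
  finally have "card (D n) = card (Db n) + (card ?S1 + (card ?S2 + card ?S3))" .
  then show ?thesis
    unfolding card_dominating_pendant[OF n] card_pendant_nondominating[OF n] card_few_edges[OF n] by simp
qed

section \<open>Recurrences\<close>

lemma slack_box_boundary:
  assumes "k = 0 \<or> l = 0"
  shows "card (slack_box k l s b) = (if b = 0 then 1 else 0)"
proof -
  have "box k l = {[]}"
  proof -
    have "p = []" if "p \<in> box k l" for p
      using that assms by (cases p) (auto simp: box_def is_partition_Cons)
    moreover have "[] \<in> box k l" by (simp add: box_def is_partition_def)
    ultimately show ?thesis by blast
  qed
  then have "p \<in> slack_box k l s b \<longleftrightarrow> p = [] \<and> b = 0" for p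
    unfolding slack_box_def mem_Collect_eq \<open>box k l = {[]}\<close> singleton_iff by (cases "p = []") auto
  then have "slack_box k l s b = (if b = 0 then {[]} else {})" by (simp add: set_eq_iff)
  then show ?thesis by (cases "b = 0") simp_all
qed

text \<open>Inclusion-exclusion over the two boxes smaller by one column or one row; a partition in
  neither fills both the first row and the first column, so it is counted by
  \<open>card_hooked\<close>. Written additively to avoid truncated subtraction.\<close>

lemma card_slack_box_Suc:
  assumes "b < 2"
  shows "card (slack_box (Suc k) (Suc l) s b) + card (slack_box k l s b) =
    card (slack_box k (Suc l) s b) + card (slack_box (Suc k) l s b) +
    (if int (Suc k) \<le> s + int l then card (slack_box k l (s + int l - int (Suc k)) ((b + Suc k + l) mod 2)) else 0)"
proof -
  let ?H = "{p \<in> hooked (Suc k) l. sum_list p mod 2 = b \<and> slack s p}"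
  let ?A = "slack_box k (Suc l) s b" and ?B = "slack_box (Suc k) l s b"
  have "slack_box (Suc k) (Suc l) s b = (?A \<union> ?B) \<union> ?H"
  proof -
    have "box (Suc k) (Suc l) = (box k (Suc l) \<union> box (Suc k) l) \<union> hooked (Suc k) l"
    proof (intro equalityI subsetI)
      fix p assume p: "p \<in> box (Suc k) (Suc l)"
      show "p \<in> (box k (Suc l) \<union> box (Suc k) l) \<union> hooked (Suc k) l"
      proof (cases "length p = Suc l \<and> hd p = Suc k")
        case True
        then show ?thesis using p by (simp add: box_def hooked_def)
      next
        case False
        show ?thesis
        proof (cases p)
          case (Cons a q)
          then have "\<forall>x\<in>set p. x \<le> a" using p by (auto simp: box_def is_partition_Cons)
          moreover have "a \<le> Suc k" using p Cons by (simp add: box_def)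
          ultimately have "length p \<le> l \<or> (\<forall>x\<in>set p. x \<le> k)" using False p Cons
            by (fastforce simp: box_def)
          then show ?thesis using p by (auto simp: box_def)
        qed (use p in \<open>simp add: box_def\<close>)
      qed
    next
      fix p assume "p \<in> (box k (Suc l) \<union> box (Suc k) l) \<union> hooked (Suc k) l"
      then show "p \<in> box (Suc k) (Suc l)"
        by (cases p) (auto simp: box_def hooked_def is_partition_Cons)
    qed
    then show ?thesis by (auto simp: slack_box_def)
  qed
  moreover have "(?A \<union> ?B) \<inter> ?H = {}"
  proof -
    have "p \<notin> box k (Suc l)" "p \<notin> box (Suc k) l" if "p \<in> hooked (Suc k) l" for p
      using that by (cases p; auto simp: box_def hooked_def)+
    then show ?thesis by (auto simp: slack_box_def)
  qed
  moreover have "finite ?H" using finite_box[of "Suc k" "Suc l"] calculation(1) finite_slack_box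
    by (metis (no_types, lifting) finite_Un)
  ultimately have "card (slack_box (Suc k) (Suc l) s b) = card (?A \<union> ?B) + card ?H"
    using finite_slack_box by (simp add: card_Un_disjoint)
  moreover have "?A \<inter> ?B = slack_box k l s b" by (auto simp: slack_box_def box_def)
  then have "card (?A \<union> ?B) + card (slack_box k l s b) = card ?A + card ?B"
    using card_Un_Int[of ?A ?B] finite_slack_box by simp
  ultimately show ?thesis using card_hooked[of "Suc k" l b s] assms by simp
qed

text \<open>No partition in the box exceeds its area, and by \<open>slack_large\<close> a slack of
  that size imposes no condition.\<close>

lemma slack_box_large:
  assumes "int (k * l) \<le> s" "int (k * l) \<le> t"
  shows "slack_box k l s b = slack_box k l t b"
proof -
  have "slack u p" if "p \<in> box k l" "int (k * l) \<le> u" for p u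
  proof (rule slack_large)
    have "sum_list p \<le> length p * k" using that(1) by (intro sum_list_le_length_mult) (auto simp: box_def)
    also have "\<dots> \<le> k * l" using that(1) by (simp add: box_def mult.commute)
    finally show "int (sum_list p) \<le> u" using that(2) by linarith
  qed
  then show ?thesis using assms unfolding slack_box_def by blast
qed

text \<open>The entry for a \<open>k\<close> by \<open>l\<close> box, slack \<open>s\<close> and parity \<open>b\<close> is stored at index
  \<open>(k * n + l) * width n + (2 * s + b)\<close>. Slacks above \<open>n * n\<close> impose no condition and are replaced
  by \<open>n * n\<close>.\<close>

definition width :: "nat \<Rightarrow> nat" where
  "width n = 2 * (n * n + 1)"

lemma double_add_less_width: "s \<le> n * n \<Longrightarrow> b < 2 \<Longrightarrow> 2 * s + b < width n"
  by (simp add: width_def)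

definition slack_table :: "nat \<Rightarrow> nat \<Rightarrow> nat" where
  "slack_table n t = (let u = t div width n; z = t mod width n in
     card (slack_box (u div n) (u mod n) (int (z div 2)) (z mod 2)))"

lemma slack_table_index:
  assumes "l < n" "z < width n"
  shows "slack_table n ((k * n + l) * width n + z) = card (slack_box k l (int (z div 2)) (z mod 2))"
  using assms by (simp add: slack_table_def)

text \<open>Within a block the offset \<open>z\<close> encodes twice the slack plus the parity, so
  \<open>z\<close> can stand for its own parity bit. Capping \<open>w\<close> is harmless since the
  area of the smaller box is at most n * n.\<close>

lemma slack_table_rec:
  assumes k: "Suc k < n" and l: "Suc l < n" and z: "z < width n"
  defines "w \<equiv> int (z div 2) + int l - int (Suc k)"
  shows "int (slack_table n ((Suc k * n + Suc l) * width n + z)) =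
    int (slack_table n ((k * n + Suc l) * width n + z)) + int (slack_table n ((Suc k * n + l) * width n + z))
    - int (slack_table n ((k * n + l) * width n + z))
    + (if w < 0 then 0 else
       int (slack_table n ((k * n + l) * width n + (2 * nat (min w (int (n * n))) + (z + Suc k + l) mod 2))))"
proof -
  have par: "(z mod 2 + Suc k + l) mod 2 = (z + Suc k + l) mod 2"
    by (simp only: add.assoc mod_add_left_eq)
  have "slack_table n ((k * n + l) * width n + (2 * nat (min w (int (n * n))) + (z + Suc k + l) mod 2))
      = card (slack_box k l w ((z + Suc k + l) mod 2))" if "0 \<le> w"
  proof -
    have "nat (min w (int (n * n))) \<le> n * n" by linarith
    moreover have "(z + Suc k + l) mod 2 < 2" by simp
    ultimately have "2 * nat (min w (int (n * n))) + (z + Suc k + l) mod 2 < width n"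
      by (rule double_add_less_width)
    then have "slack_table n ((k * n + l) * width n + (2 * nat (min w (int (n * n))) + (z + Suc k + l) mod 2))
        = card (slack_box k l (min w (int (n * n))) ((z + Suc k + l) mod 2))"
      using slack_table_index[of l n _ k] l that by simp
    also have "slack_box k l (min w (int (n * n))) ((z + Suc k + l) mod 2) = slack_box k l w ((z + Suc k + l) mod 2)"
    proof (cases "w \<le> int (n * n)")
      case False
      have "k * l \<le> n * n" using k l by (intro mult_le_mono) auto
      then have "int (k * l) \<le> int (n * n)" by (rule zle_int[THEN iffD2])
      then show ?thesis using False by (intro slack_box_large) auto
    qed simp
    finally show ?thesis .
  qed
  moreover have "int (card (slack_box (Suc k) (Suc l) (int (z div 2)) (z mod 2))) + int (card (slack_box k l (int (z div 2)) (z mod 2))) =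
    int (card (slack_box k (Suc l) (int (z div 2)) (z mod 2))) + int (card (slack_box (Suc k) l (int (z div 2)) (z mod 2))) +
    (if w < 0 then 0 else int (card (slack_box k l w ((z + Suc k + l) mod 2))))"
    using card_slack_box_Suc[of "z mod 2" k l "int (z div 2)"] unfolding par w_def by auto
  moreover have idx: "slack_table n ((k' * n + l') * width n + z) = card (slack_box k' l' (int (z div 2)) (z mod 2))"
    if "l' < n" for k' l'
    using that z by (rule slack_table_index)
  have "l < n" using l by simp
  ultimately show ?thesis unfolding idx[OF l] idx[OF \<open>l < n\<close>] by (cases "w < 0") simp_all
qed

section \<open>Partition numbers and the sums that the program evaluates\<close>

definition partitions_upto :: "nat \<Rightarrow> nat \<Rightarrow> nat list set" where
  "partitions_upto m j = {p. is_partition p \<and> (\<forall>x\<in>set p. x \<le> m) \<and> sum_list p = j}"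

lemma finite_partitions_upto: "finite (partitions_upto m j)"
  by (rule finite_subset[OF _ finite_box[of m j]])
    (auto simp: partitions_upto_def box_def length_le_sum_list)

lemma partitions_upto_0: "card (partitions_upto 0 j) = (if j = 0 then 1 else 0)"
proof -
  have "p = []" if "is_partition p" "\<forall>x\<in>set p. x \<le> 0" for p
    using that by (cases p) (auto simp: is_partition_Cons)
  then have "p \<in> partitions_upto 0 j \<longleftrightarrow> p = [] \<and> j = 0" for p
    unfolding partitions_upto_def by (cases "p = []") (auto simp: is_partition_def)
  then have "partitions_upto 0 j = (if j = 0 then {[]} else {})" by (simp add: set_eq_iff)
  then show ?thesis by (cases "j = 0") simp_all
qed

text \<open>A partition either has all parts at most \<open>m\<close> or starts with
  \<open>Suc m\<close>, in which case that one part is removed.\<close>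

lemma card_partitions_upto_Suc:
  "card (partitions_upto (Suc m) j) = card (partitions_upto m j) +
    (if Suc m \<le> j then card (partitions_upto (Suc m) (j - Suc m)) else 0)"
proof -
  let ?I = "if Suc m \<le> j then (#) (Suc m) ` partitions_upto (Suc m) (j - Suc m) else {}"
  have "partitions_upto (Suc m) j = partitions_upto m j \<union> ?I"
  proof (intro equalityI subsetI)
    fix p assume p: "p \<in> partitions_upto (Suc m) j"
    show "p \<in> partitions_upto m j \<union> ?I"
    proof (cases "Suc m \<in> set p")
      case True
      then obtain a q where aq: "p = a # q" by (cases p) auto
      then have "a = Suc m" using p True by (force simp: partitions_upto_def is_partition_Cons)
      then show ?thesis using p aq by (auto simp: partitions_upto_def is_partition_Cons)
    next
      case False
      then have "\<forall>x\<in>set p. x \<le> m" using p by (force simp: partitions_upto_def le_Suc_eq)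
      then show ?thesis using p by (auto simp: partitions_upto_def)
    qed
  next
    fix p assume "p \<in> partitions_upto m j \<union> ?I"
    then show "p \<in> partitions_upto (Suc m) j"
      by (auto simp: partitions_upto_def is_partition_Cons split: if_splits)
  qed
  moreover have "partitions_upto m j \<inter> ?I = {}"
  proof -
    have "Suc m \<in> set p" if "p \<in> ?I" for p using that by (auto split: if_splits)
    moreover have "Suc m \<notin> set p" if "p \<in> partitions_upto m j" for p
      using that by (auto simp: partitions_upto_def)
    ultimately show ?thesis by blast
  qed
  moreover have "finite ?I" using finite_partitions_upto by simp
  moreover have "card ?I = (if Suc m \<le> j then card (partitions_upto (Suc m) (j - Suc m)) else 0)"
    by (simp add: card_image)
  ultimately show ?thesis using finite_partitions_upto by (simp add: card_Un_disjoint)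
qed

lemma partitions_upto_eq_P_all: "j \<le> m \<Longrightarrow> partitions_upto m j = P_all j"
  unfolding partitions_upto_def P_all_def using member_le_sum_list by fastforce

definition partition_table :: "nat \<Rightarrow> nat \<Rightarrow> nat" where
  "partition_table n t = card (partitions_upto (t div n) (t mod n))"

lemma partition_table_index: "j < n \<Longrightarrow> partition_table n (m * n + j) = card (partitions_upto m j)"
  by (simp add: partition_table_def)

text \<open>After exchanging the sums, \<open>j\<close> occurs once for each i among j + 4, j + 6,
  ... up to n - 1. This reduces the double sum to a single loop.\<close>

lemma sum_P_all:
  assumes "n \<ge> 5"
  shows "(\<Sum>i=4..n - 1. \<Sum>j | j \<le> i - 4 \<and> j mod 2 = i mod 2. card (P_all j))
    = (\<Sum>j<n - 4. card (P_all j) * ((n - 3 - j) div 2))"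
proof -
  have "(\<Sum>i=4..n - 1. \<Sum>j | j \<le> i - 4 \<and> j mod 2 = i mod 2. card (P_all j))
      = (\<Sum>i=4..n - 1. \<Sum>j<n - 4. card (P_all j) * of_bool (j + 4 \<le> i \<and> j mod 2 = i mod 2))"
  proof (rule sum.cong)
    fix i assume i: "i \<in> {4..n - 1}"
    have "{j. j \<le> i - 4 \<and> j mod 2 = i mod 2} = {j \<in> {..<n - 4}. j + 4 \<le> i \<and> j mod 2 = i mod 2}"
      using i by auto
    moreover have "(\<Sum>j<n - 4. card (P_all j) * of_bool (j + 4 \<le> i \<and> j mod 2 = i mod 2))
        = (\<Sum>j\<in>{j \<in> {..<n - 4}. j + 4 \<le> i \<and> j mod 2 = i mod 2}. card (P_all j))"
      by (subst sum.inter_filter) (simp, rule sum.cong, auto)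
    ultimately show "(\<Sum>j | j \<le> i - 4 \<and> j mod 2 = i mod 2. card (P_all j))
        = (\<Sum>j<n - 4. card (P_all j) * of_bool (j + 4 \<le> i \<and> j mod 2 = i mod 2))" by simp
  qed simp
  also have "\<dots> = (\<Sum>j<n - 4. \<Sum>i=4..n - 1. card (P_all j) * of_bool (j + 4 \<le> i \<and> j mod 2 = i mod 2))"
    by (rule sum.swap)
  also have "\<dots> = (\<Sum>j<n - 4. card (P_all j) * ((n - 3 - j) div 2))"
  proof (rule sum.cong)
    fix j assume j: "j \<in> {..<n - 4}"
    have "bij_betw (\<lambda>x. j + 4 + 2 * x) {..<(n - 3 - j) div 2} {i \<in> {4..n - 1}. j + 4 \<le> i \<and> j mod 2 = i mod 2}"
    proof (rule bij_betw_byWitness[where f' = "\<lambda>i. (i - j - 4) div 2"])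
      show "(\<lambda>x. j + 4 + 2 * x) ` {..<(n - 3 - j) div 2} \<subseteq> {i \<in> {4..n - 1}. j + 4 \<le> i \<and> j mod 2 = i mod 2}"
        using j by (auto; presburger)
      show "(\<lambda>i. (i - j - 4) div 2) ` {i \<in> {4..n - 1}. j + 4 \<le> i \<and> j mod 2 = i mod 2} \<subseteq> {..<(n - 3 - j) div 2}"
        using j by (auto; presburger)
      show "\<forall>i\<in>{i \<in> {4..n - 1}. j + 4 \<le> i \<and> j mod 2 = i mod 2}. j + 4 + 2 * ((i - j - 4) div 2) = i"
        by (auto; presburger)
    qed simp
    from bij_betw_same_card[OF this]
    have "card {i \<in> {4..n - 1}. j + 4 \<le> i \<and> j mod 2 = i mod 2} = (n - 3 - j) div 2"
      unfolding card_lessThan by (rule sym)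
    then show "(\<Sum>i=4..n - 1. card (P_all j) * of_bool (j + 4 \<le> i \<and> j mod 2 = i mod 2))
        = card (P_all j) * ((n - 3 - j) div 2)"
      by (simp add: sum_distrib_left[symmetric] Int_def)
  qed simp
  finally show ?thesis .
qed

text \<open>Sequences are sorted by the number of their nonzero terms. The summand 1 is the all-zero
  sequence, so the input values for positive lengths suffice.\<close>

lemma card_D0:
  "card (D0 m) = 1 + (\<Sum>i=1..m. card (D i))"
proof -
  let ?f = "\<lambda>i d. d @ replicate (m - i) (0::nat)"
  have pos: "\<forall>x\<in>set d. 0 < x" if "d \<in> D i" for d i using that by (auto simp: D_def)
  have "D0 m = (\<Union>i\<in>{..m}. ?f i ` D i)"
  proof (intro equalityI subsetI)
    fix ds assume ds: "ds \<in> D0 m"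
    let ?p = "filter ((<) 0) ds"
    have srt: "sorted_wrt (\<ge>) ds" and len: "length ds = m" using ds by (auto simp: D0_iff)
    have eq: "ds = ?f (length ?p) ?p" using sorted_filter_pos[OF srt] len by simp
    then have "sum_list ds = sum_list ?p"
      by (metis add_0_right mult_0_right sum_list_append sum_list_replicate)
    then have "?p \<in> D (length ?p)"
      using ds is_partition_filter_pos[OF srt] by (simp add: D_iff D0_iff_slack)
    moreover have "length ?p \<le> m" using len length_filter_le[of "(<) 0" ds] by simp
    ultimately show "ds \<in> (\<Union>i\<in>{..m}. ?f i ` D i)" using eq by blast
  next
    fix ds assume "ds \<in> (\<Union>i\<in>{..m}. ?f i ` D i)"
    then obtain i d where i: "i \<le> m" "d \<in> D i" "ds = ?f i d" by blast
    have "sorted_wrt (\<ge>) (replicate k (0::nat))" for k by (induction k) auto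
    then have "sorted_wrt (\<ge>) ds" using i by (auto simp: sorted_wrt_append D_iff is_partition_def)
    moreover have "filter ((<) 0) ds = d" using i pos by (simp add: filter_True)
    ultimately show "ds \<in> D0 m" using i by (auto simp: D0_iff_slack D_iff sum_list_replicate)
  qed
  also have "card \<dots> = (\<Sum>i\<in>{..m}. card (?f i ` D i))"
  proof (rule card_UN_disjoint)
    show "\<forall>i\<in>{..m}. \<forall>j\<in>{..m}. i \<noteq> j \<longrightarrow> ?f i ` D i \<inter> ?f j ` D j = {}"
    proof (intro ballI impI)
      fix i j :: nat assume "i \<noteq> j"
      have "filter ((<) 0) (?f i d) = d" if "d \<in> D i" for i d using that pos by (simp add: filter_True)
      then have "d = e" if "?f i d = ?f j e" "d \<in> D i" "e \<in> D j" for d e using that by metis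
      moreover have "length d = i" if "d \<in> D i" for d i using that by (simp add: D_iff)
      ultimately show "?f i ` D i \<inter> ?f j ` D j = {}" using \<open>i \<noteq> j\<close> by blast
    qed
  qed (use finite_D in auto)
  also have "\<dots> = (\<Sum>i\<in>{..m}. card (D i))" by (intro sum.cong card_image) (auto simp: inj_on_def)
  also have "{..m} = insert 0 {1..m}" by auto
  also have "(\<Sum>i\<in>insert 0 {1..m}. card (D i)) = card (D 0) + (\<Sum>i=1..m. card (D i))" by simp
  also have "D 0 = {[]}" by (auto simp: D_iff is_partition_def)
  finally show ?thesis by simp
qed

section \<open>A Hoare logic with running times\<close>

text \<open>Total correctness with a uniform time bound. The accessed locations are left open,
  because \<open>exec_space_le_time\<close> controls their number afterwards.\<close>

definition hoare :: "(state \<Rightarrow> bool) \<Rightarrow> com \<Rightarrow> (state \<Rightarrow> bool) \<Rightarrow> nat \<Rightarrow> bool" where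
  "hoare P c Q T \<longleftrightarrow> (\<forall>s. P s \<longrightarrow> (\<exists>t L s'. exec c s t L s' \<and> t \<le> T \<and> Q s'))"

lemma hoare_seq:
  assumes "hoare P c1 R T1" "hoare R c2 Q T2"
  shows "hoare P (Seq c1 c2) Q (T1 + T2)"
  unfolding hoare_def
proof (intro allI impI)
  fix s assume "P s"
  then obtain t1 L1 s1 where 1: "exec c1 s t1 L1 s1" "t1 \<le> T1" "R s1" using assms(1) unfolding hoare_def by blast
  then obtain t2 L2 s2 where 2: "exec c2 s1 t2 L2 s2" "t2 \<le> T2" "Q s2" using assms(2) unfolding hoare_def by blast
  have "exec (Seq c1 c2) s (t1 + t2) (L1 \<union> L2) s2" using 1 2 by (intro exec.Seq)
  then show "\<exists>t L s'. exec (Seq c1 c2) s t L s' \<and> t \<le> T1 + T2 \<and> Q s'"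
    using 1 2 by (meson add_le_mono)
qed

lemma hoare_weaken: "hoare P c Q T \<Longrightarrow> (\<And>s. Q s \<Longrightarrow> Q' s) \<Longrightarrow> T \<le> T' \<Longrightarrow> hoare P c Q' T'"
  unfolding hoare_def by (meson order_trans)

text \<open>The invariant is indexed by the number of completed rounds, so it also fixes when the
  loop stops; the proof is by induction on the rounds still to come.\<close>

lemma hoare_while:
  assumes body: "\<And>i. i < m \<Longrightarrow> hoare (I i) c (I (Suc i)) T"
    and go: "\<And>i s. i < m \<Longrightarrow> I i s \<Longrightarrow> bval b s" and stop: "\<And>s. I m s \<Longrightarrow> \<not> bval b s"
  shows "hoare (I 0) (While b c) (I m) (m * (bcost b + T) + bcost b)"
proof -
  have "hoare (I (m - i)) (While b c) (I m) (i * (bcost b + T) + bcost b)" if "i \<le> m" for i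
    using that
  proof (induction i)
    case 0
    show ?case unfolding hoare_def using stop exec.WhileFalse by fastforce
  next
    case (Suc i)
    show ?case
      unfolding hoare_def
    proof (intro allI impI)
      fix s assume s: "I (m - Suc i) s"
      have lt: "m - Suc i < m" "Suc (m - Suc i) = m - i" using Suc.prems by auto
      obtain t1 L1 s1 where 1: "exec c s t1 L1 s1" "t1 \<le> T" "I (m - i) s1"
        using body[OF lt(1)] s unfolding hoare_def lt(2) by blast
      obtain t2 L2 s2 where 2: "exec (While b c) s1 t2 L2 s2" "t2 \<le> i * (bcost b + T) + bcost b" "I m s2"
        using Suc.IH Suc.prems 1(3) unfolding hoare_def by auto
      have "exec (While b c) s (bcost b + t1 + t2) (blocs b s \<union> L1 \<union> L2) s2"
        using exec.WhileTrue go[OF lt(1) s] 1(1) 2(1) by blast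
      moreover have "bcost b + t1 + t2 \<le> Suc i * (bcost b + T) + bcost b" using 1(2) 2(2) by simp
      ultimately show "\<exists>t L s'. exec (While b c) s t L s' \<and> t \<le> Suc i * (bcost b + T) + bcost b \<and> I m s'"
        using 2(3) by blast
    qed
  qed
  from this[of m] show ?thesis by simp
qed

fun loop_free :: "com \<Rightarrow> bool" where
  "loop_free (While b c) \<longleftrightarrow> False"
| "loop_free (Seq c1 c2) \<longleftrightarrow> loop_free c1 \<and> loop_free c2"
| "loop_free (Cond b c1 c2) \<longleftrightarrow> loop_free c1 \<and> loop_free c2"
| "loop_free c \<longleftrightarrow> True"

text \<open>An interpreter that the simplifier can evaluate on straight-line code. The
  \<open>While\<close> clause is a dummy value, excluded by \<open>loop_free\<close>; the same holds
  for \<open>max_cost\<close>.\<close>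

fun run :: "com \<Rightarrow> state \<Rightarrow> state" where
  "run Skip s = s"
| "run (Assign x e) s = s(Scalar x := aval e s)"
| "run (Store a i e) s = s(Cell a (aval i s) := aval e s)"
| "run (Seq c1 c2) s = run c2 (run c1 s)"
| "run (Cond b c1 c2) s = (if bval b s then run c1 s else run c2 s)"
| "run (While b c) s = s"

text \<open>Conditionals are charged for both branches: an upper bound that is independent of the
  state and free of maxima.\<close>

fun max_cost :: "com \<Rightarrow> nat" where
  "max_cost Skip = 1"
| "max_cost (Assign x e) = acost e + 1"
| "max_cost (Store a i e) = acost i + acost e + 1"
| "max_cost (Seq c1 c2) = max_cost c1 + max_cost c2"
| "max_cost (Cond b c1 c2) = bcost b + max_cost c1 + max_cost c2"
| "max_cost (While b c) = 0"

lemma exec_run: "loop_free c \<Longrightarrow> \<exists>t L. exec c s t L (run c s) \<and> t \<le> max_cost c"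
proof (induction c arbitrary: s)
  case (Seq c1 c2)
  then obtain t1 L1 t2 L2 where "exec c1 s t1 L1 (run c1 s)" "t1 \<le> max_cost c1"
    "exec c2 (run c1 s) t2 L2 (run c2 (run c1 s))" "t2 \<le> max_cost c2"
    by (meson loop_free.simps(2))
  then show ?case using exec.Seq by (fastforce intro: add_le_mono)
next
  case (Cond b c1 c2)
  show ?case
  proof (cases "bval b s")
    case True
    obtain t L where "exec c1 s t L (run c1 s)" "t \<le> max_cost c1" using Cond by fastforce
    then have "exec (Cond b c1 c2) s (bcost b + t) (blocs b s \<union> L) (run c1 s)" "bcost b + t \<le> max_cost (Cond b c1 c2)"
      using True by (auto intro: exec.CondTrue)
    then show ?thesis using True by auto
  next
    case False
    obtain t L where "exec c2 s t L (run c2 s)" "t \<le> max_cost c2" using Cond by fastforce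
    then have "exec (Cond b c1 c2) s (bcost b + t) (blocs b s \<union> L) (run c2 s)" "bcost b + t \<le> max_cost (Cond b c1 c2)"
      using False by (auto intro: exec.CondFalse)
    then show ?thesis using False by auto
  qed
next
  case Skip
  show ?case using exec.Skip by fastforce
next
  case (Assign x e)
  show ?case unfolding run.simps max_cost.simps by (blast intro: exec.Assign)
next
  case (Store a i e)
  show ?case unfolding run.simps max_cost.simps by (blast intro: exec.Store)
qed simp

lemma hoare_run: "loop_free c \<Longrightarrow> (\<And>s. P s \<Longrightarrow> Q (run c s)) \<Longrightarrow> hoare P c Q (max_cost c)"
  unfolding hoare_def using exec_run by blast

lemma card_alocs_le: "card (alocs e s) \<le> acost e"
proof (induction e)
  case (Arr a i)
  then show ?case using card_insert_le_m1[of "Suc (acost i)" "alocs i s" "Cell a (aval i s)"] by simp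
next
  case (Op f e1 e2)
  then show ?case using card_Un_le[of "alocs e1 s" "alocs e2 s"] by simp
qed auto

lemma card_blocs_le: "card (blocs b s) \<le> bcost b"
proof (cases b)
  case (Cmp f e1 e2)
  then show ?thesis
    using card_alocs_le[of e1 s] card_alocs_le[of e2 s] card_Un_le[of "alocs e1 s" "alocs e2 s"] by simp
qed

lemma card_insert_le_Suc: "card A \<le> m \<Longrightarrow> card (insert x A) \<le> Suc m"
  by (metis card_insert_le_m1 diff_Suc_1 zero_less_Suc)

lemma card_Un_le_add: "card A \<le> a \<Longrightarrow> card B \<le> b \<Longrightarrow> card (A \<union> B) \<le> a + b"
  using card_Un_le[of A B] by linarith

text \<open>Every location that is read or written is paid for, so space is bounded by time.\<close>

lemma exec_space_le_time: "exec c s t L s' \<Longrightarrow> card L \<le> t"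
proof (induction rule: exec.induct)
  case (Assign x e s)
  then show ?case using card_insert_le_Suc[OF card_alocs_le[of e s]] by simp
next
  case (Store a i e s)
  then show ?case
    using card_insert_le_Suc[OF card_Un_le_add[OF card_alocs_le[of i s] card_alocs_le[of e s]]] by simp
qed (auto intro!: card_Un_le_add card_blocs_le)

section \<open>The algorithm\<close>

abbreviation Plus (infixl "\<oplus>" 65) where "a \<oplus> b \<equiv> Op Add a b"
abbreviation Minus (infixl "\<ominus>" 65) where "a \<ominus> b \<equiv> Op Sub a b"
abbreviation Times (infixl "\<otimes>" 70) where "a \<otimes> b \<equiv> Op Mul a b"
abbreviation Quot (infixl "\<oslash>" 70) where "a \<oslash> b \<equiv> Op Div a b"
abbreviation Rem (infixl "\<odot>" 70) where "a \<odot> b \<equiv> Op Mod a b"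
abbreviation Then (infixr ";;" 50) where "c1 ;; c2 \<equiv> Seq c1 c2"
abbreviation Set (infix "::=" 55) where "x ::= e \<equiv> Assign x e"

text \<open>A single counter \<open>t\<close> runs over the whole table and the parameters are
  decoded from it, so one loop replaces nested ones.\<close>

definition decode_com :: com where
  "decode_com = (''z'' ::= Var ''t'' \<odot> Var ''Z'';; ''u'' ::= Var ''t'' \<oslash> Var ''Z'';;
     ''l'' ::= Var ''u'' \<odot> Var ''n'';; ''k'' ::= Var ''u'' \<oslash> Var ''n'')"

text \<open>Going back by n * Z, by Z, or by both leads to the boxes (k - 1, l), (k, l - 1) and (k -
  1, l - 1) with the same slack and parity: the inclusion-exclusion terms.\<close>

definition slack_old :: aexp where
  "slack_old = Arr ''Q'' (Var ''t'' \<ominus> Var ''n'' \<otimes> Var ''Z'') \<oplus> Arr ''Q'' (Var ''t'' \<ominus> Var ''Z'')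
     \<ominus> Arr ''Q'' (Var ''t'' \<ominus> Var ''n'' \<otimes> Var ''Z'' \<ominus> Var ''Z'')"

text \<open>The offset \<open>z\<close> of the smaller box is replaced by \<open>2 * w\<close> plus
  the new parity, where k + l - 1 is the number of dots of the removed hook.\<close>

definition slack_peeled :: aexp where
  "slack_peeled = Arr ''Q'' (Var ''t'' \<ominus> Var ''n'' \<otimes> Var ''Z'' \<ominus> Var ''Z'' \<ominus> Var ''z''
     \<oplus> Const 2 \<otimes> Var ''w'' \<oplus> (Var ''z'' \<oplus> Var ''k'' \<oplus> Var ''l'' \<ominus> Const 1) \<odot> Const 2)"

text \<open>An empty box holds only the empty partition, so the first branch stores 1 for even
  parity and 0 for odd. Otherwise \<open>w\<close> is the slack after removing the hook, capped at
  \<open>S\<close>, the largest tabulated slack.\<close>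

definition slack_entry_com :: com where
  "slack_entry_com = Cond (Cmp Equal (Var ''k'' \<otimes> Var ''l'') (Const 0))
     (Store ''Q'' (Var ''t'') ((Var ''z'' \<oplus> Const 1) \<odot> Const 2))
     (''v'' ::= slack_old;;
      ''w'' ::= Var ''z'' \<oslash> Const 2 \<oplus> Var ''l'' \<ominus> Const 1 \<ominus> Var ''k'';;
      Cond (Cmp Less (Var ''w'') (Const 0)) Skip
        (Cond (Cmp Less (Var ''S'') (Var ''w'')) (''w'' ::= Var ''S'') Skip;;
         ''v'' ::= Var ''v'' \<oplus> slack_peeled);;
      Store ''Q'' (Var ''t'') (Var ''v''))"

definition next_com :: com where
  "next_com = (''t'' ::= Var ''t'' \<oplus> Const 1)"

text \<open>Row \<open>m\<close>, column \<open>j\<close> counts partitions of \<open>j\<close> into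
  parts at most \<open>m\<close>. Going back by \<open>n\<close> lowers the bound on the parts;
  going back by \<open>m\<close> removes one part \<open>m\<close> within the same row.\<close>

definition partition_entry_com :: com where
  "partition_entry_com = (''m'' ::= Var ''t'' \<oslash> Var ''n'';; ''j'' ::= Var ''t'' \<odot> Var ''n'';;
     Cond (Cmp Equal (Var ''m'') (Const 0))
       (Cond (Cmp Equal (Var ''j'') (Const 0)) (Store ''p'' (Var ''t'') (Const 1)) (Store ''p'' (Var ''t'') (Const 0)))
       (''v'' ::= Arr ''p'' (Var ''t'' \<ominus> Var ''n'');;
        Cond (Cmp LessEq (Var ''m'') (Var ''j'')) (''v'' ::= Var ''v'' \<oplus> Arr ''p'' (Var ''t'' \<ominus> Var ''m'')) Skip;;
        Store ''p'' (Var ''t'') (Var ''v'')))"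

definition slack_loop :: com where
  "slack_loop = While (Cmp Less (Var ''t'') (Var ''S'' \<otimes> Var ''Z'')) (decode_com;; slack_entry_com;; next_com)"

definition partition_loop :: com where
  "partition_loop = While (Cmp Less (Var ''t'') (Var ''S'')) (partition_entry_com;; next_com)"

definition D0_loop :: com where
  "D0_loop = While (Cmp LessEq (Var ''i'') (Var ''n'' \<ominus> Const 2))
     (''result'' ::= Var ''result'' \<ominus> Arr ''D'' (Var ''i'');; ''i'' ::= Var ''i'' \<oplus> Const 1)"

text \<open>In row n - 1 the bound on the parts is vacuous for the \<open>j\<close> that occur, so
  the entries are the full partition numbers.\<close>

definition few_edges_loop :: com where
  "few_edges_loop = While (Cmp Less (Var ''j'') (Var ''n'' \<ominus> Const 4))
     (''result'' ::= Var ''result'' \<ominus> Arr ''p'' ((Var ''n'' \<ominus> Const 1) \<otimes> Var ''n'' \<oplus> Var ''j'')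
        \<otimes> ((Var ''n'' \<ominus> Const 3 \<ominus> Var ''j'') \<oslash> Const 2);;
      ''j'' ::= Var ''j'' \<oplus> Const 1)"

text \<open>The offset 3 = 2 * 1 + 1 addresses slack 1 and parity 1. The initial subtraction of 1 is
  the all-zero sequence in D_0(n - 2).\<close>

definition Db_com :: com where
  "Db_com = ((''S'' ::= Var ''n'' \<otimes> Var ''n'';; ''Z'' ::= Const 2 \<otimes> (Var ''S'' \<oplus> Const 1);; ''t'' ::= Const 0);;
     slack_loop;; ''t'' ::= Const 0;; partition_loop;;
     (''result'' ::= Arr ''D'' (Var ''n'') \<ominus> Const 1;; ''i'' ::= Const 1);; D0_loop;;
     (''result'' ::= Var ''result'' \<ominus>
        Arr ''Q'' (((Var ''n'' \<ominus> Const 3) \<otimes> Var ''n'' \<oplus> (Var ''n'' \<ominus> Const 1)) \<otimes> Var ''Z'' \<oplus> Const 3);;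
      ''j'' ::= Const 0);; few_edges_loop)"

section \<open>Loop invariants and correctness of the program\<close>

definition env :: "nat \<Rightarrow> state \<Rightarrow> bool" where
  "env n s \<longleftrightarrow> s (Scalar ''n'') = int n \<and> s (Scalar ''S'') = int (n * n) \<and> s (Scalar ''Z'') = int (width n) \<and>
     (\<forall>i. 1 \<le> i \<and> i \<le> n \<longrightarrow> s (Cell ''D'' (int i)) = int (card (D i)))"

definition slack_filled :: "nat \<Rightarrow> nat \<Rightarrow> state \<Rightarrow> bool" where
  "slack_filled n m s \<longleftrightarrow> env n s \<and> (\<forall>t<m. s (Cell ''Q'' (int t)) = int (slack_table n t))"

definition partition_filled :: "nat \<Rightarrow> nat \<Rightarrow> state \<Rightarrow> bool" where
  "partition_filled n m s \<longleftrightarrow> slack_filled n (n * n * width n) s \<and>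
     (\<forall>t<m. s (Cell ''p'' (int t)) = int (partition_table n t))"

text \<open>Every entry read has a smaller index and is filled already: lowering \<open>k\<close> or
  \<open>l\<close> moves back by at least one block of length \<open>width n\<close>, more than a
  change of the offset inside a block can make up for.\<close>

lemma slack_entry:
  assumes s: "slack_filled n ((k * n + l) * width n + z) s" "s (Scalar ''t'') = int ((k * n + l) * width n + z)"
    and kl: "s (Scalar ''k'') = int k" "s (Scalar ''l'') = int l" "s (Scalar ''z'') = int z"
    and b: "k < n" "l < n" "z < width n"
  shows "slack_filled n (Suc ((k * n + l) * width n + z)) (run slack_entry_com s) \<and>
    run slack_entry_com s (Scalar ''t'') = int ((k * n + l) * width n + z)"
proof -
  define i where "i = (k * n + l) * width n + z"
  have env: "env n s" and Q: "\<And>t. t < i \<Longrightarrow> s (Cell ''Q'' (int t)) = int (slack_table n t)"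
    and t: "s (Scalar ''t'') = int i"
    using s by (auto simp: slack_filled_def i_def)
  have vars: "s (Scalar ''n'') = int n" "s (Scalar ''S'') = int (n * n)" "s (Scalar ''Z'') = int (width n)"
    using env by (auto simp: env_def)
  have W: "0 < width n" by (simp add: width_def)
  \<comment> \<open>The effect is one correct cell; the final values of the scratch variables depend
    on the branch taken and are left existential.\<close>
  have main: "\<exists>v w. run slack_entry_com s = s(Scalar ''v'' := v, Scalar ''w'' := w, Cell ''Q'' (int i) := int (slack_table n i))"
  proof (cases "k = 0 \<or> l = 0")
    case True
    have "int (slack_table n i) = (int z + 1) mod 2"
      unfolding i_def slack_table_index[OF b(2,3)] slack_box_boundary[OF True] by (auto; presburger)
    then have "run slack_entry_com s = s(Cell ''Q'' (int i) := int (slack_table n i))"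
      using True kl t by (auto simp: slack_entry_com_def)
    then show ?thesis by (intro exI[of _ "s (Scalar ''v'')"] exI[of _ "s (Scalar ''w'')"]) simp
  next
    case False
    then obtain k' l' where kl': "k = Suc k'" "l = Suc l'" by (metis not0_implies_Suc)
    let ?W = "width n"
    define w where "w = int (z div 2) + int l' - int (Suc k')"
    define y where "y = 2 * nat (min w (int (n * n))) + (z + Suc k' + l') mod 2"
    let ?a = "(k' * n + Suc l') * ?W + z" and ?b = "(Suc k' * n + l') * ?W + z"
      and ?c = "(k' * n + l') * ?W + z" and ?d = "(k' * n + l') * ?W + y"
    define v where "v = int (slack_table n ?a) + int (slack_table n ?b) - int (slack_table n ?c)"
    have rec: "int (slack_table n i) = v + (if w < 0 then 0 else int (slack_table n ?d))"
      unfolding i_def kl' v_def w_def y_def by (rule slack_table_rec) (use b kl' in auto)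
    have old: "aval slack_old s = v"
    proof -
      have idx: "int i - int n * int ?W = int ?a" "int i - int ?W = int ?b" "int ?a - int ?W = int ?c"
        unfolding i_def kl' by (simp_all add: algebra_simps)
      have "?a < i" "?b < i" "?c < i" using W b unfolding i_def kl' by (simp_all add: algebra_simps)
      then show ?thesis
        unfolding slack_old_def aval.simps arith_val.simps t vars idx v_def by (simp only: Q)
    qed
    have peeled: "aval slack_peeled s' = int (slack_table n ?d)"
      if w0: "0 \<le> w" and s': "s' (Scalar ''w'') = min w (int (n * n))" "\<And>l. l \<noteq> Scalar ''v'' \<Longrightarrow> l \<noteq> Scalar ''w'' \<Longrightarrow> s' l = s l" for s'
    proof -
      have par: "(int z + int k + int l - 1) mod 2 = int ((z + Suc k' + l') mod 2)"
        unfolding kl' zmod_int by (simp add: algebra_simps)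
      have "int (nat (min w (int (n * n)))) = min w (int (n * n))" using w0 by simp
      then have idx: "int i - int n * int ?W - int ?W - int z + 2 * min w (int (n * n)) + (int z + int k + int l - 1) mod 2 = int ?d"
        unfolding par unfolding i_def kl' y_def by (simp add: algebra_simps)
      \<comment> \<open>The capped slack keeps the new offset inside its block, which places the
        entry before index \<open>i\<close>.\<close>
      have "y < ?W"
      proof -
        have "nat (min w (int (n * n))) \<le> n * n" by linarith
        moreover have "(z + Suc k' + l') mod 2 < 2" by simp
        ultimately show ?thesis unfolding y_def by (rule double_add_less_width)
      qed
      then have "?d < i" unfolding i_def kl' by (simp add: algebra_simps)
      then have "s (Cell ''Q'' (int ?d)) = int (slack_table n ?d)" by (rule Q)
      moreover have "s' (Scalar ''t'') = int i" "s' (Scalar ''n'') = int n" "s' (Scalar ''Z'') = int ?W"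
        "s' (Scalar ''z'') = int z" "s' (Scalar ''k'') = int k" "s' (Scalar ''l'') = int l"
        "\<And>a x. s' (Cell a x) = s (Cell a x)"
        using t vars kl s'(2) by simp_all
      ultimately show ?thesis
        unfolding slack_peeled_def aval.simps arith_val.simps using s'(1) idx by (simp only:)
    qed
    have wv: "int z div 2 + int l - 1 - int k = w" unfolding w_def kl' by (simp add: zdiv_int)
    show ?thesis
    proof (cases "w < 0")
      case True
      then have "run slack_entry_com s = s(Scalar ''v'' := v, Scalar ''w'' := w, Cell ''Q'' (int i) := int (slack_table n i))"
        using False kl t wv rec by (simp add: slack_entry_com_def old)
      then show ?thesis by blast
    next
      case w: False
      define c where "c = min w (int (n * n))"
      have ap: "aval slack_peeled (s(Scalar ''v'' := v, Scalar ''w'' := c)) = int (slack_table n ?d)"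
        using w by (intro peeled) (auto simp: c_def)
      have "run slack_entry_com s = s(Scalar ''v'' := int (slack_table n i), Scalar ''w'' := c, Cell ''Q'' (int i) := int (slack_table n i))"
      proof (cases "int (n * n) < w")
        case True
        then have "c = int n * int n" by (simp add: c_def)
        then show ?thesis using False True kl t wv rec w vars ap
          by (simp add: slack_entry_com_def old) (simp add: fun_eq_iff)
      next
        case le: False
        then have "c = w" by (simp add: c_def)
        then show ?thesis using False le kl t wv rec w vars ap
          by (simp add: slack_entry_com_def old) (simp add: fun_eq_iff)
      qed
      then show ?thesis by blast
    qed
  qed
  then obtain v w where r: "run slack_entry_com s = s(Scalar ''v'' := v, Scalar ''w'' := w, Cell ''Q'' (int i) := int (slack_table n i))"
    by blast
  show ?thesis
    unfolding r i_def[symmetric] slack_filled_def env_def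
    using env t Q by (auto simp: env_def less_Suc_eq)
qed

lemma slack_loop_step:
  assumes n: "n \<ge> 5" and i: "i < n * n * width n"
  shows "hoare (\<lambda>s. slack_filled n i s \<and> s (Scalar ''t'') = int i) (decode_com;; slack_entry_com;; next_com)
    (\<lambda>s. slack_filled n (Suc i) s \<and> s (Scalar ''t'') = int (Suc i))
    (max_cost (decode_com;; slack_entry_com;; next_com))"
proof (rule hoare_run)
  show "loop_free (decode_com;; slack_entry_com;; next_com)"
    by (simp add: decode_com_def slack_entry_com_def next_com_def)
  fix s assume s: "slack_filled n i s \<and> s (Scalar ''t'') = int i"
  define z u where "z = i mod width n" and "u = i div width n"
  define l k where "l = u mod n" and "k = u div n"
  have W: "0 < width n" by (simp add: width_def)
  have "u < n * n" unfolding u_def using i by (simp add: less_mult_imp_div_less)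
  then have b: "k < n" "l < n" "z < width n"
    using n W by (simp_all add: k_def l_def z_def less_mult_imp_div_less)
  have eq: "(k * n + l) * width n + z = i" by (simp add: k_def l_def z_def u_def)
  let ?s = "run decode_com s"
  have vars: "s (Scalar ''n'') = int n" "s (Scalar ''Z'') = int (width n)"
    using s by (auto simp: slack_filled_def env_def)
  have "?s (Scalar ''k'') = int k" "?s (Scalar ''l'') = int l" "?s (Scalar ''z'') = int z"
    using s vars by (simp_all add: decode_com_def k_def l_def z_def u_def zmod_int zdiv_int)
  moreover have "slack_filled n i ?s" "?s (Scalar ''t'') = int i"
    using s by (auto simp: decode_com_def slack_filled_def env_def)
  ultimately have "slack_filled n (Suc i) (run slack_entry_com ?s) \<and> run slack_entry_com ?s (Scalar ''t'') = int i"
    using slack_entry[of n k l z ?s] b unfolding eq by blast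
  then show "slack_filled n (Suc i) (run (decode_com;; slack_entry_com;; next_com) s) \<and>
      run (decode_com;; slack_entry_com;; next_com) s (Scalar ''t'') = int (Suc i)"
    by (simp add: next_com_def slack_filled_def env_def)
qed

lemma partition_loop_step:
  assumes n: "n \<ge> 5" and i: "i < n * n"
  shows "hoare (\<lambda>s. partition_filled n i s \<and> s (Scalar ''t'') = int i) (partition_entry_com;; next_com)
    (\<lambda>s. partition_filled n (Suc i) s \<and> s (Scalar ''t'') = int (Suc i))
    (max_cost (partition_entry_com;; next_com))"
proof (rule hoare_run)
  show "loop_free (partition_entry_com;; next_com)"
    by (simp add: partition_entry_com_def next_com_def)
  fix s assume s: "partition_filled n i s \<and> s (Scalar ''t'') = int i"
  define m j where "m = i div n" and "j = i mod n"
  have b: "j < n" using n by (simp add: j_def)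
  have eq: "i = m * n + j" by (simp add: m_def j_def)
  have t: "s (Scalar ''t'') = int i" and nn: "s (Scalar ''n'') = int n"
    and p: "\<And>t. t < i \<Longrightarrow> s (Cell ''p'' (int t)) = int (partition_table n t)"
    using s by (auto simp: partition_filled_def slack_filled_def env_def)
  have dm: "int i div int n = int m" "int i mod int n = int j"
    by (simp_all add: m_def j_def zmod_int zdiv_int)
  have "\<exists>v. run partition_entry_com s = s(Scalar ''m'' := int m, Scalar ''j'' := int j, Scalar ''v'' := v,
      Cell ''p'' (int i) := int (partition_table n i))"
  proof (cases m)
    case 0
    have "int (partition_table n i) = (if j = 0 then 1 else 0)"
      unfolding eq partition_table_index[OF b] 0 partitions_upto_0 by simp
    then have "run partition_entry_com s = s(Scalar ''m'' := int m, Scalar ''j'' := int j,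
        Cell ''p'' (int i) := int (partition_table n i))"
      using 0 t nn dm by (simp add: partition_entry_com_def)
    then show ?thesis by (intro exI[of _ "s (Scalar ''v'')"]) (auto simp: fun_eq_iff)
  next
    case (Suc m')
    let ?a = "m' * n + j" and ?b = "Suc m' * n + (j - Suc m')"
    have m0: "m \<noteq> 0" using Suc by simp
    have idx: "int i - int n = int ?a" unfolding eq Suc by simp
    have "?a < i" using n unfolding eq Suc by simp
    then have pa: "s (Cell ''p'' (int i - int n)) = int (partition_table n ?a)" unfolding idx by (rule p)
    have pb: "s (Cell ''p'' (int i - int m)) = int (partition_table n ?b)" if "m \<le> j"
    proof -
      have idx: "int i - int m = int ?b" using that unfolding eq Suc by (simp add: of_nat_diff)
      have "?b < i" using that unfolding eq Suc by simp
      then show ?thesis unfolding idx by (rule p)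
    qed
    have rec: "int (partition_table n i) = int (partition_table n ?a) + (if m \<le> j then int (partition_table n ?b) else 0)"
    proof -
      have jm: "j - Suc m' < n" using b by simp
      show ?thesis
        unfolding eq Suc partition_table_index[OF b] partition_table_index[OF jm]
        by (subst card_partitions_upto_Suc) simp
    qed
    have "run partition_entry_com s = s(Scalar ''m'' := int m, Scalar ''j'' := int j,
        Scalar ''v'' := int (partition_table n i), Cell ''p'' (int i) := int (partition_table n i))"
    proof (cases "m \<le> j")
      case True
      then show ?thesis using m0 t nn dm by (simp add: partition_entry_com_def pa pb rec)
    next
      case False
      then show ?thesis using m0 t nn dm by (simp add: partition_entry_com_def pa rec)
    qed
    then show ?thesis by blast
  qed
  then obtain v where r: "run partition_entry_com s = s(Scalar ''m'' := int m, Scalar ''j'' := int j, Scalar ''v'' := v,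
      Cell ''p'' (int i) := int (partition_table n i))" by blast
  show "partition_filled n (Suc i) (run (partition_entry_com;; next_com) s) \<and>
      run (partition_entry_com;; next_com) s (Scalar ''t'') = int (Suc i)"
    unfolding run.simps r using s
    by (auto simp: next_com_def partition_filled_def slack_filled_def env_def less_Suc_eq)
qed

definition tables :: "nat \<Rightarrow> state \<Rightarrow> bool" where
  "tables n s \<longleftrightarrow> partition_filled n (n * n) s"

lemma hoare_Db_com:
  assumes n: "n \<ge> 5"
  shows "hoare (\<lambda>s. s = input n) Db_com (\<lambda>s. s (Scalar ''result'') = int (card (Db n))) (10000 * n ^ 5)"
proof -
  let ?W = "width n"
  \<comment> \<open>\<open>r1 x\<close> and \<open>r2 x\<close> are the values of
    \<open>result\<close> after \<open>x\<close> rounds of the two subtraction loops. They are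
    integers, so no intermediate value has to be shown nonnegative.\<close>
  define r1 where "r1 x = int (card (D n)) - 1 - (\<Sum>y=1..x. int (card (D y)))" for x
  define r2 where "r2 x = r1 (n - 2) - int (card (slack_box (n - 3) (n - 1) 1 1))
    - (\<Sum>j<x. int (card (P_all j) * ((n - 3 - j) div 2)))" for x
  have h1: "hoare (\<lambda>s. s = input n) (''S'' ::= Var ''n'' \<otimes> Var ''n'';; ''Z'' ::= Const 2 \<otimes> (Var ''S'' \<oplus> Const 1);; ''t'' ::= Const 0)
      (\<lambda>s. slack_filled n 0 s \<and> s (Scalar ''t'') = int 0)
      (max_cost (''S'' ::= Var ''n'' \<otimes> Var ''n'';; ''Z'' ::= Const 2 \<otimes> (Var ''S'' \<oplus> Const 1);; ''t'' ::= Const 0))"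
    by (rule hoare_run) (auto simp: slack_filled_def env_def input_def width_def)
  have h2: "hoare (\<lambda>s. slack_filled n 0 s \<and> s (Scalar ''t'') = int 0) slack_loop
      (\<lambda>s. slack_filled n (n * n * ?W) s \<and> s (Scalar ''t'') = int (n * n * ?W))
      (n * n * ?W * (bcost (Cmp Less (Var ''t'') (Var ''S'' \<otimes> Var ''Z'')) + max_cost (decode_com;; slack_entry_com;; next_com))
        + bcost (Cmp Less (Var ''t'') (Var ''S'' \<otimes> Var ''Z'')))"
    unfolding slack_loop_def
  proof (rule hoare_while[of _ "\<lambda>i s. slack_filled n i s \<and> s (Scalar ''t'') = int i"])
    have lim: "bval (Cmp Less (Var ''t'') (Var ''S'' \<otimes> Var ''Z'')) s \<longleftrightarrow> i < n * n * ?W"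
      if "slack_filled n i s \<and> s (Scalar ''t'') = int i" for i s
    proof -
      have "s (Scalar ''S'') * s (Scalar ''Z'') = int (n * n * ?W)" "s (Scalar ''t'') = int i"
        using that by (auto simp: slack_filled_def env_def)
      then show ?thesis by (simp only: bval.simps aval.simps arith_val.simps cmp_val.simps of_nat_less_iff)
    qed
    show "bval (Cmp Less (Var ''t'') (Var ''S'' \<otimes> Var ''Z'')) s"
      if "i < n * n * ?W" "slack_filled n i s \<and> s (Scalar ''t'') = int i" for i s
      using lim that by blast
    show "\<not> bval (Cmp Less (Var ''t'') (Var ''S'' \<otimes> Var ''Z'')) s"
      if "slack_filled n (n * n * ?W) s \<and> s (Scalar ''t'') = int (n * n * ?W)" for s
      using lim that by blast
  qed (rule slack_loop_step[OF n])
  have h3: "hoare (\<lambda>s. slack_filled n (n * n * ?W) s \<and> s (Scalar ''t'') = int (n * n * ?W)) (''t'' ::= Const 0)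
      (\<lambda>s. partition_filled n 0 s \<and> s (Scalar ''t'') = int 0) (max_cost (''t'' ::= Const 0))"
    by (rule hoare_run) (auto simp: partition_filled_def slack_filled_def env_def)
  have h4: "hoare (\<lambda>s. partition_filled n 0 s \<and> s (Scalar ''t'') = int 0) partition_loop
      (\<lambda>s. partition_filled n (n * n) s \<and> s (Scalar ''t'') = int (n * n))
      (n * n * (bcost (Cmp Less (Var ''t'') (Var ''S'')) + max_cost (partition_entry_com;; next_com))
        + bcost (Cmp Less (Var ''t'') (Var ''S'')))"
    unfolding partition_loop_def
  proof (rule hoare_while[of _ "\<lambda>i s. partition_filled n i s \<and> s (Scalar ''t'') = int i"])
    have lim: "bval (Cmp Less (Var ''t'') (Var ''S'')) s \<longleftrightarrow> i < n * n"
      if "partition_filled n i s \<and> s (Scalar ''t'') = int i" for i s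
    proof -
      have "s (Scalar ''S'') = int (n * n)" "s (Scalar ''t'') = int i"
        using that by (auto simp: partition_filled_def slack_filled_def env_def)
      then show ?thesis by (simp only: bval.simps aval.simps cmp_val.simps of_nat_less_iff)
    qed
    show "bval (Cmp Less (Var ''t'') (Var ''S'')) s"
      if "i < n * n" "partition_filled n i s \<and> s (Scalar ''t'') = int i" for i s
      using lim that by blast
    show "\<not> bval (Cmp Less (Var ''t'') (Var ''S'')) s"
      if "partition_filled n (n * n) s \<and> s (Scalar ''t'') = int (n * n)" for s
      using lim that by blast
  qed (rule partition_loop_step[OF n])
  let ?I = "\<lambda>x s. tables n s \<and> s (Scalar ''i'') = int x + 1 \<and> s (Scalar ''result'') = r1 x"
  have h5: "hoare (\<lambda>s. partition_filled n (n * n) s \<and> s (Scalar ''t'') = int (n * n))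
      (''result'' ::= Arr ''D'' (Var ''n'') \<ominus> Const 1;; ''i'' ::= Const 1) (?I 0)
      (max_cost (''result'' ::= Arr ''D'' (Var ''n'') \<ominus> Const 1;; ''i'' ::= Const 1))"
    using n by (intro hoare_run) (auto simp: tables_def partition_filled_def slack_filled_def env_def r1_def)
  have h6: "hoare (?I 0) D0_loop (?I (n - 2))
      ((n - 2) * (bcost (Cmp LessEq (Var ''i'') (Var ''n'' \<ominus> Const 2)) + max_cost (''result'' ::= Var ''result'' \<ominus> Arr ''D'' (Var ''i'');; ''i'' ::= Var ''i'' \<oplus> Const 1))
        + bcost (Cmp LessEq (Var ''i'') (Var ''n'' \<ominus> Const 2)))"
    unfolding D0_loop_def
  proof (rule hoare_while)
    fix x assume x: "x < n - 2"
    show "hoare (?I x) (''result'' ::= Var ''result'' \<ominus> Arr ''D'' (Var ''i'');; ''i'' ::= Var ''i'' \<oplus> Const 1) (?I (Suc x))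
       (max_cost (''result'' ::= Var ''result'' \<ominus> Arr ''D'' (Var ''i'');; ''i'' ::= Var ''i'' \<oplus> Const 1))"
    proof (rule hoare_run)
      fix s assume s: "?I x s"
      then have "\<forall>i. 1 \<le> i \<and> i \<le> n \<longrightarrow> s (Cell ''D'' (int i)) = int (card (D i))"
        unfolding tables_def partition_filled_def slack_filled_def env_def by blast
      from this[rule_format, of "Suc x"] have "s (Cell ''D'' (int x + 1)) = int (card (D (Suc x)))"
        using x by (simp add: add.commute)
      then show "?I (Suc x) (run (''result'' ::= Var ''result'' \<ominus> Arr ''D'' (Var ''i'');; ''i'' ::= Var ''i'' \<oplus> Const 1) s)"
        using s by (auto simp: tables_def partition_filled_def slack_filled_def env_def r1_def)
    qed simp
  qed (use n in \<open>auto simp: tables_def partition_filled_def slack_filled_def env_def of_nat_diff\<close>)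
  let ?J = "\<lambda>x s. tables n s \<and> s (Scalar ''j'') = int x \<and> s (Scalar ''result'') = r2 x"
  let ?c7 = "''result'' ::= Var ''result'' \<ominus>
        Arr ''Q'' (((Var ''n'' \<ominus> Const 3) \<otimes> Var ''n'' \<oplus> (Var ''n'' \<ominus> Const 1)) \<otimes> Var ''Z'' \<oplus> Const 3);; ''j'' ::= Const 0"
  have h7: "hoare (?I (n - 2)) ?c7 (?J 0) (max_cost ?c7)"
  proof (rule hoare_run)
    fix s assume s: "?I (n - 2) s"
    let ?t = "((n - 3) * n + (n - 1)) * ?W + 3"
    \<comment> \<open>The offset 3 has to stay below the block length for
      \<open>slack_table_index\<close> to decode it.\<close>
    have "5 * 5 \<le> n * n" using n by (intro mult_le_mono) auto
    then have W: "3 < ?W" by (simp add: width_def)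
    have vars: "s (Scalar ''n'') = int n" "s (Scalar ''Z'') = int ?W"
      using s by (auto simp: tables_def partition_filled_def slack_filled_def env_def)
    have "((int n - 3) * int n + (int n - 1)) * int ?W + 3 = int ?t"
      using n by (simp add: of_nat_diff)
    moreover have "?t < n * n * ?W"
    proof -
      have "(n - 3) * n \<le> (n - 1) * n" by (rule mult_le_mono1) simp
      moreover have "(n - 1) * n + n = n * n" by (cases n) auto
      ultimately have "(n - 3) * n + (n - 1) + 1 \<le> n * n" using n by linarith
      then have "((n - 3) * n + (n - 1) + 1) * ?W \<le> n * n * ?W" by (rule mult_le_mono1)
      then show ?thesis using W by (simp add: add_mult_distrib)
    qed
    then have "s (Cell ''Q'' (int ?t)) = int (slack_table n ?t)"
      using s by (auto simp: tables_def partition_filled_def slack_filled_def)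
    moreover have "slack_table n ?t = card (slack_box (n - 3) (n - 1) 1 1)"
      using slack_table_index[of "n - 1" n 3 "n - 3"] n W by simp
    ultimately show "?J 0 (run ?c7 s)"
      using s vars by (auto simp: tables_def partition_filled_def slack_filled_def env_def r2_def)
  qed simp
  have h8: "hoare (?J 0) few_edges_loop (?J (n - 4))
      ((n - 4) * (bcost (Cmp Less (Var ''j'') (Var ''n'' \<ominus> Const 4)) + max_cost (''result'' ::= Var ''result'' \<ominus> Arr ''p'' ((Var ''n'' \<ominus> Const 1) \<otimes> Var ''n'' \<oplus> Var ''j'')
        \<otimes> ((Var ''n'' \<ominus> Const 3 \<ominus> Var ''j'') \<oslash> Const 2);; ''j'' ::= Var ''j'' \<oplus> Const 1))
        + bcost (Cmp Less (Var ''j'') (Var ''n'' \<ominus> Const 4)))"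
    unfolding few_edges_loop_def
  proof (rule hoare_while)
    fix x assume x: "x < n - 4"
    let ?c = "''result'' ::= Var ''result'' \<ominus> Arr ''p'' ((Var ''n'' \<ominus> Const 1) \<otimes> Var ''n'' \<oplus> Var ''j'')
        \<otimes> ((Var ''n'' \<ominus> Const 3 \<ominus> Var ''j'') \<oslash> Const 2);; ''j'' ::= Var ''j'' \<oplus> Const 1"
    show "hoare (?J x) ?c (?J (Suc x)) (max_cost ?c)"
    proof (rule hoare_run)
      fix s assume s: "?J x s"
      let ?t = "(n - 1) * n + x"
      have "(n - 1) * n + n = n * n" by (cases n) auto
      then have "?t < n * n" using x by linarith
      then have "s (Cell ''p'' (int ?t)) = int (partition_table n ?t)"
        using s by (auto simp: tables_def partition_filled_def)
      moreover have "partition_table n ?t = card (P_all x)"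
        using x by (simp add: partition_table_index partitions_upto_eq_P_all)
      ultimately have "s (Cell ''p'' (int ?t)) = int (card (P_all x))" by (simp only:)
      moreover have "int ?t = (int n - 1) * int n + int x" using n by (simp add: of_nat_diff)
      ultimately have p: "s (Cell ''p'' ((int n - 1) * int n + int x)) = int (card (P_all x))" by (simp only:)
      have "(int n - 3 - int x) div 2 = int ((n - 3 - x) div 2)" using x by (simp add: zdiv_int of_nat_diff)
      then show "?J (Suc x) (run ?c s)"
        using s p by (auto simp: tables_def partition_filled_def slack_filled_def env_def r2_def)
    qed simp
  qed (use n in \<open>auto simp: tables_def partition_filled_def slack_filled_def env_def of_nat_diff\<close>)
  note h = hoare_seq[OF h1 hoare_seq[OF h2 hoare_seq[OF h3 hoare_seq[OF h4 hoare_seq[OF h5 hoare_seq[OF h6 hoare_seq[OF h7 h8]]]]]]]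
  have r2: "r2 (n - 4) = int (card (Db n))"
  proof -
    have "int (card (D n)) = int (card (Db n)) + int (card (D0 (n - 2))) + int (card (slack_box (n - 3) (n - 1) 1 1))
        + int (\<Sum>j<n - 4. card (P_all j) * ((n - 3 - j) div 2))"
      unfolding card_Db[OF n] sum_P_all[OF n] by simp
    moreover have "int (card (D0 (n - 2))) = 1 + (\<Sum>y=1..n - 2. int (card (D y)))" by (simp add: card_D0)
    ultimately show ?thesis by (simp add: r2_def r1_def)
  qed
  \<comment> \<open>The slack table dominates the running time with 2 n^4 + 2 n^2 entries.\<close>
  have X: "n * n * ?W \<le> 4 * n ^ 5" "n * n \<le> n ^ 5" "n \<le> n ^ 5" "1 \<le> n ^ 5"
  proof -
    have pow: "n ^ a \<le> n ^ 5" if "a \<le> 5" for a using n that by (intro power_increasing) auto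
    from pow[of 0] show "1 \<le> n ^ 5" by simp
    from pow[of 1] show "n \<le> n ^ 5" by simp
    from pow[of 2] show n2: "n * n \<le> n ^ 5" by (simp add: power2_eq_square)
    have "n * n * ?W = 2 * n ^ 4 + 2 * (n * n)"
      by (simp add: width_def algebra_simps power4_eq_xxxx)
    then show "n * n * ?W \<le> 4 * n ^ 5" using pow[of 4] n2 by linarith
  qed
  \<comment> \<open>The nested sum has the shape produced by the chain of \<open>hoare_seq\<close>.
    The costs of the pieces stay symbolic until the end, where they are evaluated and compared with
    the generous constant 10000.\<close>
  have bound: "a1 + ((x * k1 + a2) + (a3 + ((y * k2 + a4) + (a5 + ((u * k3 + a6) + (a7 + (v * k4 + a8)))))))
      \<le> (4 * k1 + k2 + k3 + k4 + a1 + a2 + a3 + a4 + a5 + a6 + a7 + a8) * N"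
    if "x \<le> 4 * N" "y \<le> N" "u \<le> N" "v \<le> N" "1 \<le> N"
    for a1 a2 a3 a4 a5 a6 a7 a8 k1 k2 k3 k4 x y u v N :: nat
  proof -
    have "x * k1 \<le> 4 * k1 * N" "y * k2 \<le> k2 * N" "u * k3 \<le> k3 * N" "v * k4 \<le> k4 * N"
      using mult_le_mono1[OF that(1), of k1] mult_le_mono1[OF that(2), of k2]
        mult_le_mono1[OF that(3), of k3] mult_le_mono1[OF that(4), of k4] by (simp_all add: mult_ac)
    moreover have "a1 + a2 + a3 + a4 + a5 + a6 + a7 + a8 \<le> (a1 + a2 + a3 + a4 + a5 + a6 + a7 + a8) * N"
      using mult_le_mono2[OF that(5), of "a1 + a2 + a3 + a4 + a5 + a6 + a7 + a8"] by (simp only: mult_1_right)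
    ultimately show ?thesis unfolding add_mult_distrib by linarith
  qed
  have "n - 2 \<le> n ^ 5" "n - 4 \<le> n ^ 5" using X(3) by auto
  note b = bound[OF X(1,2) this X(4)]
  show ?thesis
    unfolding Db_com_def
  proof (rule hoare_weaken[OF h])
    show "s (Scalar ''result'') = int (card (Db n))" if "?J (n - 4) s" for s
      using that r2 by simp
  qed (rule order_trans[OF b mult_le_mono1], simp add: decode_com_def slack_entry_com_def next_com_def
      partition_entry_com_def slack_old_def slack_peeled_def)
qed

theorem mainTheorem5:
  shows "(\<forall>n\<ge>5. int (card (Db n)) =
            int (card (D n)) - int (card (D0 (n - 2)))
            - (\<Sum>N\<in>I_even n. int (card (P_res (N - 2 * int n + 3) (int n - 3) (int n - 1) 1)))
            - (\<Sum>i=4..n - 1. \<Sum>j | j \<le> i - 4 \<and> j mod 2 = i mod 2. int (card (P_all j))))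
       \<and> (\<exists>c time space. computes_Db c time space
            \<and> (\<lambda>n. real (time n)) \<in> O(\<lambda>n. real n ^ 5)
            \<and> (\<lambda>n. real (space n)) \<in> O(\<lambda>n. real n ^ 5))"
proof (intro conjI allI impI)
  fix n :: nat assume n: "n \<ge> 5"
  show "int (card (Db n)) =
            int (card (D n)) - int (card (D0 (n - 2)))
            - (\<Sum>N\<in>I_even n. int (card (P_res (N - 2 * int n + 3) (int n - 3) (int n - 1) 1)))
            - (\<Sum>i=4..n - 1. \<Sum>j | j \<le> i - 4 \<and> j mod 2 = i mod 2. int (card (P_all j)))"
    using card_Db[OF n] sum_card_P_res[OF n, symmetric] by simp
next
  \<comment> \<open>Time and space share one bound by \<open>exec_space_le_time\<close>.\<close>
  have "computes_Db Db_com (\<lambda>n. 10000 * n ^ 5) (\<lambda>n. 10000 * n ^ 5)"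
    using hoare_Db_com exec_space_le_time unfolding computes_Db_def hoare_def by (meson order_trans)
  moreover have "(\<lambda>n. real (10000 * n ^ 5)) \<in> O(\<lambda>n. real n ^ 5)" by simp
  ultimately show "\<exists>c time space. computes_Db c time space
      \<and> (\<lambda>n. real (time n)) \<in> O(\<lambda>n. real n ^ 5) \<and> (\<lambda>n. real (space n)) \<in> O(\<lambda>n. real n ^ 5)"
    by blast
qed

end
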